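(* Let $\widetilde{Y}(\mathfrak g,\mathcal G)^{tw}$ be the subalgebra of $\widetilde Y(\mathfrak g)$ generated by the coefficients of the matrix entries $\sigma_{ij}(u)$ of $\Sigma(u)=\mathcal T(u-\kappa/2)\,\mathcal G(u)\,\mathcal T^t(-u+\kappa/2)$. Then $\widetilde{Y}(\mathfrak g,\mathcal G)^{tw}$ is a subalgebra of $X(\mathfrak g,\mathcal G)^{tw}$, and the quotient homomorphism $X(\mathfrak g,\mathcal G)^{tw}\to Y(\mathfrak g,\mathcal G)^{tw}$ induces an isomorphism between $\widetilde{Y}(\mathfrak g,\mathcal G)^{tw}$ and $Y(\mathfrak g,\mathcal G)^{tw}$. Moreover, $X(\mathfrak g,\mathcal G)^{tw}$ is isomorphic to $W(\mathfrak g,\mathcal G)^{tw}\otimes\widetilde{Y}(\mathfrak g,\mathcal G)^{tw}$.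
   Context: Notation. Tensor products are over $\mathbb C$. $\mathfrak g$ is $\mathfrak{so}_N$ ($N=2n$ or $N=2n+1$) or $\mathfrak{sp}_N$ ($N=2n$), $n\ge1$. Rows and columns of $N\times N$ matrices are indexed by $-n,\dots,-1,1,\dots,n$ if $N=2n$ and by $-n,\dots,n$ (including $0$) if $N=2n+1$. $\theta_{ij}=1$ in the orthogonal case and $\theta_{ij}=\mathrm{sign}(i)\,\mathrm{sign}(j)$ in the symplectic case. The transposition $t$ is $(E_{ij})^t=\theta_{ij}E_{-j,-i}$, and $\mathfrak g=\mathrm{span}\{F_{ij}=E_{ij}-\theta_{ij}E_{-j,-i}\}$. In $\pm,\mp$ the upper sign is for the orthogonal case, the lower for the symplectic case. $\kappa=N/2\mp1$. $P=\sum_{i,j}E_{ij}\otimes E_{ji}$, $Q=\sum_{i,j}\theta_{ij}E_{ij}\otimes E_{-i,-j}$, $R(u)=I-\frac{P}{u}+\frac{Q}{u-\kappa}$. Extended Yangian. $X(\mathfrak g)$ is the associative unital $\mathbb C$-algebra with generators $t_{ij}^{(r)}$, $r\ge 0$, $t_{ij}^{(0)}=\delta_{ij}$, and relations $R(u-v)T_1(u)T_2(v)=T_2(v)T_1(u)R(u-v)$, where $T(u)=\sum_{i,j}E_{ij}\otimes t_{ij}(u)$, $t_{ij}(u)=\sum_{r\ge0}t_{ij}^{(r)}u^{-r}$, and subscripts 1, 2 indicate the copy of $\mathrm{End}\,\mathbb C^N$. One has $T^t(u+\kappa)T(u)=T(u)T^t(u+\kappa)=z(u)I$ for a series $z(u)\in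 1+u^{-1}X(\mathfrak g)[[u^{-1}]]$ with central coefficients. Let $y(u)$ be the unique series with constant term $1$ such that $z(u)=y(u)y(u+\kappa)$. $\widetilde Y(\mathfrak g)$ is the subalgebra of $X(\mathfrak g)$ generated by the coefficients $\tau_{ij}^{(r)}$ of $\tau_{ij}(u)=y(u)^{-1}t_{ij}(u)$ (it is isomorphic to the Yangian of $\mathfrak g$), and $\mathcal T(u)$ is the matrix with entries $\tau_{ij}(u)$. The matrix $\mathcal G=(g_{ij})$ is one of the following. BCD0: $\mathcal G=I$. CI ($\mathfrak g=\mathfrak{sp}_N$) and DIII ($\mathfrak g=\mathfrak{so}_N$, $N$ even): $\mathcal G=\sum_{i=1}^{N/2}(E_{ii}-E_{-i,-i})$. CII ($\mathfrak g=\mathfrak{sp}_N$, $N=p+q$, $p,q$ even, $p\ge q>0$): $\mathcal G=-\sum_{i=1}^{q/2}(E_{ii}+E_{-i,-i})+\sum_{i=q/2+1}^{N/2}(E_{ii}+E_{-i,-i})$. BDI ($\mathfrak g=\mathfrak{so}_N$, $N=p+q$, with $p>q>0$ if $N$ is odd, $p\ge q>0$ if $N$ is even): $\mathcal G=\sum_{i=1}^{(p-q)/2}(E_{ii}+E_{-i,-i})+\sum_{i=(p-q)/2+1}^{N/2}(E_{-i,i}+E_{i,-i})$ for $N$ even, and $\mathcal G=\sum_{i=-(p-q-1)/2}^{(p-q-1)/2}E_{ii}+\sum_{i=(p-q+1)/2}^{(N-1)/2}(E_{-i,i}+E_{i,-i})$ for $N$ odd. Set $\mathcal G(u)=\mathcal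 G$ in types BCD0, CI, DIII and in types BDI, CII with $p=q$; set $\mathcal G(u)=(I-cu\,\mathcal G)(1-cu)^{-1}$, $c=\frac{4}{p-q}$, in types BDI, CII with $p>q$ (expanded in $u^{-1}$). $X(\mathfrak g,\mathcal G)^{tw}$ is the subalgebra of $X(\mathfrak g)$ generated by the coefficients of the entries $s_{ij}(u)$ of $S(u)=T(u-\kappa/2)\,\mathcal G(u)\,T^t(-u+\kappa/2)$. One has $S(u)S(-u)=w(u)I$ where $w(u)$ is an even series in $u^{-1}$ with coefficients central in $X(\mathfrak g,\mathcal G)^{tw}$. $W(\mathfrak g,\mathcal G)^{tw}$ is the commutative algebra generated by the coefficients of $w(u)$. $Y(\mathfrak g,\mathcal G)^{tw}=X(\mathfrak g,\mathcal G)^{tw}/(S(u)S(-u)-I)$, the quotient by the ideal generated by the coefficients of the entries of $S(u)S(-u)-I$. *)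

theory Defs
  imports
    "HOL-Library.Poly_Mapping"
    "HOL-Computational_Algebra.Formal_Laurent_Series"
    "HOL-Algebra.QuotRing"
    "HOL-Algebra.Subrings"
    "HOL-Algebra.Module"
begin

section \<open>Associative unital complex algebras\<close>

text \<open>
  A (noncommutative) complex algebra is represented by a record of type
  \<open>(complex, 'a) module\<close>: a HOL-Algebra ring together with a scalar multiplication.
\<close>

definition csubalg :: "'a set \<Rightarrow> (complex, 'a) module \<Rightarrow> bool" where
  "csubalg B A \<longleftrightarrow> subring B A \<and> (\<forall>c. \<forall>x\<in>B. c \<odot>\<^bsub>A\<^esub> x \<in> B)"

definition subalg_gen :: "(complex, 'a) module \<Rightarrow> 'a set \<Rightarrow> (complex, 'a) module" where
  "subalg_gen A S = A\<lparr>carrier := \<Inter>{B. csubalg B A \<and> S \<subseteq> B}\<rparr>"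

definition quot_alg :: "(complex, 'a) module \<Rightarrow> 'a set \<Rightarrow> (complex, 'a set) module" where
  "quot_alg A J =
     \<lparr>carrier = carrier (A Quot J), mult = (\<otimes>\<^bsub>A Quot J\<^esub>), one = \<one>\<^bsub>A Quot J\<^esub>,
      zero = \<zero>\<^bsub>A Quot J\<^esub>, add = (\<oplus>\<^bsub>A Quot J\<^esub>),
      smult = (\<lambda>c C. \<Union>x\<in>C. J +>\<^bsub>A\<^esub> (c \<odot>\<^bsub>A\<^esub> x))\<rparr>"

definition quot_map :: "(complex, 'a) module \<Rightarrow> 'a set \<Rightarrow> 'a \<Rightarrow> 'a set" where
  "quot_map A J x = J +>\<^bsub>A\<^esub> x"

definition alg_iso :: "(complex, 'a) module \<Rightarrow> (complex, 'b) module \<Rightarrow> ('a \<Rightarrow> 'b) set" where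
  "alg_iso A B = {h \<in> ring_iso A B. \<forall>c. \<forall>x\<in>carrier A. h (c \<odot>\<^bsub>A\<^esub> x) = c \<odot>\<^bsub>B\<^esub> h x}"

text \<open>
  The tensor product over the complex numbers: the free vector space on
  \<open>carrier A \<times> carrier B\<close>, with \<open>(a, b) (a', b') = (a a', b b')\<close> extended bilinearly, modulo
  the bilinearity relations.  The linear span of these relations is stable under multiplication
  by pairs, hence it is the two-sided ideal that they generate.
\<close>

definition pair_alg ::
    "(complex, 'a) module \<Rightarrow> (complex, 'b) module \<Rightarrow> (complex, 'a \<times> 'b \<Rightarrow>\<^sub>0 complex) module" where
  "pair_alg A B =
     \<lparr>carrier = {f. Poly_Mapping.keys f \<subseteq> carrier A \<times> carrier B},
      mult = (\<lambda>f g. \<Sum>p\<in>Poly_Mapping.keys f. \<Sum>q\<in>Poly_Mapping.keys g.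
                Poly_Mapping.single (fst p \<otimes>\<^bsub>A\<^esub> fst q, snd p \<otimes>\<^bsub>B\<^esub> snd q)
                  (Poly_Mapping.lookup f p * Poly_Mapping.lookup g q)),
      one = Poly_Mapping.single (\<one>\<^bsub>A\<^esub>, \<one>\<^bsub>B\<^esub>) 1,
      zero = 0, add = (+),
      smult = (\<lambda>c. Poly_Mapping.map ((*) c))\<rparr>"

definition bilin_rels ::
    "(complex, 'a) module \<Rightarrow> (complex, 'b) module \<Rightarrow> ('a \<times> 'b \<Rightarrow>\<^sub>0 complex) set" where
  "bilin_rels A B =
     {Poly_Mapping.single (a \<oplus>\<^bsub>A\<^esub> a', b) 1 - Poly_Mapping.single (a, b) 1
        - Poly_Mapping.single (a', b) 1 | a a' b.
        a \<in> carrier A \<and> a' \<in> carrier A \<and> b \<in> carrier B}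
   \<union> {Poly_Mapping.single (a, b \<oplus>\<^bsub>B\<^esub> b') 1 - Poly_Mapping.single (a, b) 1
        - Poly_Mapping.single (a, b') 1 | a b b'.
        a \<in> carrier A \<and> b \<in> carrier B \<and> b' \<in> carrier B}
   \<union> {Poly_Mapping.single (c \<odot>\<^bsub>A\<^esub> a, b) 1 - Poly_Mapping.single (a, b) c | c a b.
        a \<in> carrier A \<and> b \<in> carrier B}
   \<union> {Poly_Mapping.single (a, c \<odot>\<^bsub>B\<^esub> b) 1 - Poly_Mapping.single (a, b) c | c a b.
        a \<in> carrier A \<and> b \<in> carrier B}"

definition tensor_alg ::
    "(complex, 'a) module \<Rightarrow> (complex, 'b) module \<Rightarrow>
     (complex, ('a \<times> 'b \<Rightarrow>\<^sub>0 complex) set) module" where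
  "tensor_alg A B = quot_alg (pair_alg A B) (Idl\<^bsub>pair_alg A B\<^esub> (bilin_rels A B))"

section \<open>Power series in the inverse of \<open>u\<close> and matrices\<close>

text \<open>A series is the function mapping \<open>r\<close> to the coefficient of the \<open>r\<close>-th power of \<open>1/u\<close>.\<close>

definition ser_alg :: "(complex, 'a) module \<Rightarrow> (complex, nat \<Rightarrow> 'a) module" where
  "ser_alg A =
     \<lparr>carrier = {f. \<forall>r. f r \<in> carrier A},
      mult = (\<lambda>f g n. \<Oplus>\<^bsub>A\<^esub>k\<in>{..n}. f k \<otimes>\<^bsub>A\<^esub> g (n - k)),
      one = (\<lambda>n. if n = 0 then \<one>\<^bsub>A\<^esub> else \<zero>\<^bsub>A\<^esub>),
      zero = (\<lambda>n. \<zero>\<^bsub>A\<^esub>),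
      add = (\<lambda>f g n. f n \<oplus>\<^bsub>A\<^esub> g n),
      smult = (\<lambda>c f n. c \<odot>\<^bsub>A\<^esub> f n)\<rparr>"

text \<open>
  \<open>ser_subst A b a f\<close> is \<open>f(b u + a)\<close>, for nonzero \<open>b\<close>: with \<open>x = 1/u\<close> one has
  \<open>1/(b u + a) = x/(b + a x)\<close>.
\<close>

definition ser_subst :: "(complex, 'a) module \<Rightarrow> complex \<Rightarrow> complex \<Rightarrow> (nat \<Rightarrow> 'a) \<Rightarrow> nat \<Rightarrow> 'a" where
  "ser_subst A b a f = (\<lambda>m. \<Oplus>\<^bsub>A\<^esub>r\<in>{..m}.
     fps_nth ((fps_X / (fps_const b + fps_const a * fps_X)) ^ r) m \<odot>\<^bsub>A\<^esub> f r)"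

type_synonym 'a imat = "int \<Rightarrow> int \<Rightarrow> 'a"

definition mat_mult :: "('a, 'm) ring_scheme \<Rightarrow> int set \<Rightarrow> 'a imat \<Rightarrow> 'a imat \<Rightarrow> 'a imat" where
  "mat_mult R I M M' = (\<lambda>i j. \<Oplus>\<^bsub>R\<^esub>k\<in>I. M i k \<otimes>\<^bsub>R\<^esub> M' k j)"

definition mat_scalar :: "('a, 'm) ring_scheme \<Rightarrow> 'a \<Rightarrow> 'a imat" where
  "mat_scalar R z = (\<lambda>i j. if i = j then z else \<zero>\<^bsub>R\<^esub>)"

definition mat_coeffs :: "int set \<Rightarrow> (nat \<Rightarrow> 'a) imat \<Rightarrow> 'a set" where
  "mat_coeffs I M = {M i j r | i j r. i \<in> I \<and> j \<in> I}"

section \<open>Orthogonal and symplectic data\<close>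

datatype lie_type = SO nat | SP nat

fun lie_dim :: "lie_type \<Rightarrow> nat" where
  "lie_dim (SO N) = N"
| "lie_dim (SP N) = N"

fun lie_valid :: "lie_type \<Rightarrow> bool" where
  "lie_valid (SO N) \<longleftrightarrow> N \<ge> 2"
| "lie_valid (SP N) \<longleftrightarrow> N \<ge> 2 \<and> even N"

definition idx :: "lie_type \<Rightarrow> int set" where
  "idx g = (let n = int (lie_dim g div 2) in
     if even (lie_dim g) then {-n..n} - {0} else {-n..n})"

fun theta :: "lie_type \<Rightarrow> int \<Rightarrow> int \<Rightarrow> complex" where
  "theta (SO N) i j = 1"
| "theta (SP N) i j = of_int (sgn i * sgn j)"

fun kappa :: "lie_type \<Rightarrow> complex" where
  "kappa (SO N) = of_nat N / 2 - 1"
| "kappa (SP N) = of_nat N / 2 + 1"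

text \<open>
  The transposition sends \<open>E\<^sub>i\<^sub>j\<close> to \<open>theta i j\<close> times the matrix unit at \<open>(-j, -i)\<close>; so the entry
  of the transpose at \<open>(a, b)\<close> comes from \<open>(i, j) = (-b, -a)\<close>.
\<close>

definition mat_transp ::
    "lie_type \<Rightarrow> (complex, 'a) module \<Rightarrow> (nat \<Rightarrow> 'a) imat \<Rightarrow> (nat \<Rightarrow> 'a) imat" where
  "mat_transp g A M = (\<lambda>a b. theta g (-b) (-a) \<odot>\<^bsub>ser_alg A\<^esub> M (-b) (-a))"

section \<open>The extended Yangian\<close>

text \<open>
  The free algebra on the letters \<open>(i, j, r)\<close>, standing for the generator with lower indices
  \<open>i, j\<close> and upper index \<open>r\<close>: the monoid algebra of the monoid of words under concatenation.
\<close>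

instantiation list :: (type) monoid_add
begin

definition zero_list :: "'a list" where "zero_list = []"

definition plus_list :: "'a list \<Rightarrow> 'a list \<Rightarrow> 'a list" where "plus_list = (@)"

instance by standard (simp_all add: zero_list_def plus_list_def)

end

type_synonym free = "(int \<times> int \<times> nat) list \<Rightarrow>\<^sub>0 complex"

definition gen :: "int \<Rightarrow> int \<Rightarrow> nat \<Rightarrow> free" where
  "gen i j r = Poly_Mapping.single [(i, j, r)] 1"

definition free_alg :: "lie_type \<Rightarrow> (complex, free) module" where
  "free_alg g =
     \<lparr>carrier = {f. \<forall>w\<in>Poly_Mapping.keys f. set w \<subseteq> idx g \<times> idx g \<times> UNIV},
      mult = (*), one = 1, zero = 0, add = (+),
      smult = (\<lambda>c. Poly_Mapping.map ((*) c))\<rparr>"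

text \<open>
  Two-variable series live in \<open>'a fls fls\<close>: Laurent series in \<open>1/u\<close> (outer) whose coefficients are
  Laurent series in \<open>1/v\<close> (inner).  Over the complex numbers this is a field, in which the
  denominators \<open>u - v\<close> and \<open>u - v - kappa\<close> of \<open>R(u - v)\<close> are invertible (expanded in \<open>1/u\<close>).
  Endomorphisms of the tensor square are matrices indexed by pairs: the entry of
  \<open>E\<^sub>i\<^sub>j \<otimes> E\<^sub>k\<^sub>l\<close> has row index \<open>(i, k)\<close> and column index \<open>(j, l)\<close>.
\<close>

definition map_fls :: "('a::zero \<Rightarrow> 'b::zero) \<Rightarrow> 'a fls \<Rightarrow> 'b fls" where
  "map_fls h F = Abs_fls (\<lambda>n. h (fls_nth F n))"

definition scal2 :: "complex fls fls \<Rightarrow> free fls fls" where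
  "scal2 = map_fls (map_fls (Poly_Mapping.single []))"

definition var_u :: "complex fls fls" where
  "var_u = fls_X_inv"

definition var_v :: "complex fls fls" where
  "var_v = fls_const fls_X_inv"

definition R_mat ::
    "lie_type \<Rightarrow> complex fls fls \<Rightarrow> int \<times> int \<Rightarrow> int \<times> int \<Rightarrow> complex fls fls" where
  "R_mat g x = (\<lambda>(i, k) (j, l).
     of_bool (i = j \<and> k = l)
     - of_bool (k = j \<and> l = i) / x
     + fls_const (fls_const (theta g i j)) * of_bool (k = -i \<and> l = -j)
         / (x - fls_const (fls_const (kappa g))))"

definition T1_mat :: "int \<times> int \<Rightarrow> int \<times> int \<Rightarrow> free fls fls" where
  "T1_mat = (\<lambda>(i, k) (j, l).
     if k = l then fps_to_fls (Abs_fps (\<lambda>r. fls_const (gen i j r))) else 0)"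

definition T2_mat :: "int \<times> int \<Rightarrow> int \<times> int \<Rightarrow> free fls fls" where
  "T2_mat = (\<lambda>(i, k) (j, l).
     if i = j then fls_const (fps_to_fls (Abs_fps (\<lambda>r. gen k l r))) else 0)"

definition mat_mult2 ::
    "lie_type \<Rightarrow> (int \<times> int \<Rightarrow> int \<times> int \<Rightarrow> free fls fls) \<Rightarrow>
     (int \<times> int \<Rightarrow> int \<times> int \<Rightarrow> free fls fls) \<Rightarrow> int \<times> int \<Rightarrow> int \<times> int \<Rightarrow> free fls fls" where
  "mat_mult2 g M M' = (\<lambda>p q. \<Sum>s\<in>idx g \<times> idx g. M p s * M' s q)"

definition rtt_lhs :: "lie_type \<Rightarrow> int \<times> int \<Rightarrow> int \<times> int \<Rightarrow> free fls fls" where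
  "rtt_lhs g =
     mat_mult2 g (mat_mult2 g (\<lambda>p q. scal2 (R_mat g (var_u - var_v) p q)) T1_mat) T2_mat"

definition rtt_rhs :: "lie_type \<Rightarrow> int \<times> int \<Rightarrow> int \<times> int \<Rightarrow> free fls fls" where
  "rtt_rhs g =
     mat_mult2 g (mat_mult2 g T2_mat T1_mat) (\<lambda>p q. scal2 (R_mat g (var_u - var_v) p q))"

definition yangian_rels :: "lie_type \<Rightarrow> free set" where
  "yangian_rels g =
     {fls_nth (fls_nth (rtt_lhs g p q - rtt_rhs g p q) m) n | p q m n.
        p \<in> idx g \<times> idx g \<and> q \<in> idx g \<times> idx g}
   \<union> {gen i j 0 - of_bool (i = j) | i j. i \<in> idx g \<and> j \<in> idx g}"

definition yangian_ideal :: "lie_type \<Rightarrow> free set" where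
  "yangian_ideal g = Idl\<^bsub>free_alg g\<^esub> (yangian_rels g)"

definition ext_yangian :: "lie_type \<Rightarrow> (complex, free set) module" where
  "ext_yangian g = quot_alg (free_alg g) (yangian_ideal g)"

definition T_mat :: "lie_type \<Rightarrow> (nat \<Rightarrow> free set) imat" where
  "T_mat g = (\<lambda>i j r. quot_map (free_alg g) (yangian_ideal g) (gen i j r))"

definition mat_subst ::
    "lie_type \<Rightarrow> complex \<Rightarrow> complex \<Rightarrow> (nat \<Rightarrow> free set) imat \<Rightarrow> (nat \<Rightarrow> free set) imat" where
  "mat_subst g b a M = (\<lambda>i j. ser_subst (ext_yangian g) b a (M i j))"

abbreviation ser_yangian :: "lie_type \<Rightarrow> (complex, nat \<Rightarrow> free set) module" where
  "ser_yangian g \<equiv> ser_alg (ext_yangian g)"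

abbreviation mat_times ::
    "lie_type \<Rightarrow> (nat \<Rightarrow> free set) imat \<Rightarrow> (nat \<Rightarrow> free set) imat \<Rightarrow> (nat \<Rightarrow> free set) imat" where
  "mat_times g \<equiv> mat_mult (ser_yangian g) (idx g)"

abbreviation transp :: "lie_type \<Rightarrow> (nat \<Rightarrow> free set) imat \<Rightarrow> (nat \<Rightarrow> free set) imat" where
  "transp g \<equiv> mat_transp g (ext_yangian g)"

definition is_scalar_mat ::
    "lie_type \<Rightarrow> (nat \<Rightarrow> free set) imat \<Rightarrow> (nat \<Rightarrow> free set) \<Rightarrow> bool" where
  "is_scalar_mat g M z \<longleftrightarrow>
     (\<forall>i\<in>idx g. \<forall>j\<in>idx g. M i j = mat_scalar (ser_yangian g) z i j)"

text \<open>
  The series \<open>z(u)\<close>, \<open>y(u)\<close> and (below) \<open>w(u)\<close> are singled out by their defining equations.  These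
  have at most one solution; that a solution exists is a consequence of the defining relations
  of the algebra and is not built into the definitions.
\<close>

definition z_ser :: "lie_type \<Rightarrow> nat \<Rightarrow> free set" where
  "z_ser g = (THE z. z \<in> carrier (ser_yangian g) \<and> z 0 = \<one>\<^bsub>ext_yangian g\<^esub> \<and>
     is_scalar_mat g (mat_times g (mat_subst g 1 (kappa g) (transp g (T_mat g))) (T_mat g)) z \<and>
     is_scalar_mat g (mat_times g (T_mat g) (mat_subst g 1 (kappa g) (transp g (T_mat g)))) z)"

definition y_ser :: "lie_type \<Rightarrow> nat \<Rightarrow> free set" where
  "y_ser g = (THE y. y \<in> carrier (ser_yangian g) \<and> y 0 = \<one>\<^bsub>ext_yangian g\<^esub> \<and>
     z_ser g = y \<otimes>\<^bsub>ser_yangian g\<^esub> ser_subst (ext_yangian g) 1 (kappa g) y)"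

definition tau_mat :: "lie_type \<Rightarrow> (nat \<Rightarrow> free set) imat" where
  "tau_mat g = (\<lambda>i j. inv\<^bsub>ser_yangian g\<^esub> (y_ser g) \<otimes>\<^bsub>ser_yangian g\<^esub> T_mat g i j)"

definition yangian_sub :: "lie_type \<Rightarrow> (complex, free set) module" where
  "yangian_sub g = subalg_gen (ext_yangian g) (mat_coeffs (idx g) (tau_mat g))"

section \<open>Symmetric pairs\<close>

datatype pair_type = BCD0 | CI | DIII | CII nat nat | BDI nat nat

fun symmetric_pair :: "lie_type \<Rightarrow> pair_type \<Rightarrow> bool" where
  "symmetric_pair g BCD0 \<longleftrightarrow> lie_valid g"
| "symmetric_pair g CI \<longleftrightarrow> lie_valid g \<and> (\<exists>N. g = SP N)"
| "symmetric_pair g DIII \<longleftrightarrow> lie_valid g \<and> (\<exists>N. g = SO N \<and> even N)"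
| "symmetric_pair g (CII p q) \<longleftrightarrow>
     lie_valid g \<and> g = SP (p + q) \<and> even p \<and> even q \<and> p \<ge> q \<and> q > 0"
| "symmetric_pair g (BDI p q) \<longleftrightarrow>
     lie_valid g \<and> g = SO (p + q) \<and> q > 0 \<and> (if odd (p + q) then p > q else p \<ge> q)"

definition E_unit :: "int \<Rightarrow> int \<Rightarrow> int \<Rightarrow> int \<Rightarrow> complex" where
  "E_unit a b = (\<lambda>i j. of_bool (i = a \<and> j = b))"

fun G_mat :: "lie_type \<Rightarrow> pair_type \<Rightarrow> int \<Rightarrow> int \<Rightarrow> complex" where
  "G_mat g BCD0 i j = of_bool (i = j)"
| "G_mat g CI i j = (\<Sum>a=1..int (lie_dim g) div 2. E_unit a a i j - E_unit (-a) (-a) i j)"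
| "G_mat g DIII i j = (\<Sum>a=1..int (lie_dim g) div 2. E_unit a a i j - E_unit (-a) (-a) i j)"
| "G_mat g (CII p q) i j =
     - (\<Sum>a=1..int q div 2. E_unit a a i j + E_unit (-a) (-a) i j)
     + (\<Sum>a=int q div 2 + 1..int (lie_dim g) div 2. E_unit a a i j + E_unit (-a) (-a) i j)"
| "G_mat g (BDI p q) i j =
     (if even (lie_dim g) then
        (\<Sum>a=1..(int p - int q) div 2. E_unit a a i j + E_unit (-a) (-a) i j)
        + (\<Sum>a=(int p - int q) div 2 + 1..int (lie_dim g) div 2.
             E_unit (-a) a i j + E_unit a (-a) i j)
      else
        (\<Sum>a=-((int p - int q - 1) div 2)..(int p - int q - 1) div 2. E_unit a a i j)
        + (\<Sum>a=(int p - int q + 1) div 2..(int (lie_dim g) - 1) div 2.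
             E_unit (-a) a i j + E_unit a (-a) i j))"

text \<open>
  The matrix \<open>G(u)\<close>, with entries in the field of Laurent series in \<open>1/u\<close>
  (so that \<open>fls_X_inv\<close> is \<open>u\<close>).
\<close>

definition G_rational :: "complex \<Rightarrow> (int \<Rightarrow> int \<Rightarrow> complex) \<Rightarrow> int \<Rightarrow> int \<Rightarrow> complex fls" where
  "G_rational c G i j =
     (of_bool (i = j) - fls_const c * fls_X_inv * fls_const (G i j))
       / (1 - fls_const c * fls_X_inv)"

fun G_fls :: "lie_type \<Rightarrow> pair_type \<Rightarrow> int \<Rightarrow> int \<Rightarrow> complex fls" where
  "G_fls g (CII p q) i j =
     (if p > q then G_rational (4 / (of_nat p - of_nat q)) (G_mat g (CII p q)) i j
      else fls_const (G_mat g (CII p q) i j))"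
| "G_fls g (BDI p q) i j =
     (if p > q then G_rational (4 / (of_nat p - of_nat q)) (G_mat g (BDI p q)) i j
      else fls_const (G_mat g (BDI p q) i j))"
| "G_fls g ty i j = fls_const (G_mat g ty i j)"

definition G_ser :: "lie_type \<Rightarrow> pair_type \<Rightarrow> (nat \<Rightarrow> free set) imat" where
  "G_ser g ty = (\<lambda>i j r. fls_nth (G_fls g ty i j) (int r) \<odot>\<^bsub>ext_yangian g\<^esub> \<one>\<^bsub>ext_yangian g\<^esub>)"

section \<open>Twisted Yangians\<close>

text \<open>\<open>twist g ty M\<close> is \<open>M(u - kappa/2) G(u) M\<^sup>t(-u + kappa/2)\<close>.\<close>

definition twist :: "lie_type \<Rightarrow> pair_type \<Rightarrow> (nat \<Rightarrow> free set) imat \<Rightarrow> (nat \<Rightarrow> free set) imat" where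
  "twist g ty M =
     mat_times g (mat_times g (mat_subst g 1 (- kappa g / 2) M) (G_ser g ty))
       (mat_subst g (-1) (kappa g / 2) (transp g M))"

definition S_mat :: "lie_type \<Rightarrow> pair_type \<Rightarrow> (nat \<Rightarrow> free set) imat" where
  "S_mat g ty = twist g ty (T_mat g)"

definition Sigma_mat :: "lie_type \<Rightarrow> pair_type \<Rightarrow> (nat \<Rightarrow> free set) imat" where
  "Sigma_mat g ty = twist g ty (tau_mat g)"

definition X_tw :: "lie_type \<Rightarrow> pair_type \<Rightarrow> (complex, free set) module" where
  "X_tw g ty = subalg_gen (ext_yangian g) (mat_coeffs (idx g) (S_mat g ty))"

definition SS_mat :: "lie_type \<Rightarrow> pair_type \<Rightarrow> (nat \<Rightarrow> free set) imat" where
  "SS_mat g ty = mat_times g (S_mat g ty) (mat_subst g (-1) 0 (S_mat g ty))"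

definition w_ser :: "lie_type \<Rightarrow> pair_type \<Rightarrow> nat \<Rightarrow> free set" where
  "w_ser g ty = (THE w. w \<in> carrier (ser_yangian g) \<and> is_scalar_mat g (SS_mat g ty) w)"

definition W_tw :: "lie_type \<Rightarrow> pair_type \<Rightarrow> (complex, free set) module" where
  "W_tw g ty = subalg_gen (X_tw g ty) (range (w_ser g ty))"

definition unitarity_ideal :: "lie_type \<Rightarrow> pair_type \<Rightarrow> free set set" where
  "unitarity_ideal g ty = Idl\<^bsub>X_tw g ty\<^esub> (mat_coeffs (idx g)
     (\<lambda>i j. SS_mat g ty i j \<ominus>\<^bsub>ser_yangian g\<^esub> mat_scalar (ser_yangian g) \<one>\<^bsub>ser_yangian g\<^esub> i j))"

definition Y_tw :: "lie_type \<Rightarrow> pair_type \<Rightarrow> (complex, free set set) module" where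
  "Y_tw g ty = quot_alg (X_tw g ty) (unitarity_ideal g ty)"

definition Y_tilde_tw :: "lie_type \<Rightarrow> pair_type \<Rightarrow> (complex, free set) module" where
  "Y_tilde_tw g ty = subalg_gen (yangian_sub g) (mat_coeffs (idx g) (Sigma_mat g ty))"

end

theory Submission
  imports Defs
begin

text \<open>
  The theorem rests on a central factorisation. The extended Yangian contains a central series
  \<open>y(u)\<close> such that \<open>T(u) = y(u) \<tau>(u)\<close>, where \<open>\<tau>\<close> is orthogonal; consequently
  \<open>S(u) = q(u) \<Sigma>(u)\<close> with \<open>q(u) = y(u - \<kappa>/2) y(- u + \<kappa>/2)\<close> central and
  \<open>\<Sigma>(u) \<Sigma>(- u) = 1\<close>, so that \<open>w(u) = q(u) q(- u)\<close>. The three claims express that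
  the factor \<open>q\<close> can be recovered from \<open>w\<close> alone and that \<open>w\<close> is independent of \<open>\<Sigma>\<close>.

  \<^emph>\<open>The central series.\<close> Multiplied by its common denominator, the RTT relation becomes an
  identity between power series in \<open>x = 1/u\<close> and \<open>y = 1/v\<close>, which allows substitutions.
  On the line \<open>u = v + \<kappa>\<close> only the rank one matrix \<open>Q\<close> survives of the R-matrix, and
  \<open>Q T\<^sub>1(v + \<kappa>) T\<^sub>2(v) = T\<^sub>2(v) T\<^sub>1(v + \<kappa>) Q\<close> says that both products of \<open>T\<^sup>t(v + \<kappa>)\<close> and
  \<open>T(v)\<close> equal one scalar \<open>z(v)\<close> (\<open>T_transpose_T_scalar\<close>). A partial transposition exchanges
  \<open>P\<close> and \<open>Q\<close> and turns the RTT relation into a crossing relation between \<open>T\<^sub>1(u)\<close> and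
  \<open>T\<^sub>2\<^sup>t(v + \<kappa>)\<close> (\<open>crossing_relation\<close>). Moving \<open>T\<^sub>1(u)\<close> through
  \<open>T\<^sub>2\<^sup>t(v + \<kappa>) T\<^sub>2(v) = z(v)\<close> by these two relations shows that \<open>z\<close> is central
  (\<open>T_transpose_T_commutes\<close>). Then \<open>z(u) = y(u) y(u + \<kappa>)\<close> is solved recursively, and the
  coefficients of \<open>y\<close> are central as well.

  \<^emph>\<open>Recovering \<open>q\<close>.\<close> Besides \<open>q(u) q(- u) = w(u)\<close> the series satisfies \<open>q(\<kappa> - u) = q(u)\<close>.
  The first equation determines the even coefficients of \<open>q\<close> and the second one the odd
  coefficients, recursively (\<open>even_symmetric_in\<close>). So the coefficients of \<open>q\<close> are polynomials in
  those of \<open>w\<close>, and those of \<open>\<Sigma> = q\<^sup>-\<^sup>1 S\<close> lie in the algebra generated by \<open>S\<close>.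

  \<^emph>\<open>Independence.\<close> The RTT relation is invariant under multiplication of \<open>T\<close> by a central series.
  Hence every scalar series \<open>f\<close> with constant term 1 yields an endomorphism \<open>retr f\<close> of the extended
  Yangian that sends \<open>T\<close> to \<open>f \<tau>\<close>; it fixes \<open>\<tau>\<close> and \<open>\<Sigma>\<close> and sends \<open>y\<close> to \<open>f\<close>. The
  endomorphism \<open>retr 1\<close> retracts the algebra generated by \<open>S\<close> onto the one generated by \<open>\<Sigma>\<close> and
  sends \<open>w\<close> to 1, so it vanishes on the unitarity ideal; conversely \<open>x - retr 1 x\<close> always
  lies in this ideal. This is the isomorphism with the quotient (\<open>Y_iso\<close>). For variable \<open>f\<close>, the
  restrictions of \<open>retr f\<close> to the polynomials in the coefficients of \<open>y\<close> are characters, and they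
  separate points (\<open>Zk_separated\<close>). As they act trivially on \<open>\<Sigma>\<close>, a relation
  \<open>\<Sum>\<^sub>i a\<^sub>i y\<^sub>i = 0\<close> with \<open>a\<^sub>i\<close> from the algebra of \<open>w\<close> gives scalar relations between the \<open>y\<^sub>i\<close>, with
  which the terms can be eliminated one after the other; so multiplication
  identifies the tensor product with the algebra generated by \<open>S\<close> (\<open>tensor_independence\<close>).

  The calculations use the ring type classes, for which the extended Yangian has to be a type. Since
  a type cannot depend on the variable \<open>g\<close>, the type is built for one Lie type \<open>g0\<close>, chosen to be a
  counterexample to the theorem if there is one; a proof for \<open>g0\<close> is then a proof for all \<open>g\<close>.
\<close>

section \<open>Ring homomorphisms, central elements and complex algebras\<close>

locale ring_morph =
  fixes h :: "'a::ring_1 \<Rightarrow> 'b::ring_1"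
  assumes one: "h 1 = 1"
    and add: "h (x + y) = h x + h y"
    and mult: "h (x * y) = h x * h y"
begin

lemma zero: "h 0 = 0"
  using add[of 0 0] by simp

lemma uminus: "h (- x) = - h x"
  using add[of x "- x"] zero by (simp add: eq_neg_iff_add_eq_0 add.commute)

lemma diff: "h (x - y) = h x - h y"
  using add[of x "- y"] uminus by simp

lemma sum: "h (\<Sum>i\<in>A. f i) = (\<Sum>i\<in>A. h (f i))"
  by (induction A rule: infinite_finite_induct) (auto simp: zero add)

lemma power: "h (x ^ n) = h x ^ n"
  by (induction n) (auto simp: one mult)

lemma of_bool: "h (of_bool P) = of_bool P"
  by (simp add: one zero)

lemmas simps = one zero add uminus diff mult sum power of_bool

end

lemma ring_morph_comp: "ring_morph f \<Longrightarrow> ring_morph h \<Longrightarrow> ring_morph (\<lambda>x. h (f x))"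
  unfolding ring_morph_def by simp

definition central :: "'a::ring_1 \<Rightarrow> bool" where
  "central a \<longleftrightarrow> (\<forall>b. a * b = b * a)"

lemma centralD: "central a \<Longrightarrow> a * b = b * a"
  by (simp add: central_def)

lemma central_left_commute: "central a \<Longrightarrow> b * (a * c) = a * (b * c)"
  by (metis central_def mult.assoc)

lemma central_0 [simp]: "central 0" and central_1 [simp]: "central 1"
  by (simp_all add: central_def)

lemma central_add: "central a \<Longrightarrow> central b \<Longrightarrow> central (a + b)"
  by (simp add: central_def algebra_simps)

lemma central_mult: "central a \<Longrightarrow> central b \<Longrightarrow> central (a * b)"
  by (metis central_def mult.assoc)

lemma central_sum: "(\<And>i. i \<in> A \<Longrightarrow> central (f i)) \<Longrightarrow> central (sum f A)"
  by (induction A rule: infinite_finite_induct) (auto intro: central_add)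

lemma central_fps: "(\<And>n. central (fps_nth F n)) \<Longrightarrow> central F"
proof -
  assume c: "\<And>n. central (fps_nth F n)"
  have "fps_nth (F * G) n = fps_nth (G * F) n" for G n
  proof -
    have "fps_nth (F * G) n = (\<Sum>i=0..n. fps_nth G (n - i) * fps_nth F i)"
      unfolding fps_mult_nth by (intro sum.cong refl centralD c)
    also have "\<dots> = (\<Sum>i=0..n. fps_nth G i * fps_nth F (n - i))"
      by (rule sum.reindex_bij_witness[where i = "\<lambda>i. n - i" and j = "\<lambda>i. n - i"]) auto
    finally show ?thesis by (simp add: fps_mult_nth)
  qed
  then show ?thesis by (simp add: central_def fps_eq_iff)
qed

text \<open>A complex algebra is encoded by the structure map of the scalars into its centre; scalar
  multiplication is multiplication by \<open>sc c\<close>. Then the ring type classes suffice, and power series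
  and polynomial rings inherit the structure coefficientwise.\<close>

class calg = ring_1 +
  fixes sc :: "complex \<Rightarrow> 'a"
  assumes sc_one: "sc 1 = 1"
    and sc_add: "sc (a + b) = sc a + sc b"
    and sc_mult: "sc (a * b) = sc a * sc b"
    and sc_commute: "sc a * x = x * sc a"

interpretation sc: ring_morph sc
  by standard (simp_all add: sc_one sc_add sc_mult)

lemma central_sc [simp]: "central (sc c)"
  by (simp add: central_def sc_commute)

definition fmap :: "('a::zero \<Rightarrow> 'b::zero) \<Rightarrow> 'a fps \<Rightarrow> 'b fps" where
  "fmap h F = Abs_fps (\<lambda>n. h (fps_nth F n))"

lemma fmap_nth [simp]: "fps_nth (fmap h F) n = h (fps_nth F n)"
  by (simp add: fmap_def)

lemma ring_morph_fmap: assumes "ring_morph h" shows "ring_morph (fmap h)"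
proof -
  interpret ring_morph h by fact
  show ?thesis
    by standard (auto simp: fps_eq_iff simps fps_mult_nth)
qed

lemma ring_morph_fps_const: "ring_morph fps_const"
  by standard auto

lemma fmap_const: "h 0 = 0 \<Longrightarrow> fmap h (fps_const a) = fps_const (h a)"
  by (auto simp: fps_eq_iff)

lemma fmap_X: "h 0 = 0 \<Longrightarrow> h 1 = 1 \<Longrightarrow> fmap h fps_X = fps_X"
  by (auto simp: fps_eq_iff fps_X_def)

lemma fmap_fmap: "fmap h (fmap k F) = fmap (\<lambda>x. h (k x)) F"
  by (simp add: fps_eq_iff)

abbreviation scf :: "complex fps \<Rightarrow> 'a::calg fps" where "scf \<equiv> fmap sc"
abbreviation scff :: "complex fps fps \<Rightarrow> 'a::calg fps fps" where "scff \<equiv> fmap scf"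

interpretation scf: ring_morph scf
  by (rule ring_morph_fmap, rule sc.ring_morph_axioms)
interpretation scff: ring_morph scff
  by (rule ring_morph_fmap, rule scf.ring_morph_axioms)

lemma central_scf [simp]: "central (scf F)"
  by (rule central_fps) simp
lemma central_scff [simp]: "central (scff F)"
  by (rule central_fps) simp
lemma central_const: "central a \<Longrightarrow> central (fps_const a)"
  by (rule central_fps) simp

lemma scf_const [simp]: "scf (fps_const c) = fps_const (sc c)"
  by (simp add: fmap_const sc.zero)
lemma scf_X [simp]: "scf fps_X = fps_X"
  by (simp add: fmap_X sc.zero sc.one)
lemma scff_const [simp]: "scff (fps_const c) = fps_const (scf c)"
  by (simp add: fmap_const scf.zero)
lemma scff_X [simp]: "scff fps_X = fps_X"
  by (simp add: fmap_X scf.zero scf.one)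

section \<open>Substitution of Moebius transformations\<close>

text \<open>The substitution of the scalar series \<open>e\<close> for the outer variable. If \<open>e\<close> has no constant term, the
  powers beyond the \<open>n\<close>-th do not contribute to the \<open>n\<close>-th coefficient, so the sum may stop there.\<close>

definition ev :: "complex fps \<Rightarrow> 'a::calg fps fps \<Rightarrow> 'a fps" where
  "ev e F = Abs_fps (\<lambda>n. \<Sum>r\<le>n. fps_nth (fps_nth F r * scf (e ^ r)) n)"

lemma power_low: "fps_nth e 0 = (0::complex) \<Longrightarrow> n < r \<Longrightarrow> fps_nth (e ^ r) n = 0"
  using startsby_zero_power_prefix[of e r] by auto

lemma mult_power_low:
  assumes "fps_nth e 0 = 0" "n < r" shows "fps_nth (F * scf (e ^ r)) n = 0"
  using assms by (simp add: fps_mult_nth power_low sc.zero)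

lemma ev_nth:
  assumes "fps_nth e 0 = 0" "n \<le> N"
  shows "fps_nth (ev e F) n = fps_nth (\<Sum>r\<le>N. fps_nth F r * scf (e ^ r)) n"
proof -
  have "(\<Sum>r\<le>N. fps_nth (fps_nth F r * scf (e ^ r)) n) = (\<Sum>r\<le>n. fps_nth (fps_nth F r * scf (e ^ r)) n)"
    using assms by (intro sum.mono_neutral_right) (auto intro: mult_power_low)
  then show ?thesis by (simp add: ev_def fps_sum_nth)
qed

lemma fps_mult_nth_cong:
  assumes "\<And>k. k \<le> n \<Longrightarrow> fps_nth F k = fps_nth F' k" "\<And>k. k \<le> n \<Longrightarrow> fps_nth G k = fps_nth G' k"
  shows "fps_nth (F * G) n = fps_nth (F' * G') n"
  using assms by (simp add: fps_mult_nth)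

text \<open>Multiplicativity holds because the coefficients of \<open>e\<close> are scalars and hence commute with
  everything; for two series with noncommuting coefficients it would fail.\<close>

lemma ring_morph_ev: 
  assumes e: "fps_nth e 0 = 0" shows "ring_morph (ev e :: 'a::calg fps fps \<Rightarrow> 'a fps)"
proof
  show "ev e 1 = (1 :: 'a fps)"
  proof (rule fps_ext)
    fix n
    have "fps_nth (ev e 1) n = (\<Sum>r\<le>n. if r = 0 then fps_nth (1::'a fps) n else 0)"
      unfolding ev_def fps_nth_Abs_fps by (intro sum.cong) (auto simp: scf.one)
    then show "fps_nth (ev e (1::'a fps fps)) n = fps_nth 1 n" by simp
  qed
next
  fix F G :: "'a fps fps"
  show "ev e (F + G) = ev e F + ev e G"
    by (simp add: ev_def fps_eq_iff algebra_simps sum.distrib)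
  show "ev e (F * G) = ev e F * ev e G"
  proof (rule fps_ext)
    fix n
    let ?f = "\<lambda>r. fps_nth F r * scf (e ^ r)" and ?g = "\<lambda>r. fps_nth G r * scf (e ^ r)"
    have "fps_nth (ev e F * ev e G) n = fps_nth ((\<Sum>r\<le>n. ?f r) * (\<Sum>s\<le>n. ?g s)) n"
      by (rule fps_mult_nth_cong) (simp_all only: ev_nth[OF e])
    also have "\<dots> = (\<Sum>r\<le>n. \<Sum>s\<le>n. fps_nth (?f r * ?g s) n)"
      by (simp add: sum_product fps_sum_nth)
    also have "?f r * ?g s = fps_nth F r * fps_nth G s * scf (e ^ (r + s))" for r s
      by (simp add: power_add scf.mult mult.assoc)
         (metis central_left_commute central_scf)
    then have "(\<Sum>r\<le>n. \<Sum>s\<le>n. fps_nth (?f r * ?g s) n)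
       = (\<Sum>r\<le>n. \<Sum>s\<le>n. fps_nth (fps_nth F r * fps_nth G s * scf (e ^ (r + s))) n)"
      by simp
    also have "\<dots> = (\<Sum>(r, s)\<in>{..n} \<times> {..n}. fps_nth (fps_nth F r * fps_nth G s * scf (e ^ (r + s))) n)"
      by (simp add: sum.cartesian_product)
    also have "\<dots> = (\<Sum>(r, s)\<in>{(r, s). r + s \<le> n}. fps_nth (fps_nth F r * fps_nth G s * scf (e ^ (r + s))) n)"
      by (rule sum.mono_neutral_right) (auto intro!: mult_power_low[OF e])
    also have "\<dots> = (\<Sum>m\<le>n. \<Sum>r\<le>m. fps_nth (fps_nth F r * fps_nth G (m - r) * scf (e ^ m)) n)"
      by (subst sum.triangle_reindex_eq) (auto intro!: sum.cong)
    also have "\<dots> = fps_nth (ev e (F * G)) n"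
      by (simp add: ev_def fps_mult_nth[of F G] sum_distrib_right fps_sum_nth atMost_atLeast0)
    finally show "fps_nth (ev e (F * G)) n = fps_nth (ev e F * ev e G) n" by simp
  qed
qed

lemma ev_const:
  assumes e: "fps_nth e 0 = 0" shows "ev e (fps_const f) = f"
proof (rule fps_ext)
  fix n
  have "fps_nth (ev e (fps_const f)) n = (\<Sum>r\<le>n. if r = 0 then fps_nth f n else 0)"
    unfolding ev_def fps_nth_Abs_fps by (intro sum.cong) (auto simp: scf.one)
  then show "fps_nth (ev e (fps_const f)) n = fps_nth f n" by simp
qed

lemma ev_X:
  assumes e: "fps_nth e 0 = 0" shows "ev e fps_X = scf e"
proof (rule fps_ext)
  fix n
  have "fps_nth (ev e fps_X) n = (\<Sum>r\<le>n. if r = 1 then fps_nth (scf e) n else 0 :: 'a)"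
    unfolding ev_def fps_nth_Abs_fps by (intro sum.cong) (auto simp: fps_X_def)
  also have "\<dots> = fps_nth (scf e) n"
    using e by (cases n) (auto simp: sc.zero)
  finally show "fps_nth (ev e (fps_X :: 'a fps fps)) n = fps_nth (scf e) n" .
qed

text \<open>In the variable \<open>x = 1/u\<close>, this is the substitution \<open>u \<mapsto> b u + a\<close>.\<close>

definition mob :: "complex \<Rightarrow> complex \<Rightarrow> complex fps" where
  "mob b a = fps_X / (fps_const b + fps_const a * fps_X)"

text \<open>\<open>sub b a f\<close> is the series \<open>f(b u + a)\<close>, again expanded in \<open>1/u\<close>.\<close>

definition sub :: "complex \<Rightarrow> complex \<Rightarrow> 'a::calg fps \<Rightarrow> 'a fps" where
  "sub b a f = ev (mob b a) (fmap fps_const f)"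

lemma mob_unit: "b \<noteq> 0 \<Longrightarrow> mob b a * (fps_const b + fps_const a * fps_X) = fps_X"
  unfolding mob_def by (rule dvd_div_mult_self) (simp add: fps_dvd_iff subdegree_eq_0)

lemma mob_0: "b \<noteq> 0 \<Longrightarrow> fps_nth (mob b a) 0 = 0"
  using arg_cong[OF mob_unit[of b a], of "\<lambda>f. fps_nth f 0"] by simp

lemma mob_1: "b \<noteq> 0 \<Longrightarrow> fps_nth (mob b a) 1 = 1 / b"
  using arg_cong[OF mob_unit[of b a], of "\<lambda>f. fps_nth f 1"] by (simp add: mob_0 fps_mult_nth field_simps)

lemma mob_power_diag: "b \<noteq> 0 \<Longrightarrow> fps_nth (mob b a ^ n) n = (1 / b) ^ n"
  using startsby_zero_power_nth_same[of "mob b a" n] mob_1[of b a] by (simp add: mob_0)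

lemma ring_morph_sub: "b \<noteq> 0 \<Longrightarrow> ring_morph (sub b a)"
  unfolding sub_def
  by (rule ring_morph_comp[OF ring_morph_fmap[OF ring_morph_fps_const] ring_morph_ev]) (rule mob_0)

lemma sub_nth: "fps_nth (sub b a f) n = (\<Sum>r\<le>n. sc (fps_nth (mob b a ^ r) n) * fps_nth f r)"
  by (simp add: sub_def ev_def sc_commute)

lemma sub_nth_0 [simp]: "fps_nth (sub b a f) 0 = fps_nth f 0"
  by (simp add: sub_nth sc.one)

lemma mob_compose:
  assumes "b \<noteq> 0" "b' \<noteq> 0" 
  shows "mob b a oo mob b' a' = mob (b * b') (b * a' + a)"
proof -
  let ?c = "mob b' a'"
  have c0: "fps_nth ?c 0 = 0" using assms by (simp add: mob_0)
  have "(mob b a oo ?c) * (fps_const b + fps_const a * ?c) = ?c"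
    using arg_cong[OF mob_unit[of b a], of "\<lambda>f. f oo ?c"] assms c0
    by (simp add: fps_compose_mult_distrib fps_compose_add_distrib)
  then have "(mob b a oo ?c) * (fps_const b + fps_const a * ?c) * (fps_const b' + fps_const a' * fps_X) = fps_X"
    using assms by (simp add: mob_unit)
  moreover have "(fps_const b + fps_const a * ?c) * (fps_const b' + fps_const a' * fps_X)
      = fps_const b * (fps_const b' + fps_const a' * fps_X) + fps_const a * fps_X"
    by (subst mob_unit[OF assms(2), of a', symmetric]) (simp only: distrib_right mult.assoc)
  moreover have "\<dots> = fps_const (b * b') + fps_const (b * a' + a) * fps_X"
    by (simp add: algebra_simps flip: fps_const_add fps_const_mult)
  ultimately have "(mob b a oo ?c) * (fps_const (b * b') + fps_const (b * a' + a) * fps_X) = fps_X"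
    by (simp add: mult.assoc)
  also have "fps_X = mob (b * b') (b * a' + a) * (fps_const (b * b') + fps_const (b * a' + a) * fps_X)"
    using assms by (simp add: mob_unit)
  finally show ?thesis
    by (subst (asm) mult_right_cancel) (use assms in \<open>auto simp: fps_eq_iff fps_mult_nth dest: spec[of _ 0]\<close>)
qed

lemma sub_sub:
  assumes "b \<noteq> 0" "b' \<noteq> 0"
  shows "sub b' a' (sub b a f) = sub (b * b') (b * a' + a) f"
proof (rule fps_ext)
  fix n
  let ?c = "mob b' a'"
  have c0: "fps_nth ?c 0 = 0" using assms by (simp add: mob_0)
  have "fps_nth (sub b' a' (sub b a f)) n
    = (\<Sum>m\<le>n. sc (fps_nth (?c ^ m) n) * (\<Sum>r\<le>m. sc (fps_nth (mob b a ^ r) m) * fps_nth f r))"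
    by (simp only: sub_nth)
  also have "\<dots> = (\<Sum>m\<le>n. sc (fps_nth (?c ^ m) n) * (\<Sum>r\<le>n. sc (fps_nth (mob b a ^ r) m) * fps_nth f r))"
    by (intro sum.cong arg_cong2[of _ _ _ _ "(*)"] sum.mono_neutral_left refl)
       (auto simp: power_low[OF mob_0[OF assms(1)]] sc.zero)
  also have "\<dots> = (\<Sum>m\<le>n. \<Sum>r\<le>n. sc (fps_nth (mob b a ^ r) m * fps_nth (?c ^ m) n) * fps_nth f r)"
  proof -
    have "sc x * (sc y * z) = sc (y * x) * z" for x y and z :: 'a
      by (metis mult.assoc sc_mult mult.commute)
    then show ?thesis by (simp add: sum_distrib_left)
  qed
  also have "\<dots> = (\<Sum>r\<le>n. \<Sum>m\<le>n. sc (fps_nth (mob b a ^ r) m * fps_nth (?c ^ m) n) * fps_nth f r)"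
    by (rule sum.swap)
  also have "\<dots> = (\<Sum>r\<le>n. sc (fps_nth ((mob b a ^ r) oo ?c) n) * fps_nth f r)"
    by (simp add: fps_compose_nth sc.sum sum_distrib_right atMost_atLeast0)
  also have "\<dots> = fps_nth (sub (b * b') (b * a' + a) f) n"
    by (simp add: sub_nth fps_compose_power[OF c0, symmetric] mob_compose[OF assms])
  finally show "fps_nth (sub b' a' (sub b a f)) n = fps_nth (sub (b * b') (b * a' + a) f) n" .
qed

lemma sub_id [simp]: "sub 1 0 f = f"
proof (rule fps_ext)
  fix n
  have m: "mob 1 0 = fps_X" by (simp add: mob_def)
  have "fps_nth (sub 1 0 f) n = (\<Sum>r\<le>n. if r = n then fps_nth f n else 0)"
    unfolding sub_nth m by (intro sum.cong) (auto simp: sc.one sc.zero)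
  then show "fps_nth (sub 1 0 f) n = fps_nth f n" by simp
qed

lemma sub_central: "(\<And>n. central (fps_nth f n)) \<Longrightarrow> central (fps_nth (sub b a f) n)"
  unfolding sub_nth by (intro central_sum central_mult) auto

lemma sub_morph:
  assumes "ring_morph h" "\<And>c. h (sc c) = sc c"
  shows "fmap h (sub b a f) = sub b a (fmap h f)"
proof -
  interpret ring_morph h by fact
  show ?thesis by (simp add: fps_eq_iff sub_nth simps assms(2))
qed

section \<open>Matrices over index pairs\<close>

text \<open>Matrices are functions of two indices, with an arbitrary index set, so that the same product serves
  for endomorphisms of the vector space and (with pairs as indices) of its tensor square.\<close>

definition mm :: "'i set \<Rightarrow> ('i \<Rightarrow> 'i \<Rightarrow> 'a::semiring_0) \<Rightarrow> ('i \<Rightarrow> 'i \<Rightarrow> 'a) \<Rightarrow> 'i \<Rightarrow> 'i \<Rightarrow> 'a" where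
  "mm I M N = (\<lambda>p q. \<Sum>s\<in>I. M p s * N s q)"

lemma mm_assoc: "mm I (mm I A B) C = mm I A (mm I B C)"
proof (intro ext)
  fix p q
  have "mm I (mm I A B) C p q = (\<Sum>s\<in>I. \<Sum>r\<in>I. A p r * B r s * C s q)"
    by (simp add: mm_def sum_distrib_right)
  also have "\<dots> = (\<Sum>r\<in>I. \<Sum>s\<in>I. A p r * B r s * C s q)" by (rule sum.swap)
  finally show "mm I (mm I A B) C p q = mm I A (mm I B C) p q"
    by (simp add: mm_def sum_distrib_left mult.assoc)
qed

lemma mm_cong:
  assumes "\<And>s. s \<in> I \<Longrightarrow> A p s = A' p s" "\<And>s. s \<in> I \<Longrightarrow> B s q = B' s q"
  shows "mm I A B p q = mm I A' B' p q"
  unfolding mm_def by (intro sum.cong refl arg_cong2[of _ _ _ _ "(*)"] assms)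

lemma mm_cong_right: "(\<And>s. s \<in> I \<Longrightarrow> B s q = B' s q) \<Longrightarrow> mm I A B p q = mm I A B' p q"
  by (rule mm_cong) auto

lemma mm_scale_left: "mm I (\<lambda>p q. d * M p q) N = (\<lambda>p q. d * mm I M N p q)"
  by (simp add: mm_def sum_distrib_left mult.assoc)

lemma mm_scale_right: "central d \<Longrightarrow> mm I M (\<lambda>p q. d * N p q) = (\<lambda>p q. d * mm I M N p q)"
  by (simp add: mm_def sum_distrib_left central_left_commute)

lemma (in ring_morph) mm: "h (mm I A B p q) = mm I (\<lambda>p q. h (A p q)) (\<lambda>p q. h (B p q)) p q"
  by (simp add: mm_def simps)

lemma (in ring_morph) mm3:
  "h (mm I (mm I A B) C p q) = mm I (mm I (\<lambda>p q. h (A p q)) (\<lambda>p q. h (B p q))) (\<lambda>p q. h (C p q)) p q"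
  by (simp add: mm_def simps)

text \<open>A pair \<open>(i, k)\<close> is the index of the tensor product of the \<open>i\<close>-th and the \<open>k\<close>-th basis vector.\<close>

definition T1 :: "(int \<Rightarrow> int \<Rightarrow> 'a::zero) \<Rightarrow> int \<times> int \<Rightarrow> int \<times> int \<Rightarrow> 'a" where
  "T1 U = (\<lambda>(i, k) (j, l). if k = l then U i j else 0)"

definition T2 :: "(int \<Rightarrow> int \<Rightarrow> 'a::zero) \<Rightarrow> int \<times> int \<Rightarrow> int \<times> int \<Rightarrow> 'a" where
  "T2 V = (\<lambda>(i, k) (j, l). if i = j then V k l else 0)"

text \<open>The matrix \<open>a I - b P + c Q\<close>, where the signs in \<open>Q\<close> are given as products \<open>e i * e j\<close>.\<close>

definition RR :: "(int \<Rightarrow> 'a::ring_1) \<Rightarrow> 'a \<Rightarrow> 'a \<Rightarrow> 'a \<Rightarrow> int \<times> int \<Rightarrow> int \<times> int \<Rightarrow> 'a" where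
  "RR e a b c = (\<lambda>(i, k) (j, l). of_bool (i = j \<and> k = l) * a - of_bool (k = j \<and> l = i) * b
     + of_bool (k = -i \<and> l = -j) * (e i * e j * c))"

lemma (in ring_morph) RR: "h (RR e a b c p q) = RR (\<lambda>i. h (e i)) (h a) (h b) (h c) p q"
  by (cases p; cases q) (simp add: RR_def simps)

lemma RR_scale:
  assumes "central d"
  shows "RR e (d * a) (d * b) (d * c) p q = d * RR e a b c p q"
  by (cases p; cases q) (simp add: RR_def of_bool_def ring_distribs central_left_commute[OF assms])

lemma (in ring_morph) T1: "h (T1 U p q) = T1 (\<lambda>i j. h (U i j)) p q"
  by (cases p; cases q) (simp add: T1_def zero)

lemma (in ring_morph) T2: "h (T2 U p q) = T2 (\<lambda>i j. h (U i j)) p q"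
  by (cases p; cases q) (simp add: T2_def zero)

lemma mm_T1_right:
  assumes "finite I" "l \<in> I"
  shows "mm (I \<times> I) M (T1 U) p (j, l) = (\<Sum>a\<in>I. M p (a, l) * U a j)"
  using assms by (simp add: mm_def T1_def sum.cartesian_product' if_distrib sum.delta cong: if_cong)

lemma mm_T2_right:
  assumes "finite I" "j \<in> I"
  shows "mm (I \<times> I) M (T2 U) p (j, l) = (\<Sum>b\<in>I. M p (j, b) * U b l)"
proof -
  have "mm (I \<times> I) M (T2 U) p (j, l) = (\<Sum>b\<in>I. \<Sum>a\<in>I. if a = j then M p (a, b) * U b l else 0)"
    unfolding mm_def sum.cartesian_product' by (subst sum.swap) (simp add: T2_def if_distrib cong: if_cong)
  then show ?thesis using assms by simp
qed

lemma mm_T1_left: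
  assumes "finite I" "k \<in> I"
  shows "mm (I \<times> I) (T1 U) M (i, k) q = (\<Sum>a\<in>I. U i a * M (a, k) q)"
  using assms by (simp add: mm_def T1_def sum.cartesian_product' if_distrib[of "\<lambda>x. x * _"] sum.delta' cong: if_cong)

lemma mm_T2_left:
  assumes "finite I" "i \<in> I"
  shows "mm (I \<times> I) (T2 U) M (i, k) q = (\<Sum>b\<in>I. U k b * M (i, b) q)"
proof -
  have "mm (I \<times> I) (T2 U) M (i, k) q = (\<Sum>b\<in>I. \<Sum>a\<in>I. if i = a then U k b * M (a, b) q else 0)"
    unfolding mm_def sum.cartesian_product' by (subst sum.swap) (simp add: T2_def if_distrib[of "\<lambda>x. x * _"] cong: if_cong)
  then show ?thesis using assms by simp
qed

lemma mm_RR_T1_T2: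
  fixes U V :: "int \<Rightarrow> int \<Rightarrow> 'a::ring_1"
  assumes I: "finite I" "\<And>i. i \<in> I \<Longrightarrow> - i \<in> I" and "i \<in> I" "k \<in> I" "j \<in> I" "l \<in> I"
  shows "mm (I \<times> I) (mm (I \<times> I) (RR e a b c) (T1 U)) (T2 V) (i, k) (j, l) =
    a * (U i j * V k l) - b * (U k j * V i l) + of_bool (k = - i) * (\<Sum>p\<in>I. e i * e p * c * (U p j * V (-p) l))"
proof -
  have "mm (I \<times> I) (mm (I \<times> I) (RR e a b c) (T1 U)) (T2 V) (i, k) (j, l)
    = (\<Sum>y\<in>I. (\<Sum>x\<in>I. RR e a b c (i, k) (x, y) * U x j) * V y l)"
    using assms by (simp add: mm_T2_right mm_T1_right)
  also have "\<dots> = (\<Sum>y\<in>I. \<Sum>x\<in>I. RR e a b c (i, k) (x, y) * (U x j * V y l))"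
    by (simp add: sum_distrib_right mult.assoc)
  also have "\<dots> = (\<Sum>y\<in>I. \<Sum>x\<in>I. (if x = i then (if y = k then a * (U x j * V y l) else 0) else 0))
     - (\<Sum>y\<in>I. \<Sum>x\<in>I. (if x = k then (if y = i then b * (U x j * V y l) else 0) else 0))
     + (\<Sum>y\<in>I. \<Sum>x\<in>I. if y = - x then of_bool (k = - i) * (e i * e x * c * (U x j * V y l)) else 0)"
    unfolding sum.distrib[symmetric] sum_subtractf[symmetric]
    by (intro sum.cong refl) (auto simp: RR_def algebra_simps of_bool_def)
  also have "(\<Sum>y\<in>I. \<Sum>x\<in>I. (if x = i then (if y = k then a * (U x j * V y l) else 0) else 0)) = a * (U i j * V k l)"
    using assms by simp
  also have "(\<Sum>y\<in>I. \<Sum>x\<in>I. (if x = k then (if y = i then b * (U x j * V y l) else 0) else 0)) = b * (U k j * V i l)"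
    using assms by simp
  also have "(\<Sum>y\<in>I. \<Sum>x\<in>I. if y = - x then of_bool (k = - i) * (e i * e x * c * (U x j * V y l)) else 0)
    = (\<Sum>x\<in>I. of_bool (k = - i) * (e i * e x * c * (U x j * V (-x) l)))"
    using assms by (subst sum.swap) simp
  finally show ?thesis by (simp add: sum_distrib_left)
qed

lemma mm_T2_T1_RR:
  fixes U V :: "int \<Rightarrow> int \<Rightarrow> 'a::ring_1"
  assumes I: "finite I" "\<And>i. i \<in> I \<Longrightarrow> - i \<in> I" and "i \<in> I" "k \<in> I" "j \<in> I" "l \<in> I"
  shows "mm (I \<times> I) (mm (I \<times> I) (T2 V) (T1 U)) (RR e a b c) (i, k) (j, l) =
    V k l * U i j * a - V k j * U i l * b + of_bool (l = - j) * (\<Sum>p\<in>I. V k (-p) * U i p * (e p * e j * c))"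
proof -
  have "mm (I \<times> I) (mm (I \<times> I) (T2 V) (T1 U)) (RR e a b c) (i, k) (j, l)
    = (\<Sum>y\<in>I. \<Sum>x\<in>I. V k y * U i x * RR e a b c (x, y) (j, l))"
    using assms by (simp add: mm_assoc mm_T2_left mm_T1_left sum_distrib_left mult.assoc)
  also have "\<dots> = (\<Sum>y\<in>I. \<Sum>x\<in>I. (if x = j then (if y = l then V k y * U i x * a else 0) else 0))
     - (\<Sum>y\<in>I. \<Sum>x\<in>I. (if x = l then (if y = j then V k y * U i x * b else 0) else 0))
     + (\<Sum>y\<in>I. \<Sum>x\<in>I. if y = - x then of_bool (l = - j) * (V k y * U i x * (e x * e j * c)) else 0)"
    unfolding sum.distrib[symmetric] sum_subtractf[symmetric]
    by (intro sum.cong refl) (auto simp: RR_def algebra_simps of_bool_def)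
  also have "(\<Sum>y\<in>I. \<Sum>x\<in>I. (if x = j then (if y = l then V k y * U i x * a else 0) else 0)) = V k l * U i j * a"
    using assms by simp
  also have "(\<Sum>y\<in>I. \<Sum>x\<in>I. (if x = l then (if y = j then V k y * U i x * b else 0) else 0)) = V k j * U i l * b"
    using assms by simp
  also have "(\<Sum>y\<in>I. \<Sum>x\<in>I. if y = - x then of_bool (l = - j) * (V k y * U i x * (e x * e j * c)) else 0)
    = (\<Sum>x\<in>I. of_bool (l = - j) * (V k (-x) * U i x * (e x * e j * c)))"
    using assms by (subst sum.swap) simp
  finally show ?thesis by (simp add: sum_distrib_left)
qed

section \<open>Index set and signs\<close>

text \<open>The sign \<open>\<theta>\<close> splits as a product of two signs, each depending on one index.\<close>

fun eps :: "lie_type \<Rightarrow> int \<Rightarrow> complex" where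
  "eps (SO N) i = 1"
| "eps (SP N) i = of_int (sgn i)"

lemma theta_eps: "theta g i j = eps g i * eps g j"
  by (cases g) auto

lemma finite_idx [simp]: "finite (idx g)"
  by (simp add: idx_def Let_def)

lemma idx_uminus [simp]: "- i \<in> idx g \<longleftrightarrow> i \<in> idx g"
  by (auto simp: idx_def Let_def)

lemma eps_square: "lie_valid g \<Longrightarrow> i \<in> idx g \<Longrightarrow> eps g i * eps g i = 1"
  by (cases g) (auto simp: idx_def Let_def sgn_if)

lemma eps_uminus: "eps g (- i) * eps g (- j) = eps g i * eps g j"
  by (cases g) auto

lemma one_in_idx: "lie_valid g \<Longrightarrow> 1 \<in> idx g"
  by (cases g) (auto simp: idx_def Let_def)

instantiation complex :: calg
begin
definition sc_complex :: "complex \<Rightarrow> complex" where "sc_complex c = c"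
instance by standard (simp_all add: sc_complex_def)
end

lemma sc_inject: "sc c = (0 :: 'a::calg) \<Longrightarrow> c = 0"
proof (rule ccontr)
  assume "sc c = (0 :: 'a)" "c \<noteq> 0"
  then have "sc (c * (1 / c)) = (0 :: 'a)" by (simp only: sc_mult) simp
  then show False using \<open>c \<noteq> 0\<close> by (simp add: sc_one)
qed

lemma sc_cancel: "c \<noteq> 0 \<Longrightarrow> sc c * a = (0 :: 'a::calg) \<Longrightarrow> a = 0"
  by (metis mult_1 mult.assoc mult_zero_right sc_one sc_mult nonzero_eq_divide_eq)

lemma fps_cancel:
  fixes f g :: "'a::ring_1 fps"
  assumes "\<And>a. fps_nth f (subdegree f) * a = 0 \<Longrightarrow> a = 0" "f * g = 0"
  shows "g = 0"
proof -
  have "fps_nth f (subdegree f) * fps_nth g (subdegree g) = fps_nth (f * g) (subdegree f + subdegree g)"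
    by simp
  also have "\<dots> = 0" using assms(2) by simp
  finally have "fps_nth g (subdegree g) = 0" by (rule assms(1))
  then show ?thesis by simp
qed

lemma subdegree_scf: "subdegree (scf c :: 'a::calg fps) = subdegree c"
proof (cases "c = 0")
  case False
  then show ?thesis by (intro subdegreeI) (auto dest: sc_inject simp: sc.zero)
qed (simp add: scf.zero)

lemma scf_cancel: "c \<noteq> 0 \<Longrightarrow> scf c * a = (0 :: 'a::calg fps) \<Longrightarrow> a = 0"
  by (erule fps_cancel[rotated]) (auto simp: subdegree_scf intro: sc_cancel[rotated])

lemma scf_inject: "scf c = (0 :: 'a::calg fps) \<Longrightarrow> c = 0"
  using scf_cancel[of c "1 :: 'a fps"] by auto

lemma subdegree_scff: "subdegree (scff c :: 'a::calg fps fps) = subdegree c"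
proof (cases "c = 0")
  case False
  then show ?thesis by (intro subdegreeI) (auto dest: scf_inject simp: scf.zero)
qed (simp add: scff.zero)

text \<open>Although the coefficient algebra may have zero divisors, nonzero series with scalar
  coefficients can be cancelled, because their lowest coefficient is an invertible scalar.\<close>

lemma scff_cancel: "c \<noteq> 0 \<Longrightarrow> scff c * a = (0 :: 'a::calg fps fps) \<Longrightarrow> a = 0"
  by (erule fps_cancel[rotated]) (auto simp: subdegree_scff intro: scf_cancel[rotated])

section \<open>The RTT relation over power series\<close>

text \<open>The variables \<open>x = 1/u\<close> (outer) and \<open>y = 1/v\<close> (inner). In them \<open>u - v = (y - x)/(x y)\<close>, so that
  \<open>pa g = (y - x) (y - x - \<kappa> x y)\<close> is a common denominator of \<open>R(u - v)\<close>; the series \<open>Rh\<close> below is the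
  product of \<open>R(u - v)\<close> with it.\<close>

abbreviation vx :: "'a::ring_1 fps fps" where "vx \<equiv> fps_X"
abbreviation vy :: "'a::ring_1 fps fps" where "vy \<equiv> fps_const fps_X"
abbreviation cc :: "complex \<Rightarrow> 'a::calg fps fps" where "cc c \<equiv> fps_const (fps_const (sc c))"

definition pa :: "lie_type \<Rightarrow> 'a::calg fps fps" where
  "pa g = (vy - vx) * (vy - vx - cc (kappa g) * vx * vy)"
definition pb :: "lie_type \<Rightarrow> 'a::calg fps fps" where
  "pb g = vx * vy * (vy - vx - cc (kappa g) * vx * vy)"
definition pc :: "'a::calg fps fps" where
  "pc = vx * vy * (vy - vx)"

definition Rh :: "lie_type \<Rightarrow> int \<times> int \<Rightarrow> int \<times> int \<Rightarrow> 'a::calg fps fps" where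
  "Rh g = RR (\<lambda>i. cc (eps g i)) (pa g) (pb g) pc"

abbreviation ser_u :: "(int \<Rightarrow> int \<Rightarrow> 'a::ring_1 fps) \<Rightarrow> int \<Rightarrow> int \<Rightarrow> 'a fps fps" where
  "ser_u t \<equiv> \<lambda>i j. fmap fps_const (t i j)"
abbreviation ser_v :: "(int \<Rightarrow> int \<Rightarrow> 'a::ring_1 fps) \<Rightarrow> int \<Rightarrow> int \<Rightarrow> 'a fps fps" where
  "ser_v t \<equiv> \<lambda>i j. fps_const (t i j)"

definition rtt :: "lie_type \<Rightarrow> (int \<Rightarrow> int \<Rightarrow> 'a::calg fps) \<Rightarrow> bool" where
  "rtt g t \<longleftrightarrow> (\<forall>p\<in>idx g \<times> idx g. \<forall>q\<in>idx g \<times> idx g.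
     mm (idx g \<times> idx g) (mm (idx g \<times> idx g) (Rh g) (T1 (ser_u t))) (T2 (ser_v t)) p q
   = mm (idx g \<times> idx g) (mm (idx g \<times> idx g) (T2 (ser_v t)) (T1 (ser_u t))) (Rh g) p q)"

lemma scff_cc: "scff (cc c) = cc c"
  by (simp add: sc_complex_def)

lemma scff_pa: "scff (pa g) = pa g" and scff_pb: "scff (pb g) = pb g" and scff_pc: "scff pc = pc"
  by (simp_all add: pa_def pb_def pc_def scff.simps scff_cc sc_complex_def)

lemma scff_Rh: "scff (Rh g p q) = Rh g p q"
  by (simp only: Rh_def scff.RR scff_pa scff_pb scff_pc scff_cc)

lemma central_Rh [simp]: "central (Rh g p q)"
  by (metis central_scff scff_Rh)

lemma nz1: "vy - vx \<noteq> (0 :: complex fps fps)"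
  by (auto dest!: arg_cong[of _ _ "\<lambda>f. fps_nth f 0"])
lemma nz2: "vy - vx - cc k * vx * vy \<noteq> (0 :: complex fps fps)"
  by (auto dest!: arg_cong[of _ _ "\<lambda>f. fps_nth f 0"])

lemma sw_morph: "ring_morph (\<lambda>F :: 'a::ring_1 fps fps. Abs_fps (\<lambda>r. Abs_fps (\<lambda>s. fps_nth (fps_nth F s) r)))"
proof
  fix F G :: "'a fps fps"
  show "Abs_fps (\<lambda>r. Abs_fps (\<lambda>s. fps_nth (fps_nth (F * G) s) r)) =
    Abs_fps (\<lambda>r. Abs_fps (\<lambda>s. fps_nth (fps_nth F s) r)) * Abs_fps (\<lambda>r. Abs_fps (\<lambda>s. fps_nth (fps_nth G s) r))"
    by (simp add: fps_eq_iff fps_mult_nth fps_sum_nth) (intro allI, rule sum.swap)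
qed (auto simp: fps_eq_iff)

text \<open>The exchange of the two variables.\<close>

definition sw :: "'a::ring_1 fps fps \<Rightarrow> 'a fps fps" where
  "sw F = Abs_fps (\<lambda>r. Abs_fps (\<lambda>s. fps_nth (fps_nth F s) r))"

interpretation sw: ring_morph sw
  unfolding sw_def by (rule sw_morph)

lemma sw_const: "sw (fps_const f) = fmap fps_const f"
  by (auto simp: sw_def fps_eq_iff)
lemma sw_u: "sw (fmap fps_const f) = fps_const f"
  by (auto simp: sw_def fps_eq_iff)
lemma sw_x: "sw vx = vy"
  by (auto simp: sw_def fps_eq_iff fps_X_def)
lemma sw_y: "sw vy = vx"
  by (auto simp: sw_def fps_eq_iff fps_X_def)
lemma sw_cc: "sw (cc c) = cc c"
  by (auto simp: sw_def fps_eq_iff)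

lemma mm_flip:
  "mm (I \<times> I) A B (prod.swap p) (prod.swap q)
     = mm (I \<times> I) (\<lambda>p q. A (prod.swap p) (prod.swap q)) (\<lambda>p q. B (prod.swap p) (prod.swap q)) p q"
  unfolding mm_def
  by (rule sum.reindex_bij_witness[where i = prod.swap and j = prod.swap]) auto

definition tr :: "lie_type \<Rightarrow> (int \<Rightarrow> int \<Rightarrow> 'a::calg fps) \<Rightarrow> int \<Rightarrow> int \<Rightarrow> 'a fps" where
  "tr g t = (\<lambda>i j. fps_const (sc (theta g (-j) (-i))) * t (-j) (-i))"

text \<open>This is \<open>Q T\<^sub>1(v + \<kappa>) T\<^sub>2(v) = T\<^sub>2(v) T\<^sub>1(v + \<kappa>) Q\<close> in matrix entries: the residue of the RTT
  relation at the pole \<open>u = v + \<kappa>\<close> of the R-matrix. The substitution \<open>u = v + \<kappa>\<close> into the relation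
  without denominators kills the coefficients of the identity and of \<open>P\<close>. For \<open>\<kappa> = 0\<close> it also
  kills that of \<open>Q\<close>; then the common factor \<open>y - x\<close> has to be removed first, and a term with \<open>P\<close>
  survives, which contributes equally to both sides because both arguments of \<open>T\<close> coincide.\<close>

lemma ev_Q_relation:
  fixes t :: "int \<Rightarrow> int \<Rightarrow> 'a::calg fps"
  assumes g: "lie_valid g" and rtt: "rtt g t"
    and I: "i \<in> idx g" "k \<in> idx g" "j \<in> idx g" "l \<in> idx g"
  shows "of_bool (k = - i) * (\<Sum>p\<in>idx g. fps_const (sc (eps g i * eps g p)) * (sub 1 (kappa g) (t p j) * t (-p) l))
       = of_bool (l = - j) * (\<Sum>p\<in>idx g. t k (-p) * sub 1 (kappa g) (t i p) * fps_const (sc (eps g p * eps g j)))"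
proof -
  let ?k = "kappa g" and ?I = "idx g" and ?II = "idx g \<times> idx g"
  define e where "e = mob 1 ?k"
  have e0: "fps_nth e 0 = 0" by (simp add: e_def mob_0)
  have e1: "e * (1 + fps_const ?k * fps_X) = fps_X" using mob_unit[of 1 ?k] by (simp add: e_def)
  interpret E: ring_morph "ev e :: 'a fps fps \<Rightarrow> 'a fps" by (rule ring_morph_ev[OF e0])
  have Eu: "ev e (fmap fps_const (t i j)) = sub 1 ?k (t i j)" for i j
    by (simp add: sub_def e_def)
  have fin: "finite ?I" by simp
  have nz: "e \<noteq> 0" using e1 by auto
  \<comment> \<open>The line \<open>u = v + \<kappa>\<close> in the coordinates \<open>x\<close> and \<open>y\<close>.\<close>
  have e2: "fps_X - e - fps_const ?k * e * fps_X = 0"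
    using e1 by (simp add: algebra_simps)
  \<comment> \<open>Both cases end with a specialised R-matrix \<open>c Q - \<beta> P\<close> whose \<open>P\<close>-term cancels.\<close>
  have final: ?thesis if c: "c \<noteq> 0" and bu: "\<beta> = 0 \<or> (\<forall>i j. sub 1 ?k (t i j) = t i j)"
    and h: "mm ?II (mm ?II (RR (\<lambda>i. fps_const (sc (eps g i))) 0 \<beta> (scf c)) (T1 (\<lambda>i j. sub 1 ?k (t i j)))) (T2 t) (i, k) (j, l)
     = mm ?II (mm ?II (T2 t) (T1 (\<lambda>i j. sub 1 ?k (t i j)))) (RR (\<lambda>i. fps_const (sc (eps g i))) 0 \<beta> (scf c)) (i, k) (j, l)"
     and b: "central \<beta>" for c \<beta>
  proof -
    let ?L = "\<Sum>p\<in>idx g. fps_const (sc (eps g i * eps g p)) * (sub 1 (kappa g) (t p j) * t (-p) l)"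
    let ?R = "\<Sum>p\<in>idx g. t k (-p) * sub 1 (kappa g) (t i p) * fps_const (sc (eps g p * eps g j))"
    have move1: "x * (y * (scf c * w)) = scf c * (x * (y * w))" for x y w :: "'a fps"
      by (simp only: central_left_commute[OF central_scf[of c]])
    have move2: "x * (y * (z * (w * scf c))) = scf c * (x * (y * (z * w)))" for x y z w :: "'a fps"
      using centralD[OF central_scf[of c], of "x * (y * (z * w))"] by (simp add: mult.assoc)
    have s: "\<beta> * (sub 1 ?k (t k j) * t i l) = t k j * sub 1 ?k (t i l) * \<beta>"
      using bu centralD[OF b] by auto
    have "of_bool (k = - i) * (\<Sum>p\<in>?I. fps_const (sc (eps g i)) * fps_const (sc (eps g p)) * scf c * (sub 1 (kappa g) (t p j) * t (-p) l))
      = of_bool (l = - j) * (\<Sum>p\<in>?I. t k (-p) * sub 1 (kappa g) (t i p) * (fps_const (sc (eps g p)) * fps_const (sc (eps g j)) * scf c))"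
      using h unfolding mm_RR_T1_T2[OF fin _ I, simplified] mm_T2_T1_RR[OF fin _ I, simplified] s
      by (simp only: mult_zero_left mult_zero_right add_left_cancel)
    also have "(\<Sum>p\<in>?I. fps_const (sc (eps g i)) * fps_const (sc (eps g p)) * scf c * (sub 1 (kappa g) (t p j) * t (-p) l))
       = scf c * ?L"
      by (simp only: sum_distrib_left fps_const_mult[symmetric] sc_mult mult.assoc move1)
    also have "(\<Sum>p\<in>?I. t k (-p) * sub 1 (kappa g) (t i p) * (fps_const (sc (eps g p)) * fps_const (sc (eps g j)) * scf c)) = scf c * ?R"
      by (simp only: sum_distrib_left fps_const_mult[symmetric] sc_mult mult.assoc move2)
    finally have "scf c * (of_bool (k = - i) * ?L - of_bool (l = - j) * ?R) = 0"
      by (auto simp: algebra_simps of_bool_def split: if_splits)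
    from scf_cancel[OF c this] show ?thesis by simp
  qed
  have A: "mm ?II (mm ?II (Rh g) (T1 (ser_u t))) (T2 (ser_v t)) (i, k) (j, l)
   = mm ?II (mm ?II (T2 (ser_v t)) (T1 (ser_u t))) (Rh g) (i, k) (j, l)"
    using rtt I by (auto simp: rtt_def)
  show ?thesis
  proof (cases "?k = 0")
    case False
    define c where "c = e * fps_X * (fps_X - e)"
    have "fps_X \<noteq> e"
    proof
      assume "fps_X = e"
      with e1 have "fps_X * (1 + fps_const ?k * fps_X) = fps_X * 1" by simp
      then have "1 + fps_const ?k * fps_X = 1" by (subst (asm) mult_left_cancel) simp_all
      then have "fps_nth (1 + fps_const ?k * fps_X) 1 = fps_nth 1 1" by simp
      then show False using False by simp
    qed
    then have cnz: "c \<noteq> 0" using nz by (simp add: c_def)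
    have Er: "ev e (Rh g p q :: 'a fps fps) = RR (\<lambda>i. fps_const (sc (eps g i))) 0 0 (scf c) p q" for p q
    proof -
      have e2': "fps_X - scf e - fps_const (sc ?k) * scf e * fps_X = (0 :: 'a fps)"
        using arg_cong[OF e2, of "scf :: complex fps \<Rightarrow> 'a fps"]
        by (simp only: scf.simps scf_X scf_const)
      have "ev e (pa g :: 'a fps fps) = 0" "ev e (pb g :: 'a fps fps) = 0" "ev e (pc :: 'a fps fps) = scf c"
        unfolding pa_def pb_def pc_def c_def E.mult E.diff ev_X[OF e0] ev_const[OF e0] e2' scf.mult scf.diff scf_X
        by simp_all
      then show ?thesis by (simp add: Rh_def E.RR ev_const[OF e0])
    qed
    show ?thesis
    proof (rule final[OF cnz])
      show "mm ?II (mm ?II (RR (\<lambda>i. fps_const (sc (eps g i))) 0 0 (scf c)) (T1 (\<lambda>i j. sub 1 ?k (t i j)))) (T2 t) (i, k) (j, l)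
     = mm ?II (mm ?II (T2 t) (T1 (\<lambda>i j. sub 1 ?k (t i j)))) (RR (\<lambda>i. fps_const (sc (eps g i))) 0 0 (scf c)) (i, k) (j, l)"
        using arg_cong[OF A, of "ev e"]
        by (simp only: E.mm3 Er E.T1 E.T2 Eu ev_const[OF e0])
    qed auto
  next
    case True
    define R0 where "R0 = (RR (\<lambda>i. cc (eps g i)) (vy - vx) (vx * vy) (vx * vy) :: _ \<Rightarrow> _ \<Rightarrow> 'a fps fps)"
    let ?d = "scff (vy - vx) :: 'a fps fps"
    have "Rh g p q = ?d * R0 p q" for p q :: "int \<times> int"
    proof -
      have 1: "pa g = ?d * (vy - vx)" "pb g = ?d * (vx * vy)" "pc = ?d * (vx * vy)"
        using centralD[OF central_scff[of "vy - vx"], of "vx * vy :: 'a fps fps"]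
        by (simp_all add: pa_def pb_def pc_def True scff.simps sc.zero)
      show ?thesis
        unfolding Rh_def R0_def 1 by (rule RR_scale) simp
    qed
    then have Rd: "Rh g = (\<lambda>p q. ?d * R0 p q)" by (intro ext)
    have "?d * mm ?II (mm ?II R0 (T1 (ser_u t))) (T2 (ser_v t)) (i, k) (j, l)
      = ?d * mm ?II (mm ?II (T2 (ser_v t)) (T1 (ser_u t))) R0 (i, k) (j, l)"
      using A unfolding Rd mm_scale_left mm_scale_right[OF central_scff] .
    then have "?d * (mm ?II (mm ?II R0 (T1 (ser_u t))) (T2 (ser_v t)) (i, k) (j, l)
      - mm ?II (mm ?II (T2 (ser_v t)) (T1 (ser_u t))) R0 (i, k) (j, l)) = 0" by (simp add: algebra_simps)
    from scff_cancel[OF nz1 this]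
    have A0: "mm ?II (mm ?II R0 (T1 (ser_u t))) (T2 (ser_v t)) (i, k) (j, l)
      = mm ?II (mm ?II (T2 (ser_v t)) (T1 (ser_u t))) R0 (i, k) (j, l)" by simp
    have eX: "e = fps_X" using e1 by (simp add: True)
    have Er: "ev e (R0 p q) = RR (\<lambda>i. fps_const (sc (eps g i))) 0 (scf (fps_X * fps_X)) (scf (fps_X * fps_X)) p q" for p q
      by (simp add: R0_def E.RR ev_const[OF e0] E.simps ev_X[OF e0] scf.simps) (simp add: eX scf.simps)
    show ?thesis
    proof (rule final)
      show "mm ?II (mm ?II (RR (\<lambda>i. fps_const (sc (eps g i))) 0 (scf (fps_X * fps_X)) (scf (fps_X * fps_X))) (T1 (\<lambda>i j. sub 1 ?k (t i j)))) (T2 t) (i, k) (j, l)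
     = mm ?II (mm ?II (T2 t) (T1 (\<lambda>i j. sub 1 ?k (t i j)))) (RR (\<lambda>i. fps_const (sc (eps g i))) 0 (scf (fps_X * fps_X)) (scf (fps_X * fps_X))) (i, k) (j, l)"
        using arg_cong[OF A0, of "ev e"]
        by (simp only: E.mm3 Er E.T1 E.T2 Eu ev_const[OF e0])
    qed (auto simp: True)
  qed
qed

text \<open>The two sides of the relation with \<open>Q\<close> are supported on \<open>k = - i\<close> and on \<open>l = - j\<close>. If only one
  condition holds, the other side vanishes, which gives the off-diagonal entries; if both hold, the
  common value does not depend on the indices.\<close>

lemma T_transpose_T_scalar:
  fixes t :: "int \<Rightarrow> int \<Rightarrow> 'a::calg fps"
  assumes g: "lie_valid g" and rtt: "rtt g t"
  defines "t' \<equiv> tr g (\<lambda>i j. sub 1 (kappa g) (t i j))"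
  shows "\<exists>z. \<forall>i\<in>idx g. \<forall>j\<in>idx g. mm (idx g) t' t i j = (if i = j then z else 0)
     \<and> mm (idx g) t t' i j = (if i = j then z else 0)"
proof -
  let ?I = "idx g"
  have c1: "cc' * F = F * cc'" if "cc' = fps_const (sc c)" for cc' F :: "'a fps" and c
    using that by (simp add: centralD central_const)
  have L: "(\<Sum>p\<in>?I. fps_const (sc (eps g i * eps g p)) * (sub 1 (kappa g) (t p j) * t (-p) l))
     = fps_const (sc (eps g i * eps g j)) * mm ?I t' t (-j) l" if "i \<in> ?I" "j \<in> ?I" for i j l
  proof -
    have "mm ?I t' t (-j) l = (\<Sum>p\<in>?I. fps_const (sc (eps g p * eps g j)) * (sub 1 (kappa g) (t p j) * t (-p) l))"
      unfolding mm_def t'_def tr_def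
      by (rule sum.reindex_bij_witness[where i = uminus and j = uminus]) (auto simp: theta_eps mult.assoc)
    then have "fps_const (sc (eps g i * eps g j)) * mm ?I t' t (-j) l
      = (\<Sum>p\<in>?I. fps_const (sc ((eps g i * eps g p) * (eps g j * eps g j))) * (sub 1 (kappa g) (t p j) * t (-p) l))"
      by (simp add: sum_distrib_left mult.assoc[symmetric] sc_mult[symmetric])
         (intro sum.cong refl arg_cong[of _ _ "\<lambda>x. x * _"] arg_cong[of _ _ "\<lambda>x. _ (_ x) * _"], simp add: mult_ac)
    then show ?thesis using that by (simp add: eps_square[OF g])
  qed
  have R: "(\<Sum>p\<in>?I. t k (-p) * sub 1 (kappa g) (t i p) * fps_const (sc (eps g p * eps g j)))
     = fps_const (sc (eps g i * eps g j)) * mm ?I t t' k (-i)" if "i \<in> ?I" "j \<in> ?I" for i j k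
  proof -
    have "mm ?I t t' k (-i) = (\<Sum>p\<in>?I. t k (-p) * (fps_const (sc (eps g i * eps g p)) * sub 1 (kappa g) (t i p)))"
      unfolding mm_def t'_def tr_def
      by (rule sum.reindex_bij_witness[where i = uminus and j = uminus]) (auto simp: theta_eps)
    also have "\<dots> = (\<Sum>p\<in>?I. fps_const (sc (eps g i * eps g p)) * (t k (-p) * sub 1 (kappa g) (t i p)))"
      by (intro sum.cong refl central_left_commute central_const central_sc)
    finally have "fps_const (sc (eps g i * eps g j)) * mm ?I t t' k (-i)
      = (\<Sum>p\<in>?I. fps_const (sc ((eps g p * eps g j) * (eps g i * eps g i))) * (t k (-p) * sub 1 (kappa g) (t i p)))"
      by (simp add: sum_distrib_left mult.assoc[symmetric] sc_mult[symmetric])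
         (intro sum.cong refl arg_cong[of _ _ "\<lambda>x. x * _"] arg_cong[of _ _ "\<lambda>x. _ (_ x) * _"], simp add: mult_ac)
    then show ?thesis using that by (simp add: eps_square[OF g] c1[OF refl])
  qed
  have key: "of_bool (k = - i) * mm ?I t' t (-j) l = of_bool (l = - j) * mm ?I t t' k (-i)"
    if "i \<in> ?I" "k \<in> ?I" "j \<in> ?I" "l \<in> ?I" for i j k l
  proof -
    have "fps_const (sc (eps g i * eps g j)) * (of_bool (k = - i) * mm ?I t' t (-j) l)
      = fps_const (sc (eps g i * eps g j)) * (of_bool (l = - j) * mm ?I t t' k (-i))"
      using ev_Q_relation[OF g rtt that] that by (simp add: L R of_bool_def split: if_splits)
    then have "scf (fps_const (eps g i * eps g j)) * (of_bool (k = - i) * mm ?I t' t (-j) l - of_bool (l = - j) * mm ?I t t' k (-i)) = 0"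
      by (simp add: algebra_simps)
    moreover have "fps_const (eps g i * eps g j) \<noteq> 0"
      using that eps_square[OF g, of i] eps_square[OF g, of j] by auto
    ultimately have "of_bool (k = - i) * mm ?I t' t (-j) l - of_bool (l = - j) * mm ?I t t' k (-i) = 0"
      by (metis scf_cancel)
    then show ?thesis by simp
  qed
  have e: "1 \<in> ?I" using one_in_idx[OF g] .
  have key': "of_bool (k = i) * mm ?I t' t j l = of_bool (l = j) * mm ?I t t' k i"
    if "i \<in> ?I" "k \<in> ?I" "j \<in> ?I" "l \<in> ?I" for i j k l
    using key[of "-i" k "-j" l] that by simp
  show ?thesis
  proof (intro exI[of _ "mm ?I t t' 1 1"] ballI)
    fix i j assume ij: "i \<in> ?I" "j \<in> ?I"
    show "mm ?I t' t i j = (if i = j then mm ?I t t' 1 1 else 0) \<and> mm ?I t t' i j = (if i = j then mm ?I t t' 1 1 else 0)"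
      using key'[OF e e ij] key'[of j i 1 1] key'[of i i 1 1] key'[OF e e e e] ij e by (auto split: if_splits)
  qed
qed

text \<open>The partial transposition in the second tensor factor. It fixes the identity matrix and exchanges \<open>P\<close> with \<open>Q\<close>.\<close>

definition ptr :: "lie_type \<Rightarrow> (int \<times> int \<Rightarrow> int \<times> int \<Rightarrow> 'a::calg fps fps) \<Rightarrow> int \<times> int \<Rightarrow> int \<times> int \<Rightarrow> 'a fps fps" where
  "ptr g M = (\<lambda>(i, k) (j, l). cc (eps g k * eps g l) * M (i, - l) (j, - k))"

lemma central_cc [simp]: "central (cc c)"
  by (intro central_const central_sc)

lemma cc_mult: "cc a * cc b = cc (a * b)"
  by (simp add: sc_mult)

lemma cc_mult_left: "cc a * (cc b * c) = cc (a * b) * c"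
  by (simp only: cc_mult mult.assoc[symmetric])

text \<open>The relation \<open>T\<^sub>2\<^sup>t(v + \<kappa>) R T\<^sub>1(u) = T\<^sub>1(u) R T\<^sub>2\<^sup>t(v + \<kappa>)\<close>. The RTT relation with exchanged
  factors and variables reads \<open>R(v - u) T\<^sub>2(v) T\<^sub>1(u) = T\<^sub>1(u) T\<^sub>2(v) R(v - u)\<close>. After the shift of \<open>v\<close>
  by \<open>\<kappa>\<close>, a partial transposition in the second factor reverses the order of the factors with
  respect to that factor only and replaces \<open>R(v - u + \<kappa>)\<close> by its partial transpose, which is \<open>R(u - v)\<close>:
  the poles of \<open>P\<close> and \<open>Q\<close> are exchanged by \<open>u - v \<mapsto> \<kappa> - (u - v)\<close>.\<close>

lemma crossing_relation:
  fixes t :: "int \<Rightarrow> int \<Rightarrow> 'a::calg fps"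
  assumes g: "lie_valid g" and rtt: "rtt g t" and pq: "p \<in> idx g \<times> idx g" "q \<in> idx g \<times> idx g"
  defines "V' \<equiv> ser_v (tr g (\<lambda>i j. sub 1 (kappa g) (t i j)))"
  shows "mm (idx g \<times> idx g) (mm (idx g \<times> idx g) (T2 V') (Rh g)) (T1 (ser_u t)) p q
       = mm (idx g \<times> idx g) (mm (idx g \<times> idx g) (T1 (ser_u t)) (Rh g)) (T2 V') p q"
proof -
  let ?k = "kappa g" and ?I = "idx g" and ?II = "idx g \<times> idx g" and ?U = "ser_u t"
  define Vs where "Vs = ser_v (\<lambda>i j. sub 1 ?k (t i j))"
  let ?sh = "fmap (sub 1 ?k) :: 'a fps fps \<Rightarrow> 'a fps fps"
  interpret b: ring_morph "sub 1 ?k :: 'a fps \<Rightarrow> 'a fps" by (rule ring_morph_sub) simp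
  interpret s: ring_morph ?sh by (intro ring_morph_fmap b.ring_morph_axioms)
  have sub_const: "sub 1 a (fps_const x) = fps_const x" for a and x :: 'a
    by (simp add: sub_def fmap_const ev_const mob_0)
  have shU: "?sh (?U i j) = ?U i j" for i j
    by (simp add: fps_eq_iff sub_const)
  have shV: "?sh (ser_v t i j) = Vs i j" for i j
    by (simp add: Vs_def fmap_const b.zero)
  \<comment> \<open>The R-matrix \<open>R(v + \<kappa> - u)\<close>, without denominators.\<close>
  define R1 where "R1 = (\<lambda>p q. ?sh (sw (Rh g (prod.swap p) (prod.swap q))) :: 'a fps fps)"
  have A1: "mm ?II (mm ?II R1 (T2 Vs)) (T1 ?U) p q = mm ?II (mm ?II (T1 ?U) (T2 Vs)) R1 p q"
    if "p \<in> ?II" "q \<in> ?II" for p q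
  proof -
    have 1: "mm ?II (mm ?II (Rh g) (T1 ?U)) (T2 (ser_v t)) (prod.swap p) (prod.swap q)
      = mm ?II (mm ?II (T2 (ser_v t)) (T1 ?U)) (Rh g) (prod.swap p) (prod.swap q)"
      using rtt that by (auto simp: rtt_def)
    have T1: "?sh (sw (T1 ?U (prod.swap p) (prod.swap q))) = T2 Vs p q" for p q
      by (cases p; cases q) (auto simp: T1_def T2_def sw.zero s.zero sw_u shV)
    have T2: "?sh (sw (T2 (ser_v t) (prod.swap p) (prod.swap q))) = T1 ?U p q" for p q
      by (cases p; cases q) (auto simp: T1_def T2_def sw.zero s.zero sw_const shU)
    show ?thesis
      using arg_cong[OF 1, of "\<lambda>F. ?sh (sw F)"]
      by (simp only: mm_flip sw.mm s.mm T1 T2 R1_def)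
  qed
  \<comment> \<open>The shift turns \<open>y\<close> into \<open>w = y / d\<close>; the square of \<open>d\<close> clears the new denominators.\<close>
  define d where "d = (1 + cc ?k * vy :: complex fps fps)"
  let ?d = "scff d :: 'a fps fps"
  define w where "w = (fps_const (mob 1 ?k) :: complex fps fps)"
  interpret cst: ring_morph "fps_const :: complex fps \<Rightarrow> _" by (rule ring_morph_fps_const)
  have "d = fps_const (fps_const 1 + fps_const ?k * fps_X)"
    by (simp only: d_def cst.add cst.mult sc_complex_def fps_const_1_eq_1 cst.one)
  then have "w * d = vy"
    by (simp only: w_def cst.mult[symmetric] mob_unit[OF one_neq_zero])
  then have dw: "d * w = vy"
    by (simp only: mult.commute[of d w])
  define a1 where "a1 = (vx - w) * (vx - w - cc ?k * w * vx)"
  define b1 where "b1 = w * vx * (vx - w - cc ?k * w * vx)"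
  define c1 where "c1 = w * vx * (vx - w)"
  have dvx: "d * vx = vx + cc ?k * vx * vy"
    by (simp only: d_def distrib_right distrib_left mult_1_left mult_1_right mult_ac)
  have dx: "d * (vx - w) = vx + cc ?k * vx * vy - vy"
    by (simp only: right_diff_distrib dw dvx)
  have "d * (cc ?k * w * vx) = cc ?k * vx * (d * w)"
    by (simp only: mult_ac)
  then have dy: "d * (vx - w - cc ?k * w * vx) = vx - vy"
    by (simp only: right_diff_distrib dw dvx) (metis add_diff_cancel_right diff_diff_eq)
  have I1: "d * d * a1 = pa g"
  proof -
    have "d * d * a1 = (d * (vx - w)) * (d * (vx - w - cc ?k * w * vx))" by (simp only: a1_def mult_ac)
    also have "\<dots> = - (vy - vx - cc ?k * vx * vy) * - (vy - vx)"
      unfolding dx dy by (intro arg_cong2[of _ _ _ _ "(*)"]) simp_all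
    finally show ?thesis by (simp only: pa_def minus_mult_minus mult.commute)
  qed
  have I2: "d * d * b1 = - pc"
  proof -
    have "d * d * b1 = (d * w) * vx * (d * (vx - w - cc ?k * w * vx))" by (simp only: b1_def mult_ac)
    also have "\<dots> = vx * vy * - (vy - vx)" unfolding dw dy by (simp only: minus_diff_eq mult.commute)
    finally show ?thesis by (simp only: pc_def mult_minus_right)
  qed
  have I3: "d * d * c1 = - pb g"
  proof -
    have "d * d * c1 = (d * w) * vx * (d * (vx - w))" by (simp only: c1_def mult_ac)
    also have "d * (vx - w) = - (vy - vx - cc ?k * vx * vy)" unfolding dx by simp
    finally show ?thesis unfolding dw by (simp only: pb_def mult_minus_right mult.commute[of vy vx])
  qed
  have sh_vy: "?sh vy = scff w"
  proof -
    have "sub 1 ?k fps_X = (scf (mob 1 ?k) :: 'a fps)"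
      by (simp add: sub_def fmap_X ev_X mob_0)
    then show ?thesis by (simp only: fmap_const[of "sub 1 ?k", OF b.zero] w_def scff_const)
  qed
  have sh_vx: "?sh vx = vx"
    by (simp add: fmap_X b.zero b.one)
  have sh_cc: "?sh (cc c) = cc c" for c
    by (simp add: fmap_const b.zero sub_const)
  have R1: "R1 p q = RR (\<lambda>i. cc (eps g i)) (scff a1) (scff b1) (scff c1) (prod.swap p) (prod.swap q)" for p q
    unfolding R1_def Rh_def sw.RR s.RR
    by (simp add: pa_def pb_def pc_def sw.simps s.simps sw_x sw_y sw_cc sh_vy sh_vx sh_cc a1_def b1_def c1_def
      scff.simps sc_complex_def del: fps_const_mult)
  have cR1: "central (R1 p q)" for p q :: "int \<times> int"
  proof -
    have "R1 p q = scff (RR (\<lambda>i. cc (eps g i)) a1 b1 c1 (prod.swap p) (prod.swap q))"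
      by (simp only: R1 scff.RR scff_cc)
    then show ?thesis by simp
  qed
  have ptrR: "?d * ?d * ptr g R1 p q = Rh g p q" if "p \<in> ?II" "q \<in> ?II" for p q
  proof -
    obtain i k j l where pq: "p = (i, k)" "q = (j, l)" by fastforce
    have e: "eps g k * eps g k = 1" using that pq by (auto simp: eps_square[OF g])
    let ?E = "cc (eps g k * eps g l) :: 'a fps fps"
    have d1: "?d * ?d * scff a1 = pa g" "?d * ?d * scff b1 = - pc" "?d * ?d * scff c1 = - pb g"
      using arg_cong[OF I1, of scff] arg_cong[OF I2, of scff] arg_cong[OF I3, of scff]
      by (simp_all only: scff.simps scff_pa scff_pb scff_pc)
    have bools: "(- l = - k \<and> i = j) = (i = j \<and> k = l)" "(i = - k \<and> j = - l) = (k = - i \<and> l = - j)"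
      "(i = - (- l) \<and> j = - (- k)) = (k = j \<and> l = i)"
      by auto
    have gen: "D * (E * (of_bool P * A - of_bool Q * B + of_bool R * (E * C)))
       = of_bool P * (E * (D * A)) - of_bool Q * (E * (D * B)) + of_bool R * (E * (E * (D * C)))"
      if "central D" "central E" for A B C D E :: "'a fps fps" and P Q R
    proof -
      have "D * (E * X) = E * (D * X)" "D * (E * (E * X)) = E * (E * (D * X))" for X
        using that by (metis central_left_commute)+
      then show ?thesis by (cases P; cases Q; cases R) (simp_all add: distrib_left right_diff_distrib)
    qed
    have cD: "central (?d * ?d)" by (intro central_mult) simp_all
    have "ptr g R1 p q = ?E * (of_bool (i = j \<and> k = l) * scff a1 - of_bool (k = - i \<and> l = - j) * scff b1
        + of_bool (k = j \<and> l = i) * (?E * scff c1))"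
      unfolding pq ptr_def R1 RR_def prod.case prod.swap_def fst_conv snd_conv bools cc_mult eps_uminus
      by (simp only: mult.commute[of "eps g l"])
    then have "?d * ?d * ptr g R1 p q = of_bool (i = j \<and> k = l) * (?E * pa g) - of_bool (k = - i \<and> l = - j) * (?E * - pc)
        + of_bool (k = j \<and> l = i) * (?E * (?E * - pb g))"
      by (simp only: gen[OF cD central_cc] d1)
    moreover have "of_bool (i = j \<and> k = l) * (?E * pa g) = of_bool (i = j \<and> k = l) * pa g"
      using e by (auto simp: sc_one)
    moreover have "of_bool (k = - i \<and> l = - j) * (?E * - pc) = - (of_bool (k = - i \<and> l = - j) * (cc (eps g i) * cc (eps g j) * pc))"
      by (cases "k = - i \<and> l = - j") (simp_all only: of_bool_def if_True if_False cc_mult eps_uminus mult_1 mult_zero_left mult_minus_right minus_zero)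
    moreover have "of_bool (k = j \<and> l = i) * (?E * (?E * - pb g)) = - (of_bool (k = j \<and> l = i) * pb g)"
    proof -
      have "?E * (?E * X) = X" for X
      proof -
        have "?E * (?E * X) = cc ((eps g k * eps g k) * (eps g l * eps g l)) * X"
          by (simp only: cc_mult_left mult_ac)
        then show ?thesis using e that pq by (simp add: eps_square[OF g] sc_one)
      qed
      then show ?thesis by simp
    qed
    ultimately show ?thesis
      by (simp only: Rh_def RR_def pq prod.case) (simp add: algebra_simps)
  qed
  have V': "V' k b = cc (eps g b * eps g k) * Vs (- b) (- k)" for k b
    by (simp add: V'_def Vs_def tr_def theta_eps eps_uminus)
  have A2: "mm ?II (mm ?II (T2 V') (ptr g R1)) (T1 ?U) p q = mm ?II (mm ?II (T1 ?U) (ptr g R1)) (T2 V') p q"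
    if pq: "p \<in> ?II" "q \<in> ?II" for p q
  proof -
    obtain i k j l where pq': "p = (i, k)" "q = (j, l)" by fastforce
    then have I: "i \<in> ?I" "k \<in> ?I" "j \<in> ?I" "l \<in> ?I" using pq by auto
    note e = eps_square[OF g]
    have move2: "central x \<Longrightarrow> central y \<Longrightarrow> v * (x * (y * u)) = x * (y * (v * u))" for x y u v :: "'a fps fps"
      by (metis central_left_commute)
    have move3: "central x \<Longrightarrow> central y \<Longrightarrow> u * (x * (r * (y * v))) = x * (y * (u * (r * v)))" for x y u v r :: "'a fps fps"
      by (metis central_left_commute)
    have "mm ?II (mm ?II (T2 V') (ptr g R1)) (T1 ?U) p q
      = (\<Sum>b\<in>?I. \<Sum>a\<in>?I. V' k b * (ptr g R1 (i, b) (a, l) * ?U a j))"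
      by (simp add: pq' mm_assoc mm_T2_left mm_T1_right I sum_distrib_left)
    also have "\<dots> = (\<Sum>b\<in>?I. \<Sum>a\<in>?I. cc (eps g k * eps g l) * (R1 (i, - l) (a, - b) * (Vs (- b) (- k) * ?U a j)))"
    proof (intro sum.cong refl)
      fix a b assume "a \<in> ?I" "b \<in> ?I"
      have "V' k b * (ptr g R1 (i, b) (a, l) * ?U a j)
        = cc (eps g b * eps g k) * (Vs (- b) (- k) * (cc (eps g b * eps g l) * (R1 (i, - l) (a, - b) * ?U a j)))"
        by (simp only: V' ptr_def prod.case mult.assoc)
      also have "\<dots> = cc (eps g b * eps g k) * (cc (eps g b * eps g l) * (R1 (i, - l) (a, - b) * (Vs (- b) (- k) * ?U a j)))"
        by (simp only: move2[OF central_cc cR1])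
      also have "\<dots> = cc ((eps g b * eps g b) * (eps g k * eps g l)) * (R1 (i, - l) (a, - b) * (Vs (- b) (- k) * ?U a j))"
        by (simp only: cc_mult_left mult_ac)
      finally show "V' k b * (ptr g R1 (i, b) (a, l) * ?U a j) = cc (eps g k * eps g l) * (R1 (i, - l) (a, - b) * (Vs (- b) (- k) * ?U a j))"
        using e[OF \<open>b \<in> ?I\<close>] by simp
    qed
    also have "\<dots> = (\<Sum>b\<in>?I. \<Sum>a\<in>?I. cc (eps g k * eps g l) * (R1 (i, - l) (a, b) * (Vs b (- k) * ?U a j)))"
      by (rule sum.reindex_bij_witness[where i = uminus and j = uminus]) auto
    also have "\<dots> = cc (eps g k * eps g l) * mm ?II (mm ?II R1 (T2 Vs)) (T1 ?U) (i, - l) (j, - k)"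
      by (subst sum.swap) (simp add: mm_T2_right mm_T1_right I sum_distrib_left sum_distrib_right mult.assoc)
    also have "\<dots> = cc (eps g k * eps g l) * mm ?II (mm ?II (T1 ?U) (T2 Vs)) R1 (i, - l) (j, - k)"
      using A1[of "(i, -l)" "(j, -k)"] I by simp
    also have "\<dots> = (\<Sum>b\<in>?I. \<Sum>a\<in>?I. cc (eps g k * eps g l) * (?U i a * (Vs (- l) b * R1 (a, b) (j, - k))))"
      by (subst sum.swap) (simp add: mm_T2_left mm_T1_left mm_assoc I sum_distrib_left sum_distrib_right mult.assoc)
    also have "\<dots> = (\<Sum>b\<in>?I. \<Sum>a\<in>?I. cc (eps g k * eps g l) * (?U i a * (Vs (- l) (- b) * R1 (a, - b) (j, - k))))"
      by (rule sum.reindex_bij_witness[where i = uminus and j = uminus]) auto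
    also have "\<dots> = (\<Sum>b\<in>?I. \<Sum>a\<in>?I. ?U i a * ptr g R1 (a, k) (j, b) * V' b l)"
    proof (intro sum.cong refl)
      fix a b assume "a \<in> ?I" "b \<in> ?I"
      have "?U i a * ptr g R1 (a, k) (j, b) * V' b l
        = ?U i a * (cc (eps g k * eps g b) * (R1 (a, - b) (j, - k) * (cc (eps g l * eps g b) * Vs (- l) (- b))))"
        by (simp only: V' ptr_def prod.case mult.assoc)
      also have "\<dots> = cc (eps g k * eps g b) * (cc (eps g l * eps g b) * (?U i a * (R1 (a, - b) (j, - k) * Vs (- l) (- b))))"
        by (simp only: move3[OF central_cc central_cc])
      also have "\<dots> = cc ((eps g b * eps g b) * (eps g k * eps g l)) * (?U i a * (R1 (a, - b) (j, - k) * Vs (- l) (- b)))"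
        by (simp only: cc_mult_left mult_ac)
      also have "R1 (a, - b) (j, - k) * Vs (- l) (- b) = Vs (- l) (- b) * R1 (a, - b) (j, - k)"
        by (rule centralD[OF cR1])
      finally show "cc (eps g k * eps g l) * (?U i a * (Vs (- l) (- b) * R1 (a, - b) (j, - k))) = ?U i a * ptr g R1 (a, k) (j, b) * V' b l"
        using e[OF \<open>b \<in> ?I\<close>] by simp
    qed
    also have "\<dots> = mm ?II (mm ?II (T1 ?U) (ptr g R1)) (T2 V') p q"
      by (simp add: pq' mm_T2_right mm_T1_left I sum_distrib_right)
    finally show ?thesis .
  qed
  define dd where "dd = ?d * ?d"
  have dd: "central dd" by (simp add: dd_def central_mult)
  have "mm ?II (mm ?II (T2 V') (Rh g)) (T1 ?U) p q
    = mm ?II (mm ?II (T2 V') (\<lambda>p q. dd * ptr g R1 p q)) (T1 ?U) p q"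
    by (intro mm_cong refl) (simp_all add: ptrR[folded dd_def] pq)
  also have "\<dots> = dd * mm ?II (mm ?II (T2 V') (ptr g R1)) (T1 ?U) p q"
    by (simp only: mm_scale_left mm_scale_right[OF dd])
  also have "\<dots> = dd * mm ?II (mm ?II (T1 ?U) (ptr g R1)) (T2 V') p q"
    by (simp add: A2 pq)
  also have "\<dots> = mm ?II (mm ?II (T1 ?U) (\<lambda>p q. dd * ptr g R1 p q)) (T2 V') p q"
    by (simp only: mm_scale_left mm_scale_right[OF dd])
  also have "\<dots> = mm ?II (mm ?II (T1 ?U) (Rh g)) (T2 V') p q"
    by (intro mm_cong refl) (simp_all add: ptrR[folded dd_def] pq)
  finally show ?thesis .
qed

text \<open>The R-matrix is invertible up to a scalar factor, but a single column suffices here: for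
  \<open>j \<noteq> 0\<close> the column \<open>(j, j)\<close> of \<open>R\<close> is a multiple of a basis vector, and for \<open>j = 0\<close> the column
  \<open>(0, 1)\<close> has only one entry with second index 1.\<close>

lemma RR_right_cancel:
  fixes C :: "int \<Rightarrow> int \<Rightarrow> 'a::calg fps fps"
  assumes g: "lie_valid g" and "i \<in> idx g" "j \<in> idx g"
    and C: "\<And>p q. p \<in> idx g \<times> idx g \<Longrightarrow> q \<in> idx g \<times> idx g \<Longrightarrow> mm (idx g \<times> idx g) (T1 C) (Rh g) p q = 0"
  shows "C i j = 0"
proof (cases "j = 0")
  case False
  have "0 = (\<Sum>a\<in>idx g. C i a * Rh g (a, j) (j, j))"
    using C[of "(i, j)" "(j, j)"] assms by (simp add: mm_T1_left)
  also have "\<dots> = (\<Sum>a\<in>idx g. if a = j then C i a * (pa g - pb g) else 0)"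
    using False by (intro sum.cong) (auto simp: Rh_def RR_def)
  also have "\<dots> = C i j * scff (pa g - pb g)"
    using assms by (simp add: scff.diff scff_pa scff_pb)
  also have "\<dots> = scff (pa g - pb g) * C i j" by (rule centralD[OF central_scff, symmetric])
  finally have "scff (pa g - pb g) * C i j = 0" by simp
  moreover have "pa g - pb g \<noteq> (0 :: complex fps fps)"
  proof -
    have "pa g - pb g = (vy - vx - vx * vy) * (vy - vx - cc (kappa g) * vx * vy :: complex fps fps)"
      by (simp add: pa_def pb_def algebra_simps)
    moreover have "vy - vx - vx * vy \<noteq> (0 :: complex fps fps)"
      using nz2[of 1] by (simp add: sc_complex_def)
    ultimately show ?thesis using nz2 by simp
  qed
  ultimately show ?thesis by (rule scff_cancel[rotated])
next
  case True
  have 1: "1 \<in> idx g" by (rule one_in_idx[OF g])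
  have "0 = (\<Sum>a\<in>idx g. C i a * Rh g (a, 1) (j, 1))"
    using C[of "(i, 1)" "(j, 1)"] assms 1 by (simp add: mm_T1_left)
  also have "\<dots> = (\<Sum>a\<in>idx g. if a = j then C i a * pa g else 0)"
    using True by (intro sum.cong) (auto simp: Rh_def RR_def)
  also have "\<dots> = C i j * scff (pa g)"
    using assms by (simp add: scff_pa)
  also have "\<dots> = scff (pa g) * C i j" by (rule centralD[OF central_scff, symmetric])
  finally have "scff (pa g) * C i j = 0" by simp
  moreover have "pa g \<noteq> (0 :: complex fps fps)"
    using nz1 nz2 by (simp add: pa_def)
  ultimately show ?thesis by (rule scff_cancel[rotated])
qed

text \<open>The product \<open>T\<^sub>2\<^sup>t(v + \<kappa>) R T\<^sub>1(u) T\<^sub>2(v)\<close> equals \<open>T\<^sub>1(u) R z(v)\<close> by the crossing relation and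
  \<open>z(v) T\<^sub>1(u) R\<close> by the RTT relation; cancelling \<open>R\<close> shows that \<open>z(v)\<close> commutes with \<open>T(u)\<close>.\<close>

lemma T_transpose_T_commutes:
  fixes t :: "int \<Rightarrow> int \<Rightarrow> 'a::calg fps"
  assumes g: "lie_valid g" and rtt: "rtt g t"
  assumes z: "\<And>i j. i \<in> idx g \<Longrightarrow> j \<in> idx g \<Longrightarrow>
     mm (idx g) (tr g (\<lambda>i j. sub 1 (kappa g) (t i j))) t i j = (if i = j then z else 0)"
    and ij: "i \<in> idx g" "j \<in> idx g"
  shows "fps_nth z m * fps_nth (t i j) n = fps_nth (t i j) n * fps_nth z m"
proof -
  let ?I = "idx g" and ?II = "idx g \<times> idx g"
  let ?U = "ser_u t" and ?V = "ser_v t" and ?z = "fps_const z"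
  define V' where "V' = ser_v (tr g (\<lambda>i j. sub 1 (kappa g) (t i j)))"
  interpret c: ring_morph "fps_const :: 'a fps \<Rightarrow> _" by (rule ring_morph_fps_const)
  have VV: "mm ?II (T2 V') (T2 ?V) p q = (if p = q then ?z else 0)" if "p \<in> ?II" "q \<in> ?II" for p q
  proof -
    obtain i k j l where pq: "p = (i, k)" "q = (j, l)" by fastforce
    have "mm ?II (T2 V') (T2 ?V) p q = (\<Sum>b\<in>?I. V' k b * T2 ?V (i, b) (j, l))"
      using that by (simp add: pq mm_T2_left)
    also have "\<dots> = (if i = j then fps_const (mm ?I (tr g (\<lambda>i j. sub 1 (kappa g) (t i j))) t k l) else 0)"
      by (simp add: T2_def V'_def mm_def c.sum)
    finally show ?thesis using that by (auto simp: pq z)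
  qed
  have delta_left: "mm ?II (\<lambda>p q. if p = q then ?z else 0) M p q = ?z * M p q" if "p \<in> ?II" for M and p q :: "int \<times> int"
    using that by (simp add: mm_def if_distrib[of "\<lambda>x. x * _"] cong: if_cong)
  have delta_right: "mm ?II M (\<lambda>p q. if p = q then ?z else 0) p q = M p q * ?z" if "q \<in> ?II" for M and p q :: "int \<times> int"
    using that by (simp add: mm_def if_distrib[of "\<lambda>x. _ * x"] cong: if_cong)
  have main: "mm ?II (T1 (\<lambda>i j. ?z * ?U i j - ?U i j * ?z)) (Rh g) p q = 0" if pq: "p \<in> ?II" "q \<in> ?II" for p q
  proof -
    have "mm ?II (T2 V') (mm ?II (mm ?II (Rh g) (T1 ?U)) (T2 ?V)) p q
       = mm ?II (mm ?II (mm ?II (T2 V') (Rh g)) (T1 ?U)) (T2 ?V) p q"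
      by (simp only: mm_assoc)
    also have "\<dots> = mm ?II (mm ?II (mm ?II (T1 ?U) (Rh g)) (T2 V')) (T2 ?V) p q"
      unfolding V'_def by (intro mm_cong refl crossing_relation[OF g rtt] pq)
    also have "\<dots> = mm ?II (mm ?II (T1 ?U) (Rh g)) (mm ?II (T2 V') (T2 ?V)) p q"
      by (simp only: mm_assoc)
    also have "\<dots> = mm ?II (mm ?II (T1 ?U) (Rh g)) (\<lambda>p q. if p = q then ?z else 0) p q"
      by (intro mm_cong refl VV pq)
    also have "\<dots> = mm ?II (T1 ?U) (Rh g) p q * ?z" by (rule delta_right[OF pq(2)])
    finally have 1: "mm ?II (T2 V') (mm ?II (mm ?II (Rh g) (T1 ?U)) (T2 ?V)) p q = mm ?II (T1 ?U) (Rh g) p q * ?z" .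
    have "mm ?II (T2 V') (mm ?II (mm ?II (Rh g) (T1 ?U)) (T2 ?V)) p q
       = mm ?II (T2 V') (mm ?II (mm ?II (T2 ?V) (T1 ?U)) (Rh g)) p q"
      by (rule mm_cong_right) (rule rtt[unfolded rtt_def, rule_format, OF _ pq(2)])
    also have "\<dots> = mm ?II (mm ?II (T2 V') (T2 ?V)) (mm ?II (T1 ?U) (Rh g)) p q"
      by (simp only: mm_assoc)
    also have "\<dots> = mm ?II (\<lambda>p q. if p = q then ?z else 0) (mm ?II (T1 ?U) (Rh g)) p q"
      by (intro mm_cong refl VV pq)
    also have "\<dots> = ?z * mm ?II (T1 ?U) (Rh g) p q" by (rule delta_left[OF pq(1)])
    finally have 2: "?z * mm ?II (T1 ?U) (Rh g) p q - mm ?II (T1 ?U) (Rh g) p q * ?z = 0"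
      using 1 by simp
    have "?z * (T1 ?U p s * Rh g s q) - T1 ?U p s * Rh g s q * ?z = T1 (\<lambda>i j. ?z * ?U i j - ?U i j * ?z) p s * Rh g s q" for s
    proof -
      have "T1 ?U p s * Rh g s q * ?z = T1 ?U p s * ?z * Rh g s q"
        by (simp add: mult.assoc centralD[OF central_Rh])
      then show ?thesis
        by (cases p; cases s) (auto simp: T1_def algebra_simps)
    qed
    then show ?thesis using 2 by (simp add: mm_def sum_distrib_left sum_distrib_right flip: sum_subtractf)
  qed
  from RR_right_cancel[OF g ij main]
  have "?z * ?U i j = ?U i j * ?z" by simp
  from arg_cong[OF this, of "\<lambda>F. fps_nth (fps_nth F n) m"]
  show ?thesis by simp
qed

section \<open>Two-variable Laurent series\<close>

lemma map_fls_nth: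
  assumes "h 0 = 0" shows "fls_nth (map_fls h F) n = h (fls_nth F n)"
  unfolding map_fls_def
proof (rule nth_Abs_fls_ex_lower_bound)
  show "\<exists>N. \<forall>n<N. h (fls_nth F n) = 0"
    using assms by (intro exI[of _ "fls_subdegree F"]) simp
qed

lemma fls_times_nth_wide:
  fixes f g :: "'a::ring_1 fls"
  assumes "a \<le> fls_subdegree f" "b \<le> fls_subdegree g"
  shows "fls_nth (f * g) n = (\<Sum>i=a..n - b. fls_nth f i * fls_nth g (n - i))"
  unfolding fls_times_nth(2) using assms
  by (intro sum.mono_neutral_left) auto

lemma ring_morph_map_fls:
  assumes "ring_morph h" shows "ring_morph (map_fls h)"
proof -
  interpret ring_morph h by fact
  note nth = map_fls_nth[of h, OF zero]
  show ?thesis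
  proof
    show "map_fls h 1 = 1" by (intro fls_eqI) (simp add: nth simps)
    fix x y
    show "map_fls h (x + y) = map_fls h x + map_fls h y" by (intro fls_eqI) (simp add: nth simps)
    show "map_fls h (x * y) = map_fls h x * map_fls h y"
    proof (rule fls_eqI)
      fix n
      let ?a = "min (fls_subdegree x) (fls_subdegree (map_fls h x))"
      let ?b = "min (fls_subdegree y) (fls_subdegree (map_fls h y))"
      show "fls_nth (map_fls h (x * y)) n = fls_nth (map_fls h x * map_fls h y) n"
        by (simp add: nth simps fls_times_nth_wide[of ?a x ?b y] fls_times_nth_wide[of ?a "map_fls h x" ?b "map_fls h y"])
    qed
  qed
qed

lemma central_fls: 
  assumes "\<And>n. central (fls_nth F n)" shows "central F"
proof -
  have "fls_nth (F * G) n = fls_nth (G * F) n" for G n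
  proof -
    have "fls_nth (F * G) n = (\<Sum>i=fls_subdegree F..n - fls_subdegree G. fls_nth G (n - i) * fls_nth F i)"
      unfolding fls_times_nth(2) by (intro sum.cong refl centralD assms)
    also have "\<dots> = (\<Sum>i=fls_subdegree G..n - fls_subdegree F. fls_nth G i * fls_nth F (n - i))"
      by (rule sum.reindex_bij_witness[where i = "\<lambda>i. n - i" and j = "\<lambda>i. n - i"]) auto
    finally show ?thesis by (simp add: fls_times_nth(2))
  qed
  then show ?thesis by (simp add: central_def fls_eq_iff)
qed

lemma ring_morph_fps_to_fls: "ring_morph fps_to_fls"
  by standard (auto simp: fls_times_fps_to_fls)

lemma map_fls_fps_to_fls: "h 0 = 0 \<Longrightarrow> map_fls h (fps_to_fls f) = fps_to_fls (fmap h f)"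
  by (intro fls_eqI) (simp add: map_fls_nth)

lemma map_fls_const: "h 0 = 0 \<Longrightarrow> map_fls h (fls_const a) = fls_const (h a)"
  by (intro fls_eqI) (simp add: map_fls_nth)

text \<open>The relations of the extended Yangian are stated in iterated Laurent series, first in \<open>1/u\<close> with
  coefficients in series in \<open>1/v\<close>. The power series used above embed in them.\<close>

definition emb :: "'a::ring_1 fps fps \<Rightarrow> 'a fls fls" where
  "emb F = fps_to_fls (fmap fps_to_fls F)"

lemma ring_morph_emb: "ring_morph emb"
  unfolding emb_def by (rule ring_morph_comp[OF ring_morph_fmap[OF ring_morph_fps_to_fls] ring_morph_fps_to_fls])

interpretation emb: ring_morph emb by (rule ring_morph_emb)

lemma emb_inject: "emb F = emb G \<Longrightarrow> F = G"
  by (simp add: emb_def fps_eq_iff)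

abbreviation mfls2 :: "('a::zero \<Rightarrow> 'b::zero) \<Rightarrow> 'a fls fls \<Rightarrow> 'b fls fls" where
  "mfls2 h \<equiv> map_fls (map_fls h)"

lemma ring_morph_mfls2: "ring_morph h \<Longrightarrow> ring_morph (mfls2 h)"
  by (intro ring_morph_map_fls)

lemma mfls2_emb:
  assumes "ring_morph h" shows "mfls2 h (emb F) = emb (fmap (fmap h) F)"
proof -
  interpret ring_morph h by fact
  interpret f: ring_morph "map_fls h" by (intro ring_morph_map_fls assms)
  show ?thesis
    by (simp add: emb_def map_fls_fps_to_fls f.zero fmap_fmap zero)
qed

lemma map_fls_map_fls: "h 0 = 0 \<Longrightarrow> k 0 = 0 \<Longrightarrow> map_fls h (map_fls k F) = map_fls (\<lambda>x. h (k x)) F"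
  by (intro fls_eqI) (simp add: map_fls_nth)

abbreviation scal_fls :: "complex fls fls \<Rightarrow> 'a::calg fls fls" where
  "scal_fls \<equiv> mfls2 sc"

interpretation scal_fls: ring_morph scal_fls
  by (intro ring_morph_mfls2 sc.ring_morph_axioms)

lemma central_scal_fls [simp]: "central (scal_fls x)"
  by (intro central_fls) (simp add: map_fls_nth sc.zero map_fls_nth[of "map_fls sc"] map_fls_const[of sc 0, simplified sc.zero, simplified])

lemma scal_fls_cancel: "x \<noteq> 0 \<Longrightarrow> scal_fls x * F = (0 :: 'a::calg fls fls) \<Longrightarrow> F = 0"
proof -
  assume x: "x \<noteq> 0" and F: "scal_fls x * F = (0 :: 'a fls fls)"
  have "F = scal_fls (inverse x * x) * F" using x by (simp add: scal_fls.one)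
  also have "\<dots> = 0" by (simp only: scal_fls.mult mult.assoc F) simp
  finally show ?thesis .
qed

section \<open>Comparison of the two forms of the RTT relation\<close>

lemma emb_vx: "emb vx = fls_X" and emb_vy: "emb vy = fls_const fls_X"
  and emb_cc: "emb (fps_const (fps_const c)) = fls_const (fls_const c)"
  by (simp_all add: emb_def fmap_X fmap_const)

lemma R_mat_emb:
  "emb (pa g) * R_mat g (var_u - var_v) p q = emb (Rh g p q)"
proof -
  let ?x = "emb vx :: complex fls fls" and ?y = "emb vy :: complex fls fls" and ?k = "emb (cc (kappa g)) :: complex fls fls"
  let ?D = "var_u - var_v"
  have u: "?x * var_u = 1"
    by (simp add: emb_vx var_u_def fls_X_times_conv_shift)
  have v: "?y * var_v = 1"
    by (simp add: emb_vy var_v_def fls_X_times_conv_shift)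
  have 1: "emb (vy - vx) = ?x * ?y * ?D"
  proof -
    have "?x * ?y * ?D = ?y * (?x * var_u) - ?x * (?y * var_v)" by (simp only: left_diff_distrib right_diff_distrib mult_ac)
    then show ?thesis by (simp only: u v emb.simps) simp
  qed
  have 2: "emb (vy - vx - cc (kappa g) * vx * vy) = ?x * ?y * (?D - ?k)"
  proof -
    have "?x * ?y * (?D - ?k) = ?x * ?y * ?D - ?k * ?x * ?y" by (simp only: left_diff_distrib right_diff_distrib mult_ac)
    then show ?thesis by (simp only: 1[symmetric] emb.simps)
  qed
  have "?x * ?y * ?D \<noteq> 0" "?x * ?y * (?D - ?k) \<noteq> 0"
    unfolding 1[symmetric] 2[symmetric] using nz1 nz2[of "kappa g"] emb_inject emb.zero by metis+
  then have nz: "?D \<noteq> 0" "?D - ?k \<noteq> 0" by auto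
  have A: "emb (pa g) = (?x * ?y * ?D) * (?x * ?y * (?D - ?k))"
    by (simp only: pa_def emb.mult 1 2)
  have k: "fls_const (fls_const (kappa g)) = ?k"
    by (simp add: emb_cc sc_complex_def)
  have gen: "(x * y * d) * w * (a / d) = a * (x * y * w)" "w * (x * y * d) * (a / d) = a * (x * y * w)"
    if "d \<noteq> 0" for a d w x y :: "complex fls fls"
    using that by simp_all
  have B: "emb (pa g) * (a / ?D) = a * emb (pb g)" for a
    unfolding A pb_def emb.mult 2 by (rule gen(1)[OF nz(1)])
  have C: "emb (pa g) * (a / (?D - ?k)) = a * emb pc" for a
    unfolding A pc_def emb.mult 1 by (rule gen(2)[OF nz(2)])
  obtain i k j l where pq: "p = (i, k)" "q = (j, l)" by fastforce
  have "emb (pa g) * R_mat g ?D p q = of_bool (i = j \<and> k = l) * emb (pa g)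
    - of_bool (k = j \<and> l = i) * emb (pb g)
    + fls_const (fls_const (theta g i j)) * of_bool (k = - i \<and> l = - j) * emb pc"
    unfolding pq R_mat_def prod.case k distrib_left right_diff_distrib B C by (simp only: mult.commute)
  also have "\<dots> = emb (Rh g p q)"
    by (simp add: pq Rh_def RR_def emb.simps theta_eps emb_cc sc_complex_def mult_ac)
  finally show ?thesis .
qed

definition rtt_fls :: "lie_type \<Rightarrow> (int \<Rightarrow> int \<Rightarrow> 'a::calg fps) \<Rightarrow> int \<times> int \<Rightarrow> int \<times> int \<Rightarrow> 'a fls fls" where
  "rtt_fls g t p q =
     mm (idx g \<times> idx g) (mm (idx g \<times> idx g) (\<lambda>p q. scal_fls (R_mat g (var_u - var_v) p q))
       (T1 (\<lambda>i j. emb (ser_u t i j)))) (T2 (\<lambda>i j. emb (ser_v t i j))) p q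
   - mm (idx g \<times> idx g) (mm (idx g \<times> idx g) (T2 (\<lambda>i j. emb (ser_v t i j)))
       (T1 (\<lambda>i j. emb (ser_u t i j)))) (\<lambda>p q. scal_fls (R_mat g (var_u - var_v) p q)) p q"

text \<open>The two forms of the RTT relation differ by the factor \<open>pa g\<close>, a nonzero scalar series and
  hence cancellable.\<close>

lemma rtt_iff_fls: "rtt g t \<longleftrightarrow> (\<forall>p\<in>idx g \<times> idx g. \<forall>q\<in>idx g \<times> idx g. rtt_fls g t p q = 0)"
proof -
  let ?II = "idx g \<times> idx g"
  let ?L = "\<lambda>p q. mm ?II (mm ?II (Rh g) (T1 (ser_u t))) (T2 (ser_v t)) p q"
  let ?R = "\<lambda>p q. mm ?II (mm ?II (T2 (ser_v t)) (T1 (ser_u t))) (Rh g) p q"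
  let ?a = "scal_fls (emb (pa g)) :: 'a fls fls"
  have aR: "(\<lambda>p q. ?a * scal_fls (R_mat g (var_u - var_v) p q)) = (\<lambda>p q. emb (Rh g p q))"
  proof (intro ext)
    fix p q :: "int \<times> int"
    have "?a * scal_fls (R_mat g (var_u - var_v) p q) = scal_fls (emb (pa g) * R_mat g (var_u - var_v) p q)"
      by (rule scal_fls.mult[symmetric])
    also have "\<dots> = scal_fls (emb (Rh g p q))" by (simp only: R_mat_emb)
    also have "\<dots> = emb (Rh g p q)" by (simp only: mfls2_emb[OF sc.ring_morph_axioms] scff_Rh)
    finally show "?a * scal_fls (R_mat g (var_u - var_v) p q) = emb (Rh g p q)" .
  qed
  have "?a * rtt_fls g t p q = emb (?L p q - ?R p q)" for p q
    unfolding rtt_fls_def right_diff_distrib emb.diff emb.mm3 emb.T1 emb.T2 aR[symmetric]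
      mm_scale_left mm_scale_right[OF central_scal_fls] ..
  moreover have "emb (pa g) \<noteq> (0 :: complex fls fls)"
    using emb_inject[of "pa g" "0 :: complex fps fps"] nz1 nz2[of "kappa g"] by (auto simp: emb.zero pa_def)
  ultimately have "rtt_fls g t p q = 0 \<longleftrightarrow> ?L p q = ?R p q" for p q
  proof -
    assume E: "\<And>p q. ?a * rtt_fls g t p q = emb (?L p q - ?R p q)" and nz: "emb (pa g) \<noteq> (0 :: complex fls fls)"
    show ?thesis
    proof
      assume "rtt_fls g t p q = 0"
      then have "emb (?L p q - ?R p q) = emb 0" using E[of p q] by (simp add: emb.zero)
      from emb_inject[OF this] show "?L p q = ?R p q" by simp
    next
      assume "?L p q = ?R p q"
      then have "?a * rtt_fls g t p q = 0" using E[of p q] by (simp add: emb.zero)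
      then show "rtt_fls g t p q = 0" by (rule scal_fls_cancel[OF nz])
    qed
  qed
  then show ?thesis by (simp add: rtt_def)
qed

section \<open>Linear extension and evaluation of words\<close>

instantiation poly_mapping :: (monoid_add, calg) calg
begin
definition sc_poly_mapping :: "complex \<Rightarrow> ('a \<Rightarrow>\<^sub>0 'b)" where
  "sc_poly_mapping c = Poly_Mapping.single 0 (sc c)"
instance
proof
  fix a b :: complex and x :: "'a \<Rightarrow>\<^sub>0 'b"
  show "sc 1 = (1 :: 'a \<Rightarrow>\<^sub>0 'b)" by (simp add: sc_poly_mapping_def sc_one)
  show "sc (a + b) = (sc a + sc b :: 'a \<Rightarrow>\<^sub>0 'b)" by (simp add: sc_poly_mapping_def sc_add single_add)
  show "sc (a * b) = (sc a * sc b :: 'a \<Rightarrow>\<^sub>0 'b)" by (simp add: sc_poly_mapping_def sc_mult mult_single)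
  have x: "x = (\<Sum>k\<in>Poly_Mapping.keys x. Poly_Mapping.single k (Poly_Mapping.lookup x k))"
    by (rule poly_mapping_eqI) (auto simp: lookup_sum lookup_single when_def in_keys_iff)
  show "sc a * x = x * sc a"
    by (subst (1 2) x) (simp add: sum_distrib_left sum_distrib_right sc_poly_mapping_def mult_single sc_commute)
qed
end

lemma poly_mapping_sum_single:
  "f = (\<Sum>k\<in>Poly_Mapping.keys f. Poly_Mapping.single k (Poly_Mapping.lookup f k))"
  by (rule poly_mapping_eqI) (auto simp: lookup_sum lookup_single when_def in_keys_iff)

definition lin :: "('k \<Rightarrow> 'a::calg) \<Rightarrow> ('k \<Rightarrow>\<^sub>0 complex) \<Rightarrow> 'a" where
  "lin b f = (\<Sum>k\<in>Poly_Mapping.keys f. sc (Poly_Mapping.lookup f k) * b k)"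

lemma lin_add: "lin b (f + g) = lin b f + lin b g"
  unfolding lin_def by (rule setsum_keys_plus_distrib) (simp_all add: sc.zero sc_add distrib_right)

lemma lin_zero: "lin b 0 = 0"
  by (simp add: lin_def)

lemma lin_single: "lin b (Poly_Mapping.single k c) = sc c * b k"
  by (simp add: lin_def sc.zero)

lemma lin_sum: "lin b (\<Sum>i\<in>A. f i) = (\<Sum>i\<in>A. lin b (f i))"
  by (induction A rule: infinite_finite_induct) (auto simp: lin_add lin_zero)

definition word_val :: "(int \<Rightarrow> int \<Rightarrow> 'a::calg fps) \<Rightarrow> (int \<times> int \<times> nat) list \<Rightarrow> 'a" where
  "word_val t w = prod_list (map (\<lambda>(i, j, r). fps_nth (t i j) r) w)"

definition evf :: "(int \<Rightarrow> int \<Rightarrow> 'a::calg fps) \<Rightarrow> free \<Rightarrow> 'a" where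
  "evf t = lin (word_val t)"

lemma ring_morph_evf: "ring_morph (evf t)"
proof
  fix x y :: free
  show "evf t 1 = 1"
    by (simp add: evf_def lin_single word_val_def sc_one zero_list_def flip: single_one)
  show "evf t (x + y) = evf t x + evf t y" by (simp add: evf_def lin_add)
  have "evf t (Poly_Mapping.single v a * Poly_Mapping.single w b)
     = evf t (Poly_Mapping.single v a) * evf t (Poly_Mapping.single w b)" for v w a b
    by (simp add: evf_def mult_single lin_single word_val_def plus_list_def sc_mult mult.assoc
        central_left_commute[OF central_sc[of b]])
  then have "evf t ((\<Sum>v\<in>A. Poly_Mapping.single v (a v)) * (\<Sum>w\<in>B. Poly_Mapping.single w (b w)))
    = evf t (\<Sum>v\<in>A. Poly_Mapping.single v (a v)) * evf t (\<Sum>w\<in>B. Poly_Mapping.single w (b w))" for A B a b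
    by (simp only: evf_def lin_sum sum_product)
  from this[of "Poly_Mapping.lookup x" "Poly_Mapping.keys x" "Poly_Mapping.lookup y" "Poly_Mapping.keys y"]
  show "evf t (x * y) = evf t x * evf t y"
    unfolding poly_mapping_sum_single[symmetric] .
qed

lemma evf_sc: "evf t (sc c) = sc c"
  by (simp add: evf_def sc_poly_mapping_def sc_complex_def lin_single word_val_def zero_list_def)

lemma evf_gen: "evf t (gen i j r) = fps_nth (t i j) r"
  by (simp add: evf_def gen_def lin_single word_val_def sc_one)

definition gen_ser :: "int \<Rightarrow> int \<Rightarrow> free fps" where
  "gen_ser i j = Abs_fps (gen i j)"

lemma rtt_rels_fls:
  "rtt_lhs g p q - rtt_rhs g p q = rtt_fls g gen_ser p q"
proof -
  have s: "Poly_Mapping.single [] = (sc :: complex \<Rightarrow> free)"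
    by (simp add: sc_poly_mapping_def sc_complex_def zero_list_def fun_eq_iff)
  have u: "emb (ser_u gen_ser i j) = fps_to_fls (Abs_fps (\<lambda>r. fls_const (gen i j r)))" for i j
    by (simp add: emb_def gen_ser_def fps_eq_iff)
  have v: "emb (ser_v gen_ser i j) = fls_const (fps_to_fls (Abs_fps (\<lambda>r. gen i j r)))" for i j
    by (simp add: emb_def gen_ser_def fmap_const)
  have "T1_mat = T1 (\<lambda>i j. emb (ser_u gen_ser i j))"
    unfolding T1_mat_def T1_def u ..
  moreover have "T2_mat = T2 (\<lambda>i j. emb (ser_v gen_ser i j))"
    unfolding T2_mat_def T2_def v ..
  moreover have "mat_mult2 g = mm (idx g \<times> idx g)"
    by (simp add: mat_mult2_def mm_def fun_eq_iff)
  moreover have "scal2 = scal_fls"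
    by (simp add: scal2_def s)
  ultimately show ?thesis
    by (simp only: rtt_lhs_def rtt_rhs_def rtt_fls_def)
qed

lemma mfls2_evf_rtt:
  "mfls2 (evf t) (rtt_fls g (gen_ser) p q) = rtt_fls g (t :: int \<Rightarrow> int \<Rightarrow> 'a::calg fps) p q"
proof -
  interpret e: ring_morph "evf t" by (rule ring_morph_evf)
  interpret E: ring_morph "mfls2 (evf t)" by (rule ring_morph_mfls2) (rule ring_morph_evf)
  interpret e1: ring_morph "map_fls (evf t)" by (rule ring_morph_map_fls) (rule ring_morph_evf)
  interpret s1: ring_morph "map_fls sc" by (rule ring_morph_map_fls) (rule sc.ring_morph_axioms)
  have 1: "mfls2 (evf t) (scal_fls x) = scal_fls x" for x
    by (simp add: map_fls_map_fls e.zero sc.zero e1.zero s1.zero evf_sc)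
  have g: "fmap (evf t) (gen_ser i j) = t i j" for i j
    by (simp add: fps_eq_iff gen_ser_def evf_gen)
  have 2: "mfls2 (evf t) (emb (ser_u gen_ser i j)) = emb (ser_u t i j)" for i j
    by (simp add: mfls2_emb[OF ring_morph_evf] fmap_fmap fmap_const e.zero evf_gen gen_ser_def)
       (simp add: fps_eq_iff evf_gen emb_def)
  have 3: "mfls2 (evf t) (emb (ser_v gen_ser i j)) = emb (ser_v t i j)" for i j
    by (simp add: mfls2_emb[OF ring_morph_evf] fmap_const e.zero g
        ring_morph.zero[OF ring_morph_fmap[OF ring_morph_evf]])
  show ?thesis
    by (simp only: rtt_fls_def E.diff E.mm3 E.T1 E.T2 1 2 3)
qed

lemma yangian_rels_fls:
  "yangian_rels g = {fls_nth (fls_nth (rtt_fls g gen_ser p q) m) n | p q m n.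
        p \<in> idx g \<times> idx g \<and> q \<in> idx g \<times> idx g}
   \<union> {gen i j 0 - of_bool (i = j) | i j. i \<in> idx g \<and> j \<in> idx g}"
  unfolding yangian_rels_def rtt_rels_fls ..

text \<open>The value of a relation at a family \<open>t\<close> is a coefficient of the RTT relation for \<open>t\<close>, because
  the evaluation homomorphism can be applied to the Laurent series coefficientwise.\<close>

lemma evf_yangian_rels:
  fixes t :: "int \<Rightarrow> int \<Rightarrow> 'a::calg fps"
  shows "(\<forall>x\<in>yangian_rels g. evf t x = 0) \<longleftrightarrow>
    rtt g t \<and> (\<forall>i\<in>idx g. \<forall>j\<in>idx g. fps_nth (t i j) 0 = of_bool (i = j))"
proof -
  interpret e: ring_morph "evf t" by (rule ring_morph_evf)
  interpret e1: ring_morph "map_fls (evf t)" by (rule ring_morph_map_fls) (rule ring_morph_evf)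
  have 1: "evf t (fls_nth (fls_nth (rtt_fls g gen_ser p q) m) n) = fls_nth (fls_nth (rtt_fls g t p q) m) n" for p q m n
    by (subst mfls2_evf_rtt[of t, symmetric]) (simp add: map_fls_nth e.zero e1.zero)
  have 2: "rtt_fls g t p q = 0 \<longleftrightarrow> (\<forall>m n. fls_nth (fls_nth (rtt_fls g t p q) m) n = 0)" for p q
    by (simp add: fls_eq_iff)
  have 3: "evf t (gen i j 0 - of_bool (i = j)) = fps_nth (t i j) 0 - of_bool (i = j)" for i j
    by (simp only: e.diff e.of_bool evf_gen)
  have A: "(\<forall>x\<in>{f p q m n | p q m n. p \<in> S \<and> q \<in> S}. P x) \<longleftrightarrow> (\<forall>p\<in>S. \<forall>q\<in>S. \<forall>m n. P (f p q m n))"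
    for f :: "int \<times> int \<Rightarrow> int \<times> int \<Rightarrow> int \<Rightarrow> int \<Rightarrow> free" and S P by blast
  have B: "(\<forall>x\<in>{f i j | i j. i \<in> S \<and> j \<in> S}. P x) \<longleftrightarrow> (\<forall>i\<in>S. \<forall>j\<in>S. P (f i j))"
    for f :: "int \<Rightarrow> int \<Rightarrow> free" and S P by blast
  show ?thesis
    unfolding rtt_iff_fls yangian_rels_fls ball_Un A B 1 3 2 by simp
qed

section \<open>The carrier of the free algebra\<close>

text \<open>The generators with all indices outside the index set replaced by 0. Evaluation at this family
  projects onto the free algebra on the admissible generators, so membership in that algebra becomes
  a fixed point equation (\<open>evf_restr\<close>).\<close>

definition restr :: "lie_type \<Rightarrow> int \<Rightarrow> int \<Rightarrow> free fps" where
  "restr g i j = (if i \<in> idx g \<and> j \<in> idx g then gen_ser i j else 0)"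

lemma free_carrier:
  "carrier (free_alg g) = {f. \<forall>w\<in>Poly_Mapping.keys f. set w \<subseteq> idx g \<times> idx g \<times> UNIV}"
  by (simp add: free_alg_def)

lemma word_val_restr:
  "word_val (restr g) w = (if set w \<subseteq> idx g \<times> idx g \<times> UNIV then Poly_Mapping.single w 1 else 0)"
proof (induction w)
  case Nil
  have "(1 :: free) = Poly_Mapping.single [] 1" by (simp only: single_one[symmetric] zero_list_def)
  then show ?case by (simp add: word_val_def)
next
  case (Cons a w)
  obtain i j r where a: "a = (i, j, r)" by (cases a)
  have 1: "word_val (restr g) (a # w) = fps_nth (restr g i j) r * word_val (restr g) w"
    by (simp add: word_val_def a)
  have 2: "fps_nth (restr g i j) r = (if i \<in> idx g \<and> j \<in> idx g then Poly_Mapping.single [(i, j, r)] 1 else 0)"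
    by (simp add: restr_def gen_ser_def gen_def)
  have 3: "Poly_Mapping.single [(i, j, r)] 1 * Poly_Mapping.single w 1 = (Poly_Mapping.single (a # w) 1 :: free)"
    by (simp add: mult_single plus_list_def a)
  show ?case
    unfolding 1 Cons.IH 2 by (cases "i \<in> idx g \<and> j \<in> idx g"; cases "set w \<subseteq> idx g \<times> idx g \<times> UNIV") (auto simp: 3 a)
qed

lemma evf_restr: "f \<in> carrier (free_alg g) \<longleftrightarrow> evf (restr g) f = f"
proof
  assume f: "f \<in> carrier (free_alg g)"
  have "evf (restr g) f = (\<Sum>w\<in>Poly_Mapping.keys f. Poly_Mapping.single w (Poly_Mapping.lookup f w))"
    unfolding evf_def lin_def using f
    by (intro sum.cong) (auto simp: free_carrier word_val_restr sc_poly_mapping_def sc_complex_def mult_single)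
  then show "evf (restr g) f = f" using poly_mapping_sum_single[of f] by simp
next
  assume e: "evf (restr g) f = f"
  have "evf (restr g) f \<in> carrier (free_alg g)"
    unfolding free_carrier
  proof safe
    fix w i j r assume w: "w \<in> Poly_Mapping.keys (evf (restr g) f)" and a: "(i, j, r) \<in> set w"
    have "set w \<subseteq> idx g \<times> idx g \<times> UNIV"
    proof (rule ccontr)
      assume n: "\<not> set w \<subseteq> idx g \<times> idx g \<times> UNIV"
      have "Poly_Mapping.lookup (sc c * word_val (restr g) v :: free) w = 0" for c v
        using n by (auto simp: word_val_restr sc_poly_mapping_def mult_single lookup_single when_def)
      then have "Poly_Mapping.lookup (evf (restr g) f) w = 0"
        unfolding evf_def lin_def by (simp add: lookup_sum)
      with w show False by (simp add: in_keys_iff)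
    qed
    then show "i \<in> idx g" "j \<in> idx g" using a by auto
  qed simp
  then show "f \<in> carrier (free_alg g)" using e by simp
qed

lemma rtt_fls_cong:
  assumes "\<And>i j. i \<in> idx g \<Longrightarrow> j \<in> idx g \<Longrightarrow> t i j = t' i j" "p \<in> idx g \<times> idx g" "q \<in> idx g \<times> idx g"
  shows "rtt_fls g t p q = rtt_fls g t' p q"
proof -
  have 1: "T1 (\<lambda>i j. emb (ser_u t i j)) p q = T1 (\<lambda>i j. emb (ser_u t' i j)) p q"
   and 2: "T2 (\<lambda>i j. emb (ser_v t i j)) p q = T2 (\<lambda>i j. emb (ser_v t' i j)) p q"
    if "p \<in> idx g \<times> idx g" "q \<in> idx g \<times> idx g" for p q
    using that assms(1) by (auto simp: T1_def T2_def split: prod.splits)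
  let ?II = "idx g \<times> idx g"
  let ?R = "\<lambda>p q. scal_fls (R_mat g (var_u - var_v) p q) :: 'a fls fls"
  have a: "mm ?II ?R (T1 (\<lambda>i j. emb (ser_u t i j))) p s = mm ?II ?R (T1 (\<lambda>i j. emb (ser_u t' i j))) p s"
    if "s \<in> ?II" for s
    by (rule mm_cong_right) (rule 1[OF _ that])
  have b: "mm ?II (T2 (\<lambda>i j. emb (ser_v t i j))) (T1 (\<lambda>i j. emb (ser_u t i j))) p s
    = mm ?II (T2 (\<lambda>i j. emb (ser_v t' i j))) (T1 (\<lambda>i j. emb (ser_u t' i j))) p s" if "s \<in> ?II" for s
    by (rule mm_cong) (rule 2[OF assms(2)], assumption, rule 1[OF _ that])
  show ?thesis
    unfolding rtt_fls_def
  proof (rule arg_cong2[where f = "(-)"])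
    show "mm ?II (mm ?II ?R (T1 (\<lambda>i j. emb (ser_u t i j)))) (T2 (\<lambda>i j. emb (ser_v t i j))) p q
      = mm ?II (mm ?II ?R (T1 (\<lambda>i j. emb (ser_u t' i j)))) (T2 (\<lambda>i j. emb (ser_v t' i j))) p q"
      by (rule mm_cong) (rule a, assumption, rule 2[OF _ assms(3)])
    show "mm ?II (mm ?II (T2 (\<lambda>i j. emb (ser_v t i j))) (T1 (\<lambda>i j. emb (ser_u t i j)))) ?R p q
      = mm ?II (mm ?II (T2 (\<lambda>i j. emb (ser_v t' i j))) (T1 (\<lambda>i j. emb (ser_u t' i j)))) ?R p q"
      by (rule mm_cong) (rule b, assumption, rule refl)
  qed
qed

lemma yangian_rels_carrier: "yangian_rels g \<subseteq> carrier (free_alg g)"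
proof
  fix x assume x: "x \<in> yangian_rels g"
  interpret e: ring_morph "evf (restr g)" by (rule ring_morph_evf)
  interpret e1: ring_morph "map_fls (evf (restr g))" by (rule ring_morph_map_fls) (rule ring_morph_evf)
  from x show "x \<in> carrier (free_alg g)"
    unfolding yangian_rels_fls evf_restr
  proof (elim UnE CollectE exE conjE)
    fix p q m n
    assume pq: "p \<in> idx g \<times> idx g" "q \<in> idx g \<times> idx g" and x: "x = fls_nth (fls_nth (rtt_fls g gen_ser p q) m) n"
    have "evf (restr g) x = fls_nth (fls_nth (rtt_fls g (restr g) p q) m) n"
      unfolding x by (subst mfls2_evf_rtt[of "restr g", symmetric]) (simp add: map_fls_nth e.zero e1.zero)
    also have "rtt_fls g (restr g) p q = rtt_fls g gen_ser p q"
      by (rule rtt_fls_cong[OF _ pq]) (simp add: restr_def)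
    finally show "evf (restr g) x = x" by (simp add: x)
  next
    fix i j assume "x = gen i j 0 - of_bool (i = j)" "i \<in> idx g" "j \<in> idx g"
    then show "evf (restr g) x = x"
      by (simp add: e.diff e.of_bool evf_gen restr_def gen_ser_def)
  qed
qed

section \<open>Complex algebras as records\<close>

text \<open>Laws for records with a complex scalar multiplication; the scalars act through multiples of 1,
  in accordance with the class of complex algebras.\<close>

locale calgebra = ring A for A :: "(complex, 'a) module" (structure) +
  assumes scalar_closed: "c \<odot> \<one> \<in> carrier A"
    and smult_eq: "x \<in> carrier A \<Longrightarrow> c \<odot> x = (c \<odot> \<one>) \<otimes> x"
    and scalar_commute: "x \<in> carrier A \<Longrightarrow> (c \<odot> \<one>) \<otimes> x = x \<otimes> (c \<odot> \<one>)"
    and scalar_one: "1 \<odot> \<one> = \<one>"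
    and scalar_add: "(a + b) \<odot> \<one> = (a \<odot> \<one>) \<oplus> (b \<odot> \<one>)"
    and scalar_mult: "(a * b) \<odot> \<one> = (a \<odot> \<one>) \<otimes> (b \<odot> \<one>)"
begin

lemma smult_closed: "x \<in> carrier A \<Longrightarrow> c \<odot> x \<in> carrier A"
  using smult_eq[of x c] scalar_closed[of c] by simp

end

lemma ring_cong:
  assumes "ring R" "carrier S = carrier R" "mult S = mult R" "one S = one R" "zero S = zero R" "add S = add R"
  shows "ring S"
proof -
  interpret R: ring R by fact
  show ?thesis
  proof (intro ringI abelian_groupI monoidI)
    fix x assume "x \<in> carrier S"
    then show "\<exists>y\<in>carrier S. y \<oplus>\<^bsub>S\<^esub> x = \<zero>\<^bsub>S\<^esub>"
      unfolding assms(2-) by (intro bexI[of _ "\<ominus>\<^bsub>R\<^esub> x"] R.l_neg R.a_inv_closed)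
  qed (simp_all add: assms(2-) R.add.m_assoc R.add.m_comm R.add.m_lcomm R.m_assoc R.l_distr R.r_distr)
qed

lemma quot_alg_simps [simp]:
  "carrier (quot_alg A J) = carrier (A Quot J)" "mult (quot_alg A J) = mult (A Quot J)"
  "one (quot_alg A J) = one (A Quot J)" "zero (quot_alg A J) = zero (A Quot J)"
  "add (quot_alg A J) = add (A Quot J)"
  by (simp_all add: quot_alg_def)

context calgebra
begin

lemma quot_ring: "ideal J A \<Longrightarrow> ring (quot_alg A J)"
  by (rule ring_cong[OF ideal.quotient_is_ring]) simp_all

lemma quot_carrier: "carrier (quot_alg A J) = quot_map A J ` carrier A"
  by (auto simp: FactRing_def quot_map_def A_RCOSETS_def')

lemma quot_map_closed: "x \<in> carrier A \<Longrightarrow> quot_map A J x \<in> carrier (quot_alg A J)"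
  by (simp add: quot_carrier del: quot_alg_simps)

lemma quot_map_add:
  assumes "ideal J A" "x \<in> carrier A" "y \<in> carrier A"
  shows "quot_map A J (x \<oplus> y) = quot_map A J x \<oplus>\<^bsub>quot_alg A J\<^esub> quot_map A J y"
  using ring_hom_add[OF ideal.rcos_ring_hom[OF assms(1)] assms(2,3)] by (simp add: quot_map_def)

lemma quot_map_mult:
  assumes "ideal J A" "x \<in> carrier A" "y \<in> carrier A"
  shows "quot_map A J (x \<otimes> y) = quot_map A J x \<otimes>\<^bsub>quot_alg A J\<^esub> quot_map A J y"
  using ring_hom_mult[OF ideal.rcos_ring_hom[OF assms(1)] assms(2,3)] by (simp add: quot_map_def)

lemma quot_map_one:
  assumes "ideal J A"
  shows "quot_map A J \<one> = \<one>\<^bsub>quot_alg A J\<^esub>"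
  using ring_hom_one[OF ideal.rcos_ring_hom[OF assms(1)]] by (simp add: quot_map_def)

lemma quot_map_eq_iff:
  assumes "ideal J A" "x \<in> carrier A" "y \<in> carrier A"
  shows "quot_map A J x = quot_map A J y \<longleftrightarrow> x \<ominus> y \<in> J"
proof -
  interpret J: ideal J A by fact
  have m: "x \<in> J +> y \<longleftrightarrow> x \<ominus> y \<in> J"
    using J.a_rcos_module_minus[OF ring_axioms assms(3,2)] by simp
  show ?thesis unfolding quot_map_def m[symmetric]
    using a_repr_independence[OF _ assms(3) J.a_subgroup] J.a_rcos_self[OF assms(2)] by blast
qed

lemma quot_map_zero_iff:
  assumes "ideal J A" "x \<in> carrier A"
  shows "quot_map A J x = \<zero>\<^bsub>quot_alg A J\<^esub> \<longleftrightarrow> x \<in> J"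
proof -
  interpret J: ideal J A by fact
  have "\<zero>\<^bsub>quot_alg A J\<^esub> = J" by (simp add: FactRing_def)
  then show ?thesis
    using a_coset_join1[OF _ assms(2) J.a_subgroup] a_coset_join2[OF assms(2) J.a_subgroup]
    unfolding quot_map_def by auto
qed

lemma ideal_smult: "ideal J A \<Longrightarrow> x \<in> J \<Longrightarrow> c \<odot> x \<in> J"
  using smult_eq[of x c] ideal.I_l_closed[of J A x "c \<odot> \<one>"] scalar_closed[of c]
    additive_subgroup.a_Hcarr[OF ideal.axioms(1), of J A x]
  by simp

lemma quot_map_smult:
  assumes J: "ideal J A" and x: "x \<in> carrier A"
  shows "c \<odot>\<^bsub>quot_alg A J\<^esub> quot_map A J x = quot_map A J (c \<odot> x)"
proof -
  interpret J: ideal J A by fact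
  have "quot_map A J (c \<odot> y) = quot_map A J (c \<odot> x)" if y: "y \<in> J +> x" for y
  proof -
    have yc: "y \<in> carrier A" using y x J.a_subset a_r_coset_subset_G by blast
    have "quot_map A J y = quot_map A J x"
      using a_repr_independence[OF y x J.a_subgroup] by (simp add: quot_map_def)
    then have "y \<ominus> x \<in> J" using quot_map_eq_iff[OF J yc x] by simp
    then have "c \<odot> (y \<ominus> x) \<in> J" by (rule ideal_smult[OF J])
    moreover have "c \<odot> (y \<ominus> x) = (c \<odot> y) \<ominus> (c \<odot> x)"
      using yc x scalar_closed[of c] smult_eq[of "y \<ominus> x" c] smult_eq[of y c] smult_eq[of x c]
      by (simp add: a_minus_def r_distr r_minus)
    ultimately show ?thesis
      using quot_map_eq_iff[OF J smult_closed[OF yc] smult_closed[OF x]] by simp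
  qed
  moreover have "x \<in> J +> x" using x by (simp add: J.a_rcos_self)
  ultimately have "(\<Union>y\<in>J +> x. quot_map A J (c \<odot> y)) = quot_map A J (c \<odot> x)" by blast
  then show ?thesis by (simp only: quot_alg_def quot_map_def module.simps)
qed

lemma calgebra_quot:
  assumes J: "ideal J A" shows "calgebra (quot_alg A J)"
proof -
  let ?Q = "quot_alg A J" and ?q = "quot_map A J"
  note s = quot_map_smult[OF J]
  have one: "c \<odot>\<^bsub>?Q\<^esub> \<one>\<^bsub>?Q\<^esub> = ?q (c \<odot> \<one>)" for c
    using s[OF one_closed, of c] quot_map_one[OF J] by simp
  show ?thesis
  proof (intro calgebra.intro calgebra_axioms.intro)
    show "ring ?Q" by (rule quot_ring[OF J])
    fix a b c :: complex and x
    show "c \<odot>\<^bsub>?Q\<^esub> \<one>\<^bsub>?Q\<^esub> \<in> carrier ?Q"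
      unfolding one by (rule quot_map_closed[OF scalar_closed])
    show "1 \<odot>\<^bsub>?Q\<^esub> \<one>\<^bsub>?Q\<^esub> = \<one>\<^bsub>?Q\<^esub>"
      unfolding one scalar_one by (rule quot_map_one[OF J])
    show "(a + b) \<odot>\<^bsub>?Q\<^esub> \<one>\<^bsub>?Q\<^esub> = a \<odot>\<^bsub>?Q\<^esub> \<one>\<^bsub>?Q\<^esub> \<oplus>\<^bsub>?Q\<^esub> b \<odot>\<^bsub>?Q\<^esub> \<one>\<^bsub>?Q\<^esub>"
      unfolding one scalar_add by (rule quot_map_add[OF J scalar_closed scalar_closed])
    show "(a * b) \<odot>\<^bsub>?Q\<^esub> \<one>\<^bsub>?Q\<^esub> = (a \<odot>\<^bsub>?Q\<^esub> \<one>\<^bsub>?Q\<^esub>) \<otimes>\<^bsub>?Q\<^esub> (b \<odot>\<^bsub>?Q\<^esub> \<one>\<^bsub>?Q\<^esub>)"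
      unfolding one scalar_mult by (rule quot_map_mult[OF J scalar_closed scalar_closed])
    assume "x \<in> carrier ?Q"
    then obtain y where y: "y \<in> carrier A" "x = ?q y" unfolding quot_carrier by blast
    show "c \<odot>\<^bsub>?Q\<^esub> x = (c \<odot>\<^bsub>?Q\<^esub> \<one>\<^bsub>?Q\<^esub>) \<otimes>\<^bsub>?Q\<^esub> x"
      unfolding one y(2) s[OF y(1)] smult_eq[OF y(1), of c] by (rule quot_map_mult[OF J scalar_closed y(1)])
    show "(c \<odot>\<^bsub>?Q\<^esub> \<one>\<^bsub>?Q\<^esub>) \<otimes>\<^bsub>?Q\<^esub> x = x \<otimes>\<^bsub>?Q\<^esub> (c \<odot>\<^bsub>?Q\<^esub> \<one>\<^bsub>?Q\<^esub>)"
      unfolding one y(2) quot_map_mult[OF J scalar_closed y(1), symmetric] quot_map_mult[OF J y(1) scalar_closed, symmetric]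
        scalar_commute[OF y(1)] ..
  qed
qed

end

section \<open>The free algebra as a record\<close>

lemma free_alg_simps [simp]:
  "mult (free_alg g) = (*)" "one (free_alg g) = 1" "zero (free_alg g) = 0" "add (free_alg g) = (+)"
  by (simp_all add: free_alg_def)

lemma free_alg_smult: "c \<odot>\<^bsub>free_alg g\<^esub> f = sc c * f"
  by (simp add: free_alg_def mult_map_scale_conv_mult sc_poly_mapping_def sc_complex_def)

lemma free_alg_calgebra: "calgebra (free_alg g)"
proof -
  interpret e: ring_morph "evf (restr g)" by (rule ring_morph_evf)
  note c = evf_restr
  show ?thesis
  proof (intro calgebra.intro calgebra_axioms.intro)
    show "ring (free_alg g)"
    proof (intro ringI abelian_groupI monoidI)
      fix x assume "x \<in> carrier (free_alg g)"
      then show "\<exists>y\<in>carrier (free_alg g). y \<oplus>\<^bsub>free_alg g\<^esub> x = \<zero>\<^bsub>free_alg g\<^esub>"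
        by (intro bexI[of _ "- x"]) (auto simp: c e.simps)
    qed (auto simp: c e.simps algebra_simps)
    fix x :: free and c :: complex
    show "(c \<odot>\<^bsub>free_alg g\<^esub> \<one>\<^bsub>free_alg g\<^esub>) \<otimes>\<^bsub>free_alg g\<^esub> x = x \<otimes>\<^bsub>free_alg g\<^esub> (c \<odot>\<^bsub>free_alg g\<^esub> \<one>\<^bsub>free_alg g\<^esub>)"
      using sc_commute[of c x] by (simp add: free_alg_smult)
  qed (simp_all add: c free_alg_smult evf_sc sc_one sc_add sc_mult)
qed

lemma gen_carrier: "i \<in> idx g \<Longrightarrow> j \<in> idx g \<Longrightarrow> gen i j r \<in> carrier (free_alg g)"
  by (simp add: evf_restr evf_gen restr_def gen_ser_def)

lemma yangian_ideal_ideal: "ideal (yangian_ideal g) (free_alg g)"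
proof -
  interpret calgebra "free_alg g" by (rule free_alg_calgebra)
  show ?thesis unfolding yangian_ideal_def by (rule genideal_ideal[OF yangian_rels_carrier])
qed

lemma yangian_rels_ideal: "yangian_rels g \<subseteq> yangian_ideal g"
proof -
  interpret calgebra "free_alg g" by (rule free_alg_calgebra)
  show ?thesis unfolding yangian_ideal_def by (rule genideal_self[OF yangian_rels_carrier])
qed

text \<open>The elements killed by the evaluation homomorphism form an ideal, which contains the relations.\<close>

lemma evf_yangian_ideal:
  assumes "rtt g t" "\<And>i j. i \<in> idx g \<Longrightarrow> j \<in> idx g \<Longrightarrow> fps_nth (t i j) 0 = of_bool (i = j)" "f \<in> yangian_ideal g"
  shows "evf t f = 0"
proof -
  interpret calgebra "free_alg g" by (rule free_alg_calgebra)
  interpret e: ring_morph "evf t" by (rule ring_morph_evf)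
  interpret r: ring_morph "evf (restr g)" by (rule ring_morph_evf)
  let ?K = "{f \<in> carrier (free_alg g). evf t f = 0}"
  have "ideal ?K (free_alg g)"
  proof (rule idealI[OF ring_axioms])
    show "subgroup ?K (add_monoid (free_alg g))"
    proof (rule add.subgroupI)
      fix a assume "a \<in> ?K"
      then show "\<ominus>\<^bsub>free_alg g\<^esub> a \<in> ?K"
        using minus_equality[of "- a" a] by (simp add: e.uminus r.uminus evf_restr)
    next
      have "0 \<in> ?K" by (simp add: e.zero r.zero evf_restr)
      then show "?K \<noteq> {}" by blast
    qed (simp_all add: e.add r.add evf_restr subset_iff)
  qed (simp_all add: e.mult r.mult evf_restr)
  moreover have "yangian_rels g \<subseteq> ?K"
    using yangian_rels_carrier evf_yangian_rels[of g t] assms(1,2) by auto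
  ultimately have "yangian_ideal g \<subseteq> ?K"
    unfolding yangian_ideal_def by (rule genideal_minimal)
  then show ?thesis using assms(3) by auto
qed

lemma ext_yangian_calgebra: "calgebra (ext_yangian g)"
  unfolding ext_yangian_def by (rule calgebra.calgebra_quot[OF free_alg_calgebra yangian_ideal_ideal])

lemma mm_delta_left:
  "finite I \<Longrightarrow> p \<in> I \<Longrightarrow> mm I (\<lambda>p q. if p = q then z else 0) M p q = z * M p q"
  by (simp add: mm_def if_distrib[of "\<lambda>x. x * _"] cong: if_cong)

lemma mm_delta_right:
  "finite I \<Longrightarrow> q \<in> I \<Longrightarrow> mm I M (\<lambda>p q. if p = q then z else 0) p q = M p q * z"
  by (simp add: mm_def if_distrib[of "\<lambda>x. _ * x"] cong: if_cong)

text \<open>The identity matrix satisfies the RTT relation. This makes the extended Yangian nontrivial, which is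
  required of a ring type.\<close>

lemma rtt_delta: "rtt g (\<lambda>i j. of_bool (i = j) :: 'a::calg fps)"
proof -
  interpret f: ring_morph "fmap fps_const :: 'a fps \<Rightarrow> _" by (rule ring_morph_fmap[OF ring_morph_fps_const])
  interpret c: ring_morph "fps_const :: 'a fps \<Rightarrow> _" by (rule ring_morph_fps_const)
  let ?D = "\<lambda>p q. if p = q then 1 else 0 :: 'a fps fps"
  let ?II = "idx g \<times> idx g"
  have 1: "T1 (ser_u (\<lambda>i j. of_bool (i = j) :: 'a fps)) = ?D"
    by (auto simp: T1_def f.simps fun_eq_iff)
  have 2: "T2 (ser_v (\<lambda>i j. of_bool (i = j) :: 'a fps)) = ?D"
    by (auto simp: T2_def c.simps fun_eq_iff)
  have "mm ?II (mm ?II (Rh g) ?D) ?D p q = mm ?II (mm ?II ?D ?D) (Rh g) p q" if "p \<in> ?II" "q \<in> ?II" for p q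
    unfolding mm_assoc[of ?II ?D ?D] using that by (simp add: mm_delta_left mm_delta_right)
  then show ?thesis unfolding rtt_def 1 2 by blast
qed

lemma ext_yangian_nontrivial: "\<one>\<^bsub>ext_yangian g\<^esub> \<noteq> \<zero>\<^bsub>ext_yangian g\<^esub>"
proof
  interpret calgebra "free_alg g" by (rule free_alg_calgebra)
  assume "\<one>\<^bsub>ext_yangian g\<^esub> = \<zero>\<^bsub>ext_yangian g\<^esub>"
  then have "1 \<in> yangian_ideal g"
    using quot_map_zero_iff[OF yangian_ideal_ideal, of 1] quot_map_one[OF yangian_ideal_ideal] one_closed
    by (simp add: ext_yangian_def)
  then have "evf (\<lambda>i j. of_bool (i = j)) 1 = (0 :: complex)"
    by (intro evf_yangian_ideal[OF rtt_delta]) auto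
  then show False
    using ring_morph.one[OF ring_morph_evf[of "\<lambda>i j. of_bool (i = j) :: complex fps"]] by simp
qed

section \<open>The extended Yangian as a type\<close>

text \<open>The type below can be built for one Lie type only. \<open>g0\<close> is a Lie type for which the claim fails, provided
  there is any such Lie type, so that it is enough to prove the claim for \<open>g0\<close>.\<close>

definition claim :: "lie_type \<Rightarrow> pair_type \<Rightarrow> bool" where
  "claim g ty \<longleftrightarrow> csubalg (carrier (Y_tilde_tw g ty)) (X_tw g ty) \<and>
         quot_map (X_tw g ty) (unitarity_ideal g ty) \<in> alg_iso (Y_tilde_tw g ty) (Y_tw g ty) \<and>
         (\<exists>\<phi>. \<phi> \<in> alg_iso (X_tw g ty) (tensor_alg (W_tw g ty) (Y_tilde_tw g ty)))"

definition g0 :: lie_type where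
  "g0 = (SOME g. lie_valid g \<and>
     ((\<exists>g ty. symmetric_pair g ty \<and> \<not> claim g ty) \<longrightarrow> (\<exists>ty. symmetric_pair g ty \<and> \<not> claim g ty)))"

lemma symmetric_pair_valid: "symmetric_pair g ty \<Longrightarrow> lie_valid g"
  by (cases ty) auto

lemma g0_properties:
  "lie_valid g0 \<and>
     ((\<exists>g ty. symmetric_pair g ty \<and> \<not> claim g ty) \<longrightarrow> (\<exists>ty. symmetric_pair g0 ty \<and> \<not> claim g0 ty))"
proof -
  have "lie_valid (SO 2)" by simp
  then show ?thesis unfolding g0_def
    by (intro someI_ex[of "\<lambda>g. lie_valid g \<and>
     ((\<exists>g ty. symmetric_pair g ty \<and> \<not> claim g ty) \<longrightarrow> (\<exists>ty. symmetric_pair g ty \<and> \<not> claim g ty))"])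
      (meson symmetric_pair_valid)
qed

lemma claim_generic:
  assumes "\<And>ty. symmetric_pair g0 ty \<Longrightarrow> claim g0 ty" "symmetric_pair g ty"
  shows "claim g ty"
  using assms g0_properties by blast

abbreviation X0 :: "(complex, free set) module" where "X0 \<equiv> ext_yangian g0"

typedef yang = "carrier X0"
proof -
  interpret calgebra X0 by (rule ext_yangian_calgebra)
  show ?thesis using zero_closed by blast
qed

interpretation X0: calgebra X0 by (rule ext_yangian_calgebra)

lemma Rep_carrier [simp]: "Rep_yang x \<in> carrier X0" by (rule Rep_yang)

instantiation yang :: calg
begin

definition "0 = Abs_yang \<zero>\<^bsub>X0\<^esub>"
definition "1 = Abs_yang \<one>\<^bsub>X0\<^esub>"
definition "x + y = Abs_yang (Rep_yang x \<oplus>\<^bsub>X0\<^esub> Rep_yang y)"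
definition "x * y = Abs_yang (Rep_yang x \<otimes>\<^bsub>X0\<^esub> Rep_yang y)"
definition "- x = Abs_yang (\<ominus>\<^bsub>X0\<^esub> Rep_yang x)"
definition "x - y = Abs_yang (Rep_yang x \<ominus>\<^bsub>X0\<^esub> Rep_yang y)"
definition sc_yang :: "complex \<Rightarrow> yang" where "sc_yang c = Abs_yang (c \<odot>\<^bsub>X0\<^esub> \<one>\<^bsub>X0\<^esub>)"

lemma Rep_zero: "Rep_yang 0 = \<zero>\<^bsub>X0\<^esub>" by (simp add: zero_yang_def Abs_yang_inverse)
lemma Rep_one: "Rep_yang 1 = \<one>\<^bsub>X0\<^esub>" by (simp add: one_yang_def Abs_yang_inverse)
lemma Rep_add: "Rep_yang (x + y) = Rep_yang x \<oplus>\<^bsub>X0\<^esub> Rep_yang y" by (simp add: plus_yang_def Abs_yang_inverse)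
lemma Rep_mult: "Rep_yang (x * y) = Rep_yang x \<otimes>\<^bsub>X0\<^esub> Rep_yang y" by (simp add: times_yang_def Abs_yang_inverse)
lemma Rep_uminus: "Rep_yang (- x) = \<ominus>\<^bsub>X0\<^esub> Rep_yang x" by (simp add: uminus_yang_def Abs_yang_inverse)
lemma Rep_diff: "Rep_yang (x - y) = Rep_yang x \<ominus>\<^bsub>X0\<^esub> Rep_yang y" by (simp add: minus_yang_def Abs_yang_inverse)
lemma Rep_sc: "Rep_yang (sc c) = c \<odot>\<^bsub>X0\<^esub> \<one>\<^bsub>X0\<^esub>" by (simp add: sc_yang_def Abs_yang_inverse X0.scalar_closed)

lemmas Rep_simps = Rep_zero Rep_one Rep_add Rep_mult Rep_uminus Rep_diff Rep_sc

instance
proof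
  fix a b c :: yang and u v :: complex
  show "a + b + c = a + (b + c)" by (simp add: Rep_yang_inject[symmetric] Rep_simps X0.a_assoc)
  show "a + b = b + a" by (simp add: Rep_yang_inject[symmetric] Rep_simps X0.a_comm)
  show "0 + a = a" by (simp add: Rep_yang_inject[symmetric] Rep_simps)
  show "- a + a = 0" by (simp add: Rep_yang_inject[symmetric] Rep_simps X0.l_neg)
  show "a - b = a + - b" by (simp add: Rep_yang_inject[symmetric] Rep_simps a_minus_def)
  show "a * b * c = a * (b * c)" by (simp add: Rep_yang_inject[symmetric] Rep_simps X0.m_assoc)
  show "1 * a = a" "a * 1 = a" by (simp_all add: Rep_yang_inject[symmetric] Rep_simps)
  show "(a + b) * c = a * c + b * c" by (simp add: Rep_yang_inject[symmetric] Rep_simps X0.l_distr)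
  show "a * (b + c) = a * b + a * c" by (simp add: Rep_yang_inject[symmetric] Rep_simps X0.r_distr)
  show "(0 :: yang) \<noteq> 1" using ext_yangian_nontrivial[of g0] by (simp add: Rep_yang_inject[symmetric] Rep_simps)
  show "sc 1 = (1 :: yang)" by (simp add: Rep_yang_inject[symmetric] Rep_simps X0.scalar_one)
  show "sc (u + v) = (sc u + sc v :: yang)" by (simp add: Rep_yang_inject[symmetric] Rep_simps X0.scalar_add)
  show "sc (u * v) = (sc u * sc v :: yang)" by (simp add: Rep_yang_inject[symmetric] Rep_simps X0.scalar_mult)
  show "sc u * a = a * sc u" by (simp add: Rep_yang_inject[symmetric] Rep_simps X0.scalar_commute)
qed

end

lemma Rep_smult: "Rep_yang (sc c * x) = c \<odot>\<^bsub>X0\<^esub> Rep_yang x"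
  by (simp add: Rep_mult Rep_sc X0.smult_eq[of "Rep_yang x" c, symmetric])

definition quo :: "free \<Rightarrow> yang" where
  "quo f = Abs_yang (quot_map (free_alg g0) (yangian_ideal g0) f)"

interpretation F0: calgebra "free_alg g0" by (rule free_alg_calgebra)

lemma Rep_quo: "f \<in> carrier (free_alg g0) \<Longrightarrow> Rep_yang (quo f) = quot_map (free_alg g0) (yangian_ideal g0) f"
  using F0.quot_map_closed[of f "yangian_ideal g0"] by (simp add: quo_def Abs_yang_inverse ext_yangian_def)

lemma quo_surj: "\<exists>f\<in>carrier (free_alg g0). quo f = x"
proof -
  have "Rep_yang x \<in> quot_map (free_alg g0) (yangian_ideal g0) ` carrier (free_alg g0)"
    using Rep_yang[of x] F0.quot_carrier[of "yangian_ideal g0"] by (simp add: ext_yangian_def)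
  then show ?thesis by (auto simp: quo_def Rep_yang_inverse) (metis Rep_yang_inverse)
qed

lemma quo_add: "f \<in> carrier (free_alg g0) \<Longrightarrow> h \<in> carrier (free_alg g0) \<Longrightarrow> quo (f + h) = quo f + quo h"
  using F0.quot_map_add[OF yangian_ideal_ideal, of f h] F0.a_closed[of f h]
  by (simp add: Rep_yang_inject[symmetric] Rep_simps Rep_quo ext_yangian_def)

lemma quo_mult: "f \<in> carrier (free_alg g0) \<Longrightarrow> h \<in> carrier (free_alg g0) \<Longrightarrow> quo (f * h) = quo f * quo h"
  using F0.quot_map_mult[OF yangian_ideal_ideal, of f h] F0.m_closed[of f h]
  by (simp add: Rep_yang_inject[symmetric] Rep_simps Rep_quo ext_yangian_def)

lemma quo_one: "quo 1 = 1"
  using F0.quot_map_one[OF yangian_ideal_ideal] F0.one_closed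
  by (simp add: Rep_yang_inject[symmetric] Rep_simps Rep_quo ext_yangian_def)

lemma quo_sc: "quo (sc c) = sc c"
  using F0.quot_map_smult[OF yangian_ideal_ideal F0.one_closed, of c] F0.scalar_closed[of c] F0.quot_map_one[OF yangian_ideal_ideal]
  by (simp add: Rep_yang_inject[symmetric] Rep_simps Rep_quo ext_yangian_def free_alg_smult)

lemma quo_eq_iff:
  assumes "f \<in> carrier (free_alg g0)" "h \<in> carrier (free_alg g0)"
  shows "quo f = quo h \<longleftrightarrow> f - h \<in> yangian_ideal g0"
proof -
  have "\<ominus>\<^bsub>free_alg g0\<^esub> h = - h"
    using assms F0.minus_equality[of "- h" h]
    by (simp add: evf_restr ring_morph.uminus[OF ring_morph_evf])
  then show ?thesis
    using F0.quot_map_eq_iff[OF yangian_ideal_ideal assms] assms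
    by (simp add: Rep_yang_inject[symmetric] Rep_quo a_minus_def)
qed

lemma quo_zero_iff: "f \<in> carrier (free_alg g0) \<Longrightarrow> quo f = 0 \<longleftrightarrow> f \<in> yangian_ideal g0"
  using quo_eq_iff[of f 0] quo_add[of 0 0] F0.zero_closed by simp

definition tt :: "int \<Rightarrow> int \<Rightarrow> yang fps" where
  "tt i j = Abs_fps (\<lambda>r. quo (gen i j r))"

lemma tt_nth: "fps_nth (tt i j) r = quo (gen i j r)"
  by (simp add: tt_def)

lemma Rep_tt: "i \<in> idx g0 \<Longrightarrow> j \<in> idx g0 \<Longrightarrow> Rep_yang (fps_nth (tt i j) r) = T_mat g0 i j r"
  by (simp add: tt_def T_mat_def Rep_quo gen_carrier)

lemma single_carrier: "set w \<subseteq> idx g \<times> idx g \<times> UNIV \<Longrightarrow> Poly_Mapping.single w c \<in> carrier (free_alg g)"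
  by (auto simp: free_carrier)

lemma quo_single: "set w \<subseteq> idx g0 \<times> idx g0 \<times> UNIV \<Longrightarrow> quo (Poly_Mapping.single w c) = sc c * word_val tt w"
proof (induction w)
  case Nil
  have "Poly_Mapping.single [] c = (sc c :: free)"
    by (simp add: sc_poly_mapping_def sc_complex_def zero_list_def)
  then show ?case by (simp add: quo_sc word_val_def)
next
  case (Cons a w)
  obtain i j r where a: "a = (i, j, r)" by (cases a)
  have ij: "i \<in> idx g0" "j \<in> idx g0" using Cons.prems a by auto
  have "Poly_Mapping.single (a # w) c = gen i j r * Poly_Mapping.single w c"
    by (simp add: gen_def mult_single plus_list_def a)
  then have "quo (Poly_Mapping.single (a # w) c) = quo (gen i j r) * quo (Poly_Mapping.single w c)"
    using Cons.prems by (simp add: quo_mult gen_carrier ij single_carrier)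
  also have "\<dots> = fps_nth (tt i j) r * (sc c * word_val tt w)"
    using Cons by (simp add: tt_nth)
  also have "\<dots> = sc c * word_val tt (a # w)"
    by (simp add: word_val_def a central_left_commute[OF central_sc[of c]])
  finally show ?case .
qed

text \<open>The quotient map of the free algebra is evaluation at the generating series \<open>tt\<close>; hence \<open>tt\<close> itself
  satisfies the RTT relation.\<close>

lemma evf_tt: 
  assumes "f \<in> carrier (free_alg g0)" shows "evf tt f = quo f"
proof -
  have zero: "quo 0 = 0" using quo_zero_iff[OF F0.zero_closed] additive_subgroup.zero_closed[OF ideal.axioms(1)[OF yangian_ideal_ideal[of g0]]] by simp
  have "finite S \<Longrightarrow> (\<And>w. w \<in> S \<Longrightarrow> set w \<subseteq> idx g0 \<times> idx g0 \<times> UNIV) \<Longrightarrow>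
    (\<Sum>w\<in>S. Poly_Mapping.single w (c w)) \<in> carrier (free_alg g0) \<and>
    quo (\<Sum>w\<in>S. Poly_Mapping.single w (c w)) = (\<Sum>w\<in>S. sc (c w) * word_val tt w)" for S and c :: "_ \<Rightarrow> complex"
  proof (induction S rule: finite_induct)
    case empty
    then show ?case using F0.zero_closed zero by simp
  next
    case (insert w S)
    then have w: "set w \<subseteq> idx g0 \<times> idx g0 \<times> UNIV" by blast
    have IH: "(\<Sum>w\<in>S. Poly_Mapping.single w (c w)) \<in> carrier (free_alg g0)"
      "quo (\<Sum>w\<in>S. Poly_Mapping.single w (c w)) = (\<Sum>w\<in>S. sc (c w) * word_val tt w)"
      using insert by auto
    show ?case
      using insert.hyps F0.a_closed[OF single_carrier[OF w, of "c w"] IH(1)]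
      by (simp add: quo_add[OF single_carrier[OF w] IH(1)] IH(2) quo_single[OF w])
  qed
  from this[of "Poly_Mapping.keys f" "Poly_Mapping.lookup f"] assms
  show ?thesis
    unfolding poly_mapping_sum_single[symmetric] by (auto simp: evf_def lin_def free_carrier)
qed

lemma rtt_tt: "rtt g0 tt" and tt_0: "i \<in> idx g0 \<Longrightarrow> j \<in> idx g0 \<Longrightarrow> fps_nth (tt i j) 0 = of_bool (i = j)"
proof -
  have "evf tt x = 0" if "x \<in> yangian_rels g0" for x
    using that yangian_rels_ideal yangian_rels_carrier by (simp add: evf_tt quo_zero_iff subset_iff)
  then have "rtt g0 tt \<and> (\<forall>i\<in>idx g0. \<forall>j\<in>idx g0. fps_nth (tt i j) 0 = of_bool (i = j))"
    using evf_yangian_rels[of g0 tt] by blast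
  then show "rtt g0 tt" "i \<in> idx g0 \<Longrightarrow> j \<in> idx g0 \<Longrightarrow> fps_nth (tt i j) 0 = of_bool (i = j)" by auto
qed

text \<open>The homomorphism out of the extended Yangian that a solution \<open>t\<close> of the RTT relation induces;
  its value does not depend on the chosen preimage in the free algebra.\<close>

definition ind :: "(int \<Rightarrow> int \<Rightarrow> 'a::calg fps) \<Rightarrow> yang \<Rightarrow> 'a" where
  "ind t x = evf t (SOME f. f \<in> carrier (free_alg g0) \<and> quo f = x)"

lemma ind_quo:
  assumes t: "rtt g0 t" "\<And>i j. i \<in> idx g0 \<Longrightarrow> j \<in> idx g0 \<Longrightarrow> fps_nth (t i j) 0 = of_bool (i = j)"
    and f: "f \<in> carrier (free_alg g0)"
  shows "ind t (quo f) = evf t f"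
proof -
  let ?h = "SOME h. h \<in> carrier (free_alg g0) \<and> quo h = quo f"
  have h: "?h \<in> carrier (free_alg g0) \<and> quo ?h = quo f"
    by (rule someI[of _ f]) (simp add: f)
  then have "?h - f \<in> yangian_ideal g0" using quo_eq_iff f by blast
  then have "evf t (?h - f) = 0" by (intro evf_yangian_ideal[OF t(1)] t(2))
  then show ?thesis by (simp add: ind_def ring_morph.diff[OF ring_morph_evf])
qed

lemma ind_properties:
  assumes t: "rtt g0 t" "\<And>i j. i \<in> idx g0 \<Longrightarrow> j \<in> idx g0 \<Longrightarrow> fps_nth (t i j) 0 = of_bool (i = j)"
  shows ring_morph_ind: "ring_morph (ind t)"
    and ind_sc: "ind t (sc c) = sc c"
    and ind_tt: "i \<in> idx g0 \<Longrightarrow> j \<in> idx g0 \<Longrightarrow> ind t (fps_nth (tt i j) r) = fps_nth (t i j) r"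
proof -
  interpret e: ring_morph "evf t" by (rule ring_morph_evf)
  have q: "f \<in> carrier (free_alg g0) \<Longrightarrow> ind t (quo f) = evf t f" for f
    by (intro ind_quo[OF t(1)] t(2))
  show "ring_morph (ind t)"
  proof
    show "ind t 1 = 1" using q[OF F0.one_closed] by (simp add: quo_one e.one)
    fix x y
    obtain f h where fh: "f \<in> carrier (free_alg g0)" "quo f = x" "h \<in> carrier (free_alg g0)" "quo h = y"
      using quo_surj by metis
    show "ind t (x + y) = ind t x + ind t y"
      using q[of f] q[of h] q[of "f + h"] F0.a_closed[of f h] quo_add[of f h] fh by (simp add: e.add)
    show "ind t (x * y) = ind t x * ind t y"
      using q[of f] q[of h] q[of "f * h"] F0.m_closed[of f h] quo_mult[of f h] fh by (simp add: e.mult)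
  qed
  show "ind t (sc c) = sc c"
    using q[of "sc c"] F0.scalar_closed[of c] by (simp add: quo_sc evf_sc free_alg_smult)
  show "ind t (fps_nth (tt i j) r) = fps_nth (t i j) r" if "i \<in> idx g0" "j \<in> idx g0"
    using q[OF gen_carrier[OF that]] by (simp add: tt_def evf_gen)
qed

lemma central_if_commutes_tt:
  assumes "\<And>i j r. i \<in> idx g0 \<Longrightarrow> j \<in> idx g0 \<Longrightarrow> a * fps_nth (tt i j) r = fps_nth (tt i j) r * a"
  shows "central a"
  unfolding central_def
proof
  fix x :: yang
  obtain f where f: "f \<in> carrier (free_alg g0)" "x = evf tt f"
    using quo_surj[of x] evf_tt by metis
  have w: "a * word_val tt w = word_val tt w * a" if "set w \<subseteq> idx g0 \<times> idx g0 \<times> UNIV" for w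
    using that
  proof (induction w)
    case (Cons b w)
    obtain i j r where b: "b = (i, j, r)" by (cases b)
    have "a * word_val tt (b # w) = (a * fps_nth (tt i j) r) * word_val tt w"
      by (simp add: word_val_def b mult.assoc)
    also have "\<dots> = fps_nth (tt i j) r * (a * word_val tt w)"
      using Cons.prems by (simp add: b assms mult.assoc)
    also have "\<dots> = word_val tt (b # w) * a"
      using Cons by (simp add: word_val_def b mult.assoc)
    finally show ?case .
  qed (simp add: word_val_def)
  have "a * (sc c * word_val tt w) = sc c * word_val tt w * a" if "w \<in> Poly_Mapping.keys f" for w c
    using w[of w] that f(1) central_left_commute[OF central_sc, of a c "word_val tt w"] by (auto simp: free_carrier mult.assoc)
  then show "a * x = x * a"
    unfolding f(2) evf_def lin_def sum_distrib_left sum_distrib_right by (rule sum.cong[OF refl])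
qed

section \<open>The matrices of symmetric pairs\<close>

lemma sum_E_diag: "(\<Sum>a=m..n. E_unit a a i j) = of_bool (i = j \<and> m \<le> i \<and> i \<le> n)"
proof -
  have "(\<Sum>a=m..n. E_unit a a i j) = (\<Sum>a=m..n. if a = i then of_bool (i = j) else 0)"
    by (intro sum.cong) (auto simp: E_unit_def)
  then show ?thesis by auto
qed

lemma sum_E_diag': "(\<Sum>a=m..n. E_unit (- a) (- a) i j) = of_bool (i = j \<and> m \<le> - i \<and> - i \<le> n)"
proof -
  have "(\<Sum>a=m..n. E_unit (- a) (- a) i j) = (\<Sum>a=m..n. if a = - i then of_bool (i = j) else 0)"
    by (intro sum.cong) (auto simp: E_unit_def)
  then show ?thesis by auto
qed

lemma sum_E_anti: "(\<Sum>a=m..n. E_unit (- a) a i j) = of_bool (i = - j \<and> m \<le> - i \<and> - i \<le> n)"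
proof -
  have "(\<Sum>a=m..n. E_unit (- a) a i j) = (\<Sum>a=m..n. if a = - i then of_bool (i = - j) else 0)"
    by (intro sum.cong) (auto simp: E_unit_def)
  then show ?thesis by auto
qed

lemma sum_E_anti': "(\<Sum>a=m..n. E_unit a (- a) i j) = of_bool (i = - j \<and> m \<le> i \<and> i \<le> n)"
proof -
  have "(\<Sum>a=m..n. E_unit a (- a) i j) = (\<Sum>a=m..n. if a = i then of_bool (i = - j) else 0)"
    by (intro sum.cong) (auto simp: E_unit_def)
  then show ?thesis by auto
qed

lemma sum_E_diag_pair: "m \<ge> 1 \<Longrightarrow>
  (\<Sum>a=m..n. E_unit a a i j + E_unit (- a) (- a) i j) = of_bool (i = j \<and> m \<le> \<bar>i\<bar> \<and> \<bar>i\<bar> \<le> n)"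
  unfolding sum.distrib sum_E_diag sum_E_diag' by (cases "i = j"; cases "i \<ge> 0") auto

lemma sum_E_sign_pair: "
  (\<Sum>a=1..n. E_unit a a i j - E_unit (- a) (- a) i j) = of_bool (i = j \<and> \<bar>i\<bar> \<le> n) * of_int (sgn i)"
  unfolding sum_subtractf sum_E_diag sum_E_diag' by (cases "i = j"; cases "i > 0"; cases "i = 0") auto

lemma sum_E_anti_pair: "m \<ge> 1 \<Longrightarrow>
  (\<Sum>a=m..n. E_unit (- a) a i j + E_unit a (- a) i j) = of_bool (i = - j \<and> m \<le> \<bar>i\<bar> \<and> \<bar>i\<bar> \<le> n)"
  unfolding sum.distrib sum_E_anti sum_E_anti' by (cases "i = - j"; cases "i \<ge> 0") auto

lemma idx_bound:
  assumes "i \<in> idx g"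
  shows "\<bar>i\<bar> \<le> int (lie_dim g) div 2" "even (lie_dim g) \<Longrightarrow> i \<noteq> 0"
  using assms by (auto simp: idx_def Let_def zdiv_int split: if_splits)

lemma exI2: "P x y \<Longrightarrow> \<exists>x y. P x y"
  by blast

text \<open>In each type, \<open>G\<close> is diagonal with entries \<open>s i = \<plusminus> 1\<close> on a symmetric set \<open>D\<close> of indices and exchanges \<open>i\<close>
  with \<open>- i\<close> outside it. Either part squares to the identity.\<close>

lemma G_mat_form:
  assumes "symmetric_pair g ty"
  shows "\<exists>D s. (\<forall>i. D (- i) = D i) \<and> (\<forall>i\<in>idx g. s i * s i = (1::complex)) \<and>
    (\<forall>i\<in>idx g. \<forall>j\<in>idx g. G_mat g ty i j = (if D i then (if i = j then s i else 0) else (if i = - j then 1 else 0)))"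
    (is "\<exists>D s. ?P D s")
proof (cases ty)
  case BCD0
  have "?P (\<lambda>_. True) (\<lambda>_. 1)" unfolding BCD0 by simp
  then show ?thesis by (rule exI2[where P = "\<lambda>D s. ?P D s"])
next
  case CI
  then have ev: "even (lie_dim g)" using assms by auto
  have G: "G_mat g ty i j = (if True then (if i = j then of_int (sgn i) else 0) else (if i = - j then 1 else 0))"
    if i: "i \<in> idx g" for i j
    using idx_bound(1)[OF i] unfolding CI G_mat.simps sum_E_sign_pair by simp
  have s: "of_int (sgn i) * of_int (sgn i) = (1 :: complex)" if i: "i \<in> idx g" for i
    using idx_bound(2)[OF i ev] by (simp add: sgn_if)
  have "?P (\<lambda>_. True) (\<lambda>i. of_int (sgn i))" by (intro conjI allI ballI G s refl)
  then show ?thesis by (rule exI2[where P = "\<lambda>D s. ?P D s"])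
next
  case DIII
  then have ev: "even (lie_dim g)" using assms by auto
  have G: "G_mat g ty i j = (if True then (if i = j then of_int (sgn i) else 0) else (if i = - j then 1 else 0))"
    if i: "i \<in> idx g" for i j
    using idx_bound(1)[OF i] unfolding DIII G_mat.simps sum_E_sign_pair by simp
  have s: "of_int (sgn i) * of_int (sgn i) = (1 :: complex)" if i: "i \<in> idx g" for i
    using idx_bound(2)[OF i ev] by (simp add: sgn_if)
  have "?P (\<lambda>_. True) (\<lambda>i. of_int (sgn i))" by (intro conjI allI ballI G s refl)
  then show ?thesis by (rule exI2[where P = "\<lambda>D s. ?P D s"])
next
  case (CII p q)
  then have "even (lie_dim g)" using assms by auto
  have G: "G_mat g ty i j = (if True then (if i = j then (if \<bar>i\<bar> \<le> int q div 2 then -1 else 1) else 0) else (if i = - j then 1 else 0))"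
    if i: "i \<in> idx g" for i j
  proof -
    have "1 \<le> \<bar>i\<bar>" "\<bar>i\<bar> \<le> int (lie_dim g) div 2" using idx_bound[OF i] \<open>even (lie_dim g)\<close> by auto
    then show ?thesis unfolding CII G_mat.simps by (simp add: sum_E_diag_pair)
  qed
  have s: "(if \<bar>i\<bar> \<le> int q div 2 then -1 else 1) * (if \<bar>i\<bar> \<le> int q div 2 then -1 else 1) = (1 :: complex)" for i
    by simp
  have "?P (\<lambda>_. True) (\<lambda>i. if \<bar>i\<bar> \<le> int q div 2 then -1 else 1)" by (intro conjI allI ballI G s refl)
  then show ?thesis by (rule exI2[where P = "\<lambda>D s. ?P D s"])
next
  case (BDI p q)
  then have g: "g = SO (p + q)" using assms by auto
  have pq: "p \<ge> q" using assms BDI by (auto split: if_splits)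
  show ?thesis
  proof (cases "even (p + q)")
    case True
    let ?m = "(int p - int q) div 2"
    have m: "0 \<le> ?m" using pq by simp
    have G: "G_mat g ty i j = (if \<bar>i\<bar> \<le> ?m then (if i = j then 1 else 0) else (if i = - j then 1 else 0))"
      if i: "i \<in> idx g" for i j
    proof -
      have i': "1 \<le> \<bar>i\<bar>" "\<bar>i\<bar> \<le> int (lie_dim g) div 2" using idx_bound[OF i] True g by auto
      have "G_mat g ty i j = of_bool (i = j \<and> 1 \<le> \<bar>i\<bar> \<and> \<bar>i\<bar> \<le> ?m)
        + of_bool (i = - j \<and> ?m + 1 \<le> \<bar>i\<bar> \<and> \<bar>i\<bar> \<le> int (lie_dim g) div 2)"
        using True m g unfolding BDI G_mat.simps by (simp add: sum_E_diag_pair sum_E_anti_pair)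
      then show ?thesis using i' by simp
    qed
    have "?P (\<lambda>i. \<bar>i\<bar> \<le> ?m) (\<lambda>_. 1)" by (intro conjI allI ballI G) simp_all
    then show ?thesis by (rule exI2[where P = "\<lambda>D s. ?P D s"])
  next
    case False
    let ?m = "(int p - int q - 1) div 2"
    have "p \<noteq> q" using False by auto
    then have m: "0 \<le> ?m" using pq by simp
    have m1: "(int p - int q + 1) div 2 = ?m + 1" by linarith
    have G: "G_mat g ty i j = (if \<bar>i\<bar> \<le> ?m then (if i = j then 1 else 0) else (if i = - j then 1 else 0))"
      if i: "i \<in> idx g" for i j
    proof -
      have i': "\<bar>i\<bar> \<le> (int (lie_dim g) - 1) div 2"
      proof -
        have "odd (int (lie_dim g))" using False g by simp
        then have "int (lie_dim g) div 2 = (int (lie_dim g) - 1) div 2" by presburger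
        then show ?thesis using idx_bound(1)[OF i] by simp
      qed
      have "G_mat g ty i j = of_bool (i = j \<and> - ?m \<le> i \<and> i \<le> ?m)
        + of_bool (i = - j \<and> ?m + 1 \<le> \<bar>i\<bar> \<and> \<bar>i\<bar> \<le> (int (lie_dim g) - 1) div 2)"
        using False m g m1 unfolding BDI G_mat.simps by (simp add: sum_E_diag sum_E_anti_pair)
      moreover have "- ?m \<le> i \<and> i \<le> ?m \<longleftrightarrow> \<bar>i\<bar> \<le> ?m" by linarith
      ultimately show ?thesis using i' by auto
    qed
    have "?P (\<lambda>i. \<bar>i\<bar> \<le> ?m) (\<lambda>_. 1)" by (intro conjI allI ballI G) simp_all
    then show ?thesis by (rule exI2[where P = "\<lambda>D s. ?P D s"])
  qed
qed

lemma G_mat_square: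
  assumes "symmetric_pair g ty" "i \<in> idx g" "j \<in> idx g"
  shows "(\<Sum>k\<in>idx g. G_mat g ty i k * G_mat g ty k j) = of_bool (i = j)"
proof -
  obtain D s where D: "\<And>i. D (- i) = D i" and s: "\<And>i. i \<in> idx g \<Longrightarrow> s i * s i = (1::complex)"
    and G: "\<And>i j. i \<in> idx g \<Longrightarrow> j \<in> idx g \<Longrightarrow> G_mat g ty i j = (if D i then (if i = j then s i else 0) else (if i = - j then 1 else 0))"
    using G_mat_form[OF assms(1)] by blast
  show ?thesis
  proof (cases "D i")
    case True
    have "(\<Sum>k\<in>idx g. G_mat g ty i k * G_mat g ty k j) = (\<Sum>k\<in>idx g. if k = i then s i * G_mat g ty i j else 0)"
      using assms True by (intro sum.cong) (auto simp: G)
    then show ?thesis using assms True s by (simp add: G)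
  next
    case False
    have "(\<Sum>k\<in>idx g. G_mat g ty i k * G_mat g ty k j) = (\<Sum>k\<in>idx g. if k = - i then G_mat g ty (- i) j else 0)"
      using assms False by (intro sum.cong) (auto simp: G)
    then show ?thesis using assms False D by (simp add: G)
  qed
qed

lemma scf_complex: "(scf F :: complex fps) = F"
  by (simp add: fps_eq_iff sc_complex_def)

lemma sub_const: "b \<noteq> 0 \<Longrightarrow> sub b a (fps_const x) = fps_const x"
  by (simp add: sub_def fmap_const ev_const mob_0)

lemma sub_X: "b \<noteq> 0 \<Longrightarrow> sub b a fps_X = scf (mob b a)"
  by (simp add: sub_def fmap_X ev_X mob_0)

lemma mob_neg: "mob (-1) 0 = - fps_X"
proof -
  have "mob (-1) 0 * fps_const (-1) = fps_X" using mob_unit[of "-1" 0] by simp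
  then have "- mob (-1) 0 = (fps_X :: complex fps)" by (simp flip: fps_const_neg)
  then show ?thesis by (metis minus_minus)
qed

definition Gc :: "lie_type \<Rightarrow> pair_type \<Rightarrow> int \<Rightarrow> int \<Rightarrow> complex fps" where
  "Gc g ty i j = fls_regpart (G_fls g ty i j)"

lemma Gc_rational:
  assumes "c \<noteq> 0"
  shows "fls_regpart (G_rational c G i j)
    = (fps_const (of_bool (i = j)) * fps_X - fps_const (c * G i j)) * inverse (fps_X - fps_const c)"
proof -
  let ?D = "fps_X - fps_const c :: complex fps"
  let ?N = "fps_const (of_bool (i = j)) * fps_X - fps_const (c * G i j) :: complex fps"
  have D: "inverse ?D * ?D = 1" by (rule inverse_mult_eq_1) (use assms in simp)
  have u: "fls_X * fls_X_inv = (1 :: complex fls)" by (simp add: fls_X_times_conv_shift)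
  have 1: "fls_X * (1 - fls_const c * fls_X_inv) = fps_to_fls ?D"
    using u by (simp add: algebra_simps)
  have 2: "fls_X * (of_bool (i = j) - fls_const c * fls_X_inv * fls_const (G i j)) = fps_to_fls ?N"
  proof -
    have "fls_X * (of_bool (i = j) - fls_const c * fls_X_inv * fls_const (G i j))
      = of_bool (i = j) * fls_X - (fls_X * fls_X_inv) * (fls_const c * fls_const (G i j))"
      by (simp only: right_diff_distrib mult_ac)
    then show ?thesis by (simp add: u fls_times_fps_to_fls)
  qed
  have "?D \<noteq> 0"
  proof
    assume "?D = 0"
    then have "inverse ?D * ?D = 0" by (simp only: mult_zero_right)
    then show False using D by simp
  qed
  then have "fps_to_fls ?D \<noteq> 0" unfolding fps_to_fls_eq_0_iff .
  then have 3: "1 - fls_const c * fls_X_inv \<noteq> 0" using 1 by auto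
  have "G_rational c G i j = fps_to_fls (?N * inverse ?D)"
  proof -
    have "fps_to_fls (?N * inverse ?D) * (1 - fls_const c * fls_X_inv) * fls_X
      = fps_to_fls (?N * inverse ?D) * fps_to_fls ?D" by (simp only: 1[symmetric] mult_ac)
    also have "\<dots> = fps_to_fls ?N" by (simp only: fls_times_fps_to_fls[symmetric] mult.assoc D mult_1_right)
    also have "\<dots> = (of_bool (i = j) - fls_const c * fls_X_inv * fls_const (G i j)) * fls_X"
      unfolding 2[symmetric] by (rule mult.commute)
    finally have "fps_to_fls (?N * inverse ?D) * (1 - fls_const c * fls_X_inv)
      = of_bool (i = j) - fls_const c * fls_X_inv * fls_const (G i j)" by simp
    then show ?thesis unfolding G_rational_def nonzero_divide_eq_eq[OF 3] by (rule sym)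
  qed
  then show ?thesis by simp
qed

text \<open>With \<open>G\<^sup>2 = 1\<close>, the product \<open>(1 - c u G) (1 + c u G) = 1 - c\<^sup>2 u\<^sup>2\<close> is the product of the two denominators.\<close>

lemma G_rational_inverse:
  assumes G: "\<And>i j. i \<in> I \<Longrightarrow> j \<in> I \<Longrightarrow> (\<Sum>k\<in>I. G i k * G k j) = of_bool (i = j)" and I: "finite I" "i \<in> I" "j \<in> I"
    and c: "c \<noteq> 0"
  defines "H \<equiv> \<lambda>i j. fls_regpart (G_rational c G i j)"
  shows "(\<Sum>k\<in>I. H i k * sub (-1) 0 (H k j)) = of_bool (i = j)"
proof -
  let ?D = "fps_X - fps_const c :: complex fps"
  interpret s: ring_morph "sub (-1) 0 :: complex fps \<Rightarrow> complex fps" by (rule ring_morph_sub) simp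
  have D: "inverse ?D * ?D = 1" by (rule inverse_mult_eq_1) (use c in simp)
  have sX: "sub (-1) 0 fps_X = (- fps_X :: complex fps)" by (simp add: sub_X mob_neg scf_complex)
  have sD: "sub (-1) 0 (inverse ?D) * (- fps_X - fps_const c) = 1"
    using arg_cong[OF D, of "sub (-1) 0"] by (simp add: s.mult s.diff s.one sX sub_const)
  let ?N = "\<lambda>i j. fps_const (of_bool (i = j)) * fps_X - fps_const (c * G i j) :: complex fps"
  let ?N' = "\<lambda>i j. - (fps_const (of_bool (i = j)) * fps_X) - fps_const (c * G i j) :: complex fps"
  have "(\<Sum>k\<in>I. H i k * sub (-1) 0 (H k j)) = (\<Sum>k\<in>I. ?N i k * ?N' k j) * (inverse ?D * sub (-1) 0 (inverse ?D))"
    unfolding sum_distrib_right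
    by (intro sum.cong refl) (simp add: H_def Gc_rational[OF c] s.mult s.diff sX sub_const)
  also have "(\<Sum>k\<in>I. ?N i k * ?N' k j) = fps_const (of_bool (i = j)) * (fps_const (c * c) - fps_X * fps_X)"
  proof -
    have "(\<Sum>k\<in>I. ?N i k * ?N' k j) = (\<Sum>k\<in>I. - (fps_const (of_bool (i = k) * of_bool (k = j)) * (fps_X * fps_X))
       - fps_const (c * (of_bool (i = k) * G k j)) * fps_X + fps_const (c * (G i k * of_bool (k = j))) * fps_X
       + fps_const (c * c * (G i k * G k j)))"
    proof (intro sum.cong refl)
      have gen: "(a * x - e * u) * (- (b * x) - e * v) = - (a * b * (x * x)) - e * (a * v) * x + e * (u * b) * x + e * e * (u * v)"
        for a b e u v x :: "complex fps" by (simp add: algebra_simps)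
      show "?N i k * ?N' k j = - (fps_const (of_bool (i = k) * of_bool (k = j)) * (fps_X * fps_X))
       - fps_const (c * (of_bool (i = k) * G k j)) * fps_X + fps_const (c * (G i k * of_bool (k = j))) * fps_X
       + fps_const (c * c * (G i k * G k j))" for k
        by (simp only: fps_const_mult[symmetric] gen)
    qed
    also have "\<dots> = - (fps_const (\<Sum>k\<in>I. of_bool (i = k) * of_bool (k = j)) * (fps_X * fps_X))
       - fps_const (c * (\<Sum>k\<in>I. of_bool (i = k) * G k j)) * fps_X + fps_const (c * (\<Sum>k\<in>I. G i k * of_bool (k = j))) * fps_X
       + fps_const (c * c * (\<Sum>k\<in>I. G i k * G k j))"
      by (simp add: sum.distrib sum_subtractf sum_negf sum_distrib_right sum_distrib_left ring_morph.sum[OF ring_morph_fps_const])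
    also have "(\<Sum>k\<in>I. of_bool (i = k) * of_bool (k = j)) = (of_bool (i = j) :: complex)"
      using I by (simp add: of_bool_def if_distrib[of "\<lambda>x. x * _"] cong: if_cong)
    also have "(\<Sum>k\<in>I. of_bool (i = k) * G k j) = G i j"
      using I by (simp add: of_bool_def if_distrib[of "\<lambda>x. x * _"] cong: if_cong)
    also have "(\<Sum>k\<in>I. G i k * of_bool (k = j)) = G i j"
      using I by (simp add: of_bool_def if_distrib[of "\<lambda>x. _ * x"] cong: if_cong)
    also have "(\<Sum>k\<in>I. G i k * G k j) = of_bool (i = j)" by (rule G[OF I(2,3)])
    finally have "(\<Sum>k\<in>I. ?N i k * ?N' k j) = - (fps_const (of_bool (i = j)) * (fps_X * fps_X))
      + fps_const (c * c * of_bool (i = j))" by (simp only: diff_add_cancel)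
    then show ?thesis by (cases "i = j") simp_all
  qed
  also have "fps_const (c * c) - fps_X * fps_X = ?D * (- fps_X - fps_const c)"
    by (simp add: algebra_simps)
  also have "fps_const (of_bool (i = j)) * (?D * (- fps_X - fps_const c)) * (inverse ?D * sub (-1) 0 (inverse ?D))
     = fps_const (of_bool (i = j)) * (inverse ?D * ?D) * (sub (-1) 0 (inverse ?D) * (- fps_X - fps_const c))"
    by (simp only: mult_ac)
  also have "\<dots> = of_bool (i = j)" unfolding D sD by simp
  finally show ?thesis .
qed

lemma Gc_inverse:
  assumes "symmetric_pair g ty" "i \<in> idx g" "j \<in> idx g"
  shows "(\<Sum>k\<in>idx g. Gc g ty i k * sub (-1) 0 (Gc g ty k j)) = of_bool (i = j)"
proof -
  note G = G_mat_square[OF assms(1)]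
  have "(\<Sum>k\<in>idx g. fps_const (G_mat g ty i k) * sub (-1) 0 (fps_const (G_mat g ty k j))) = of_bool (i = j)"
  proof -
    have "(\<Sum>k\<in>idx g. fps_const (G_mat g ty i k) * sub (-1) 0 (fps_const (G_mat g ty k j)))
      = fps_const (\<Sum>k\<in>idx g. G_mat g ty i k * G_mat g ty k j)"
      by (simp add: sub_const ring_morph.sum[OF ring_morph_fps_const])
    then show ?thesis by (simp add: G[OF assms(2,3)])
  qed
  moreover have "fls_regpart (fls_const x) = fps_const x" for x :: complex
    by (metis fls_regpart_fps_trivial fps_const_to_fls)
  ultimately have const: ?thesis if "\<And>i j. G_fls g ty i j = fls_const (G_mat g ty i j)"
    unfolding Gc_def that by simp
  have rat: ?thesis if "p > q" "\<And>i j. G_fls g ty i j = G_rational (4 / (of_nat p - of_nat q)) (G_mat g ty) i j" for p q :: nat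
    unfolding Gc_def that(2)
    by (rule G_rational_inverse[OF G]) (use assms that(1) in auto)
  show ?thesis
  proof (cases ty)
    case (CII p q)
    then show ?thesis using const rat[of q p] by (cases "p > q") auto
  next
    case (BDI p q)
    then show ?thesis using const rat[of q p] by (cases "p > q") auto
  qed (use const in auto)
qed

section \<open>Subalgebras and series with coefficients in them\<close>

text \<open>Without the condition \<open>1 \<in> V\<close>, so that two-sided ideals are covered as well.\<close>

definition nsubalg :: "'a::calg set \<Rightarrow> bool" where
  "nsubalg V \<longleftrightarrow> 0 \<in> V \<and> (\<forall>x\<in>V. \<forall>y\<in>V. x + y \<in> V \<and> x * y \<in> V) \<and> (\<forall>c. \<forall>x\<in>V. sc c * x \<in> V)"

lemma nsubalgD:
  assumes "nsubalg V"
  shows "0 \<in> V" "x \<in> V \<Longrightarrow> y \<in> V \<Longrightarrow> x + y \<in> V" "x \<in> V \<Longrightarrow> y \<in> V \<Longrightarrow> x * y \<in> V" "x \<in> V \<Longrightarrow> sc c * x \<in> V"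
    "x \<in> V \<Longrightarrow> - x \<in> V" "x \<in> V \<Longrightarrow> y \<in> V \<Longrightarrow> x - y \<in> V" "(\<And>i. i \<in> A \<Longrightarrow> f i \<in> V) \<Longrightarrow> sum f A \<in> V"
proof -
  show 0: "0 \<in> V" and add: "x \<in> V \<Longrightarrow> y \<in> V \<Longrightarrow> x + y \<in> V" and m: "x \<in> V \<Longrightarrow> y \<in> V \<Longrightarrow> x * y \<in> V"
    and s: "x \<in> V \<Longrightarrow> sc c * x \<in> V" for x y c using assms by (auto simp: nsubalg_def)
  have "sc (-1) * x = - x" for x :: 'a by (simp add: sc.uminus sc.one)
  then show u: "x \<in> V \<Longrightarrow> - x \<in> V" for x using s[of x "-1"] by simp
  show "x \<in> V \<Longrightarrow> y \<in> V \<Longrightarrow> x - y \<in> V" using add[of x "- y"] u[of y] by simp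
  show "(\<And>i. i \<in> A \<Longrightarrow> f i \<in> V) \<Longrightarrow> sum f A \<in> V"
    by (induction A rule: infinite_finite_induct) (auto simp: 0 add)
qed

inductive_set alg :: "'a::calg set \<Rightarrow> 'a set" for S where
  base: "x \<in> S \<Longrightarrow> x \<in> alg S"
| one: "1 \<in> alg S"
| add: "x \<in> alg S \<Longrightarrow> y \<in> alg S \<Longrightarrow> x + y \<in> alg S"
| mult: "x \<in> alg S \<Longrightarrow> y \<in> alg S \<Longrightarrow> x * y \<in> alg S"
| scale: "x \<in> alg S \<Longrightarrow> sc c * x \<in> alg S"

lemma nsubalg_alg: "nsubalg (alg S)"
proof -
  have "sc 0 * 1 \<in> alg S" by (intro alg.intros)
  then show ?thesis by (auto simp: nsubalg_def sc.zero intro: alg.intros)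
qed

lemma alg_least:
  assumes "nsubalg V" "1 \<in> V" "S \<subseteq> V" shows "alg S \<subseteq> V"
proof
  fix x assume "x \<in> alg S" then show "x \<in> V"
    by induction (use assms nsubalgD[OF assms(1)] in auto)
qed

lemma alg_mono_alg: "S \<subseteq> alg T \<Longrightarrow> alg S \<subseteq> alg T"
  by (rule alg_least[OF nsubalg_alg alg.one])

lemma nsubalg_central: "nsubalg {x. central x}"
  by (auto simp: nsubalg_def intro: central_add central_mult)

lemma fps_mult_in: "nsubalg V \<Longrightarrow> (\<And>n. fps_nth F n \<in> V) \<Longrightarrow> (\<And>n. fps_nth G n \<in> V) \<Longrightarrow> fps_nth (F * G) n \<in> V"
  unfolding fps_mult_nth by (intro nsubalgD(7) nsubalgD(3)) auto

lemma sub_in: "nsubalg V \<Longrightarrow> (\<And>n. fps_nth F n \<in> V) \<Longrightarrow> fps_nth (sub b a F) n \<in> V"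
  unfolding sub_nth by (intro nsubalgD(7) nsubalgD(4)) auto

lemma central_fps_iff: "central F \<longleftrightarrow> (\<forall>n. central (fps_nth F n))"
proof
  assume c: "central F"
  show "\<forall>n. central (fps_nth F n)"
  proof
    fix n
    have "fps_nth F n * b = b * fps_nth F n" for b
      using arg_cong[OF centralD[OF c, of "fps_const b"], of "\<lambda>F. fps_nth F n"] by simp
    then show "central (fps_nth F n)" by (simp add: central_def)
  qed
qed (auto intro: central_fps)

lemma central_sub: "central F \<Longrightarrow> central (sub b a F)"
  unfolding central_fps_iff by (auto intro: sub_central)

section \<open>Factorisation of a series through a shift\<close>

lemma mult_low_left:
  fixes A B :: "'a::ring_1 fps"
  assumes "\<And>k. k < n \<Longrightarrow> fps_nth A k = 0" shows "fps_nth (A * B) n = fps_nth A n * fps_nth B 0"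
proof -
  have "fps_nth (A * B) n = (\<Sum>i=0..n. if i = n then fps_nth A n * fps_nth B 0 else 0)"
    unfolding fps_mult_nth by (intro sum.cong) (auto simp: assms)
  then show ?thesis by simp
qed

lemma mult_low_right:
  fixes A B :: "'a::ring_1 fps"
  assumes "\<And>k. k < n \<Longrightarrow> fps_nth A k = 0" shows "fps_nth (B * A) n = fps_nth B 0 * fps_nth A n"
proof -
  have "fps_nth (B * A) n = (\<Sum>i=0..n. if i = 0 then fps_nth B 0 * fps_nth A n else 0)"
    unfolding fps_mult_nth by (intro sum.cong) (auto simp: assms)
  then show ?thesis by simp
qed

lemma sub_low:
  assumes "b \<noteq> 0" "\<And>k. k < n \<Longrightarrow> fps_nth A k = 0"
  shows "k < n \<Longrightarrow> fps_nth (sub b a A) k = 0" "fps_nth (sub b a A) n = sc ((1 / b) ^ n) * fps_nth A n"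
proof -
  show "k < n \<Longrightarrow> fps_nth (sub b a A) k = 0"
    unfolding sub_nth by (intro sum.neutral) (auto simp: assms)
  have "fps_nth (sub b a A) n = (\<Sum>r\<le>n. if r = n then sc ((1 / b) ^ n) * fps_nth A n else 0)"
    unfolding sub_nth by (intro sum.cong) (auto simp: assms mob_power_diag[OF assms(1)])
  then show "fps_nth (sub b a A) n = sc ((1 / b) ^ n) * fps_nth A n" by simp
qed

text \<open>Truncation isolates the coefficient to be determined: in \<open>f(u) f(u + a)\<close>, with \<open>f\<close> of constant term 1, the
  \<open>n\<close>-th coefficient of \<open>f\<close> enters the \<open>n\<close>-th coefficient of the product only as twice itself.\<close>

definition trunc :: "nat \<Rightarrow> 'a::zero fps \<Rightarrow> 'a fps" where
  "trunc n F = Abs_fps (\<lambda>k. if k < n then fps_nth F k else 0)"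

lemma shift_product_nth:
  fixes Y :: "'a::calg fps"
  assumes Y: "fps_nth Y 0 = 1" and n: "n > 0"
  shows "fps_nth (Y * sub 1 a Y) n = fps_nth (trunc n Y * sub 1 a (trunc n Y)) n + (fps_nth Y n + fps_nth Y n)"
proof -
  interpret s: ring_morph "sub 1 a :: 'a fps \<Rightarrow> 'a fps" by (rule ring_morph_sub) simp
  let ?T = "trunc n Y" and ?R = "Y - trunc n Y"
  have R: "\<And>k. k < n \<Longrightarrow> fps_nth ?R k = 0" "fps_nth ?R n = fps_nth Y n" by (simp_all add: trunc_def)
  have T0: "fps_nth ?T 0 = 1" using Y n by (simp add: trunc_def)
  have "Y * sub 1 a Y = (?T + ?R) * sub 1 a (?T + ?R)" by simp
  also have "\<dots> = ?T * sub 1 a ?T + ?R * sub 1 a ?T + ?T * sub 1 a ?R + ?R * sub 1 a ?R"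
    by (simp only: s.add ring_distribs add.assoc)
  finally show ?thesis
    using R n T0 sub_low[where b = 1 and n = n and A = ?R and a = a] mult_low_left[of n ?R "sub 1 a ?T"] mult_low_right[of n "sub 1 a ?R" ?T]
      mult_low_left[of n ?R "sub 1 a ?R"]
    by (simp add: sc_one)
qed

function ysol :: "complex \<Rightarrow> 'a::calg fps \<Rightarrow> nat \<Rightarrow> 'a" where
  "ysol a z n = (if n = 0 then 1 else
     (\<lambda>T. sc (1 / 2) * (fps_nth z n - fps_nth (T * sub 1 a T) n)) (Abs_fps (\<lambda>k. if k < n then ysol a z k else 0)))"
  by auto
termination by (relation "measure (\<lambda>(a, z, n). n)") auto

declare ysol.simps [simp del]

lemma half_half: "sc (1/2) * x + sc (1/2) * x = (x :: 'a::calg)"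
  by (simp add: distrib_right[symmetric] sc_add[symmetric] sc_one)

lemma ex_shift_root:
  fixes z :: "'a::calg fps"
  assumes "fps_nth z 0 = 1"
  shows "\<exists>y. fps_nth y 0 = 1 \<and> y * sub 1 a y = z"
proof (intro exI conjI)
  let ?y = "Abs_fps (ysol a z)"
  show y0: "fps_nth ?y 0 = 1" by (simp add: ysol.simps)
  show "?y * sub 1 a ?y = z"
  proof (rule fps_ext)
    fix n show "fps_nth (?y * sub 1 a ?y) n = fps_nth z n"
    proof (cases "n = 0")
      case False
      have "ysol a z n = sc (1/2) * (fps_nth z n - fps_nth (trunc n ?y * sub 1 a (trunc n ?y)) n)"
        using False by (subst ysol.simps) (simp add: trunc_def cong: if_cong)
      then have "fps_nth ?y n + fps_nth ?y n = fps_nth z n - fps_nth (trunc n ?y * sub 1 a (trunc n ?y)) n"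
        by (simp only: fps_nth_Abs_fps half_half)
      then show ?thesis using shift_product_nth[OF y0, of n a] False by simp
    qed (use y0 assms in simp)
  qed
qed

lemma half_cancel: "x + x = y + y \<Longrightarrow> x = (y :: 'a::calg)"
  using half_half[of x] half_half[of y] by (metis distrib_left)

lemma shift_root_unique:
  fixes y y' :: "'a::calg fps"
  assumes "fps_nth y 0 = 1" "fps_nth y' 0 = 1" "y * sub 1 a y = y' * sub 1 a y'"
  shows "y = y'"
proof (rule fps_ext)
  fix n show "fps_nth y n = fps_nth y' n"
  proof (induction n rule: less_induct)
    case (less n)
    show ?case
    proof (cases "n = 0")
      case False
      have "trunc n y = trunc n y'" using less by (simp add: trunc_def fps_eq_iff)
      then show ?thesis
        using shift_product_nth[OF assms(1), of n a] shift_product_nth[OF assms(2), of n a] False assms(3)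
        by (auto intro: half_cancel)
    qed (use assms in simp)
  qed
qed

text \<open>Applied to the centre, this makes the coefficients of \<open>y\<close> central.\<close>

lemma shift_root_in:
  fixes y :: "'a::calg fps"
  assumes "fps_nth y 0 = 1" "nsubalg V" "1 \<in> V" "\<And>n. fps_nth (y * sub 1 a y) n \<in> V"
  shows "fps_nth y n \<in> V"
proof (induction n rule: less_induct)
  case (less n)
  show ?case
  proof (cases "n = 0")
    case False
    have "fps_nth (trunc n y) k \<in> V" for k
      using less nsubalgD(1)[OF assms(2)] by (simp add: trunc_def)
    then have "fps_nth (trunc n y * sub 1 a (trunc n y)) n \<in> V"
      by (intro fps_mult_in sub_in assms(2))
    then have "fps_nth (y * sub 1 a y) n - fps_nth (trunc n y * sub 1 a (trunc n y)) n \<in> V"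
      by (intro nsubalgD(6)[OF assms(2)] assms(4))
    then have "fps_nth y n + fps_nth y n \<in> V"
      using shift_product_nth[OF assms(1), of n a] False by simp
    then have "sc (1/2) * (fps_nth y n + fps_nth y n) \<in> V" by (rule nsubalgD(4)[OF assms(2)])
    then show ?thesis by (simp add: distrib_left half_half)
  qed (use assms in simp)
qed

text \<open>The \<open>n\<close>-th coefficient of \<open>q\<close> enters that of \<open>q(u) q(- u)\<close> as \<open>(1 + (-1)\<^sup>n) q\<^sub>n\<close> and that of
  \<open>q(a - u)\<close> as \<open>(-1)\<^sup>n q\<^sub>n\<close>. So an even coefficient is determined by the product and an odd one by the
  symmetry, in terms of lower ones. As all constant terms cancel, the result holds in nonunital
  subalgebras too, which is needed for the ideal generated by the coefficients of \<open>w - 1\<close>.\<close>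

lemma even_symmetric_in:
  fixes q :: "'a::calg fps"
  assumes q0: "fps_nth q 0 = 1" and V: "nsubalg V"
    and sym: "sub (-1) a q = q"
    and w: "\<And>n. n > 0 \<Longrightarrow> fps_nth (q * sub (-1) 0 q) n \<in> V"
  shows "n > 0 \<Longrightarrow> fps_nth q n \<in> V"
proof (induction n rule: less_induct)
  case (less n)
  interpret s: ring_morph "sub (-1) b :: 'a fps \<Rightarrow> 'a fps" for b by (rule ring_morph_sub) simp
  define T where "T = trunc n q - 1"
  define R where "R = q - trunc n q"
  have q: "q = 1 + T + R" by (simp add: T_def R_def)
  have R: "\<And>k. k < n \<Longrightarrow> fps_nth R k = 0" "fps_nth R n = fps_nth q n" by (simp_all add: trunc_def R_def)
  have T: "fps_nth T k \<in> V" for k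
    using less q0 nsubalgD(1)[OF V] by (cases "k = 0") (auto simp: T_def trunc_def)
  have Tn: "fps_nth T 0 = 0" "fps_nth T n = 0" using q0 less.prems by (auto simp: T_def trunc_def)
  have "fps_nth q n + fps_nth q n \<in> V"
  proof (cases "even n")
    case True
    have "q * sub (-1) 0 q = 1 + T + R + (1 + T + R) * sub (-1) 0 T + (1 + T + R) * sub (-1) 0 R"
      by (subst (1 2) q) (simp only: s.add s.one ring_distribs mult_1_right)
    also have "\<dots> = 1 + T + R + sub (-1) 0 T + T * sub (-1) 0 T + R * sub (-1) 0 T + (1 + T + R) * sub (-1) 0 R"
      by (simp only: ring_distribs mult_1_left add.assoc)
    finally have qq: "q * sub (-1) 0 q = \<dots>" .
    have "fps_nth (q * sub (-1) 0 q) n = fps_nth q n + fps_nth (sub (-1) 0 T) n + fps_nth (T * sub (-1) 0 T) n + fps_nth q n"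
    proof -
      have sR: "fps_nth (sub (-1) 0 R) k = 0" if "k < n" for k
        using sub_low(1)[where b = "-1" and n = n and A = R and a = 0] R(1) that by simp
      have "fps_nth (sub (-1) 0 R) n = fps_nth q n"
        using sub_low(2)[where b = "-1" and n = n and A = R and a = 0] R True by (simp add: sc_one)
      moreover have "fps_nth (R * sub (-1) 0 T) n = 0"
        using mult_low_left[of n R "sub (-1) 0 T"] R(1) Tn by simp
      moreover have "fps_nth ((1 + T + R) * sub (-1) 0 R) n = fps_nth (sub (-1) 0 R) n"
        using mult_low_right[of n "sub (-1) 0 R" "1 + T + R"] sR R(1)[of 0] Tn less.prems by simp
      ultimately show ?thesis
        using qq R(2) Tn less.prems by simp
    qed
    then have "fps_nth q n + fps_nth q n = fps_nth (q * sub (-1) 0 q) n - fps_nth (sub (-1) 0 T) n - fps_nth (T * sub (-1) 0 T) n"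
      by simp
    also have "\<dots> \<in> V"
      by (intro nsubalgD(6)[OF V] w less.prems sub_in V T fps_mult_in)
    finally show ?thesis .
  next
    case False
    have "fps_nth (sub (-1) a q) n = fps_nth (1 + sub (-1) a T + sub (-1) a R) n"
      by (subst q) (simp only: s.add s.one)
    then have "fps_nth q n = fps_nth (sub (-1) a T) n - fps_nth q n"
      using sym R less.prems False
        sub_low(2)[where b = "-1" and n = n and A = R and a = a]
      by (simp add: sc_one sc.uminus)
    then have "fps_nth q n + fps_nth q n = fps_nth (sub (-1) a T) n" by (simp add: eq_diff_eq)
    then show ?thesis using sub_in[OF V T] by simp
  qed
  then have "sc (1/2) * (fps_nth q n + fps_nth q n) \<in> V" by (rule nsubalgD(4)[OF V])
  then show ?case by (simp add: distrib_left half_half)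
qed

section \<open>The central series and the endomorphisms given by scalar series\<close>

abbreviation I0 :: "int set" where "I0 \<equiv> idx g0"
abbreviation k0 :: complex where "k0 \<equiv> kappa g0"

lemma g0_valid: "lie_valid g0" using g0_properties by blast

lemma sub_tr: 
  assumes "b \<noteq> 0" shows "tr g (\<lambda>i j. sub b a (t i j)) i j = sub b a (tr g t i j)"
  by (simp add: tr_def ring_morph.mult[OF ring_morph_sub[OF assms]] sub_const[OF assms])

lemma tr_scale: "central c \<Longrightarrow> tr g (\<lambda>i j. c * t i j) i j = c * tr g t i j"
  by (simp add: tr_def central_left_commute)

lemma fmap_tr:
  assumes "ring_morph h" "\<And>c. h (sc c) = sc c"
  shows "fmap h (tr g t i j) = tr g (\<lambda>i j. fmap h (t i j)) i j"
proof -
  interpret ring_morph h by fact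
  interpret f: ring_morph "fmap h" by (rule ring_morph_fmap) fact
  show ?thesis by (simp add: tr_def f.mult fmap_const zero assms(2))
qed

definition zz :: "yang fps" where
  "zz = mm I0 (tr g0 (\<lambda>i j. sub 1 k0 (tt i j))) tt 1 1"

lemma zz_both: 
  assumes "i \<in> I0" "j \<in> I0"
  shows "mm I0 (tr g0 (\<lambda>i j. sub 1 k0 (tt i j))) tt i j = (if i = j then zz else 0)"
    and "mm I0 tt (tr g0 (\<lambda>i j. sub 1 k0 (tt i j))) i j = (if i = j then zz else 0)"
proof -
  obtain z where z: "\<And>i j. i \<in> I0 \<Longrightarrow> j \<in> I0 \<Longrightarrow> mm I0 (tr g0 (\<lambda>i j. sub 1 k0 (tt i j))) tt i j = (if i = j then z else 0)
     \<and> mm I0 tt (tr g0 (\<lambda>i j. sub 1 k0 (tt i j))) i j = (if i = j then z else 0)"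
    using T_transpose_T_scalar[OF g0_valid rtt_tt] by blast
  have "zz = z" using z[OF one_in_idx one_in_idx] g0_valid by (simp add: zz_def)
  then show "mm I0 (tr g0 (\<lambda>i j. sub 1 k0 (tt i j))) tt i j = (if i = j then zz else 0)"
    and "mm I0 tt (tr g0 (\<lambda>i j. sub 1 k0 (tt i j))) i j = (if i = j then zz else 0)"
    using z[OF assms] by auto
qed

lemma central_zz: "central zz"
  by (intro central_fps central_if_commutes_tt T_transpose_T_commutes[OF g0_valid rtt_tt] zz_both(1))

lemma zz_0: "fps_nth zz 0 = 1"
proof -
  have 1: "1 \<in> I0" by (rule one_in_idx[OF g0_valid])
  have "fps_nth zz 0 = (\<Sum>k\<in>I0. if k = 1 then 1 else 0)"
    unfolding zz_def mm_def fps_sum_nth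
    using 1 eps_square[OF g0_valid, of "-1"] by (intro sum.cong) (auto simp: tr_def tt_0 theta_eps sc_one)
  then show ?thesis using 1 by simp
qed

definition yy :: "yang fps" where
  "yy = (SOME y. fps_nth y 0 = 1 \<and> y * sub 1 k0 y = zz)"

lemma yy: "fps_nth yy 0 = 1" "yy * sub 1 k0 yy = zz"
  using someI_ex[OF ex_shift_root[OF zz_0, of k0]] by (simp_all add: yy_def)

lemma central_yy: "central yy"
proof -
  have "fps_nth yy n \<in> {x. central x}" for n
    by (rule shift_root_in[OF yy(1) nsubalg_central, where a = k0])
       (use central_zz yy(2) central_fps_iff in auto)
  then show ?thesis by (simp add: central_fps_iff)
qed

definition yi :: "yang fps" where
  "yi = fps_right_inverse yy 1"

lemma yi: "yy * yi = 1" "yi * yy = 1"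
  unfolding yi_def using fps_right_inverse[of yy 1] fps_left_inverse'[of 1 yy 1] yy(1) by simp_all

lemma central_yi: "central yi"
  unfolding central_def
proof
  fix b
  have "yi * b = yi * (b * yy) * yi" by (simp add: mult.assoc yi)
  also have "b * yy = yy * b" by (rule centralD[OF central_yy, symmetric])
  also have "yi * (yy * b) * yi = b * yi" by (simp add: mult.assoc[symmetric] yi)
  finally show "yi * b = b * yi" .
qed

lemma yi_0: "fps_nth yi 0 = 1"
  using arg_cong[OF yi(2), of "\<lambda>F. fps_nth F 0"] yy(1) by simp

definition tau :: "int \<Rightarrow> int \<Rightarrow> yang fps" where
  "tau i j = yi * tt i j"

lemma tt_tau: "tt i j = yy * tau i j"
  by (simp add: tau_def mult.assoc[symmetric] yi)

lemma mm_identity_left: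
  assumes "finite I" "\<And>i j. i \<in> I \<Longrightarrow> j \<in> I \<Longrightarrow> E i j = (if i = j then 1 else 0)" "s \<in> I"
  shows "mm I E N s j = (N s j :: 'a::ring_1)"
proof -
  have "mm I E N s j = mm I (\<lambda>p q. if p = q then 1 else 0) N s j"
    by (rule mm_cong) (simp_all add: assms)
  then show ?thesis by (simp add: mm_delta_left[OF assms(1,3)])
qed

lemma mm_scaled:
  assumes "central c" "central d"
  shows "mm I (\<lambda>i j. c * M i j) (\<lambda>i j. d * N i j) i j = (c * d) * mm I M N i j"
  by (simp add: mm_scale_left mm_scale_right[OF assms(2)] mult.assoc)

interpretation sub1: ring_morph "sub 1 a :: 'a::calg fps \<Rightarrow> 'a fps" for a by (rule ring_morph_sub) simp
interpretation subm: ring_morph "sub (-1) a :: 'a::calg fps \<Rightarrow> 'a fps" for a by (rule ring_morph_sub) simp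

lemma tau_orthogonal:
  assumes "i \<in> I0" "j \<in> I0"
  shows "mm I0 (tr g0 (\<lambda>i j. sub 1 k0 (tau i j))) tau i j = of_bool (i = j)"
    and "mm I0 tau (tr g0 (\<lambda>i j. sub 1 k0 (tau i j))) i j = of_bool (i = j)"
proof -
  have c: "central (sub 1 k0 yi)" by (rule central_sub[OF central_yi])
  have t: "tr g0 (\<lambda>i j. sub 1 k0 (tau i j)) = (\<lambda>i j. sub 1 k0 yi * tr g0 (\<lambda>i j. sub 1 k0 (tt i j)) i j)"
    by (intro ext) (simp add: tau_def sub1.mult tr_scale[OF c])
  have t2: "tau = (\<lambda>i j. yi * tt i j)" by (intro ext) (simp add: tau_def)
  have "sub 1 k0 yi * sub 1 k0 yy = 1" by (simp add: sub1.mult[symmetric] yi sub1.one)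
  moreover have "sub 1 k0 yi * yi * zz = sub 1 k0 yi * (yi * yy) * sub 1 k0 yy"
    by (simp only: yy(2)[symmetric] mult.assoc)
  ultimately have u: "sub 1 k0 yi * yi * zz = 1" by (simp add: yi)
  then have u': "yi * sub 1 k0 yi * zz = 1" by (simp only: centralD[OF central_yi, of "sub 1 k0 yi"])
  show "mm I0 (tr g0 (\<lambda>i j. sub 1 k0 (tau i j))) tau i j = of_bool (i = j)"
    unfolding t unfolding t2 unfolding mm_scaled[OF c central_yi] zz_both(1)[OF assms] using u by simp
  show "mm I0 tau (tr g0 (\<lambda>i j. sub 1 k0 (tau i j))) i j = of_bool (i = j)"
    unfolding t unfolding t2 unfolding mm_scaled[OF central_yi c] zz_both(2)[OF assms] using u' by simp
qed

text \<open>Both sides of the RTT relation contain each of \<open>T\<^sub>1(u)\<close> and \<open>T\<^sub>2(v)\<close> exactly once, so both get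
  multiplied by \<open>c(u) c(v)\<close>.\<close>

lemma rtt_gauge:
  fixes c :: "'a::calg fps"
  assumes c: "central c" and t: "rtt g t"
  shows "rtt g (\<lambda>i j. c * t i j)"
proof -
  let ?II = "idx g \<times> idx g"
  interpret cu: ring_morph "fmap fps_const :: 'a fps \<Rightarrow> _" by (rule ring_morph_fmap[OF ring_morph_fps_const])
  interpret cv: ring_morph "fps_const :: 'a fps \<Rightarrow> _" by (rule ring_morph_fps_const)
  have cu: "central (fmap fps_const c)" using c by (intro central_fps) (simp add: central_const central_fps_iff[of c])
  have cv: "central (fps_const c)" by (rule central_const[OF c])
  have 1: "T1 (ser_u (\<lambda>i j. c * t i j)) = (\<lambda>p q. fmap fps_const c * T1 (ser_u t) p q)"
    by (auto simp: T1_def fun_eq_iff cu.mult)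
  have 2: "T2 (ser_v (\<lambda>i j. c * t i j)) = (\<lambda>p q. fps_const c * T2 (ser_v t) p q)"
    by (auto simp: T2_def fun_eq_iff cv.mult[symmetric])
  have "fmap fps_const c * fps_const c = fps_const c * fmap fps_const c" by (rule centralD[OF cu])
  then show ?thesis
    using t unfolding rtt_def 1 2 mm_scale_left mm_scale_right[OF cu] mm_scale_right[OF cv]
    by (simp add: mult.assoc[symmetric])
qed

text \<open>The endomorphism \<open>T \<mapsto> f \<tau>\<close> of the extended Yangian; it exists since \<open>f \<tau> = (f / y) T\<close> satisfies
  the RTT relation.\<close>

definition retr :: "complex fps \<Rightarrow> yang \<Rightarrow> yang" where
  "retr f = ind (\<lambda>i j. scf f * tau i j)"

locale unit_series =
  fixes f :: "complex fps"
  assumes f0: "fps_nth f 0 = 1"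
begin

lemma rtt_scaled: "rtt g0 (\<lambda>i j. scf f * tau i j)"
proof -
  have "rtt g0 (\<lambda>i j. (scf f * yi) * tt i j)"
    by (intro rtt_gauge central_mult central_yi rtt_tt) simp
  then show ?thesis by (simp add: tau_def mult.assoc)
qed

lemma scaled_0: "i \<in> I0 \<Longrightarrow> j \<in> I0 \<Longrightarrow> fps_nth (scf f * tau i j) 0 = of_bool (i = j)"
  by (simp add: f0 tau_def yi_0 tt_0 sc_one)

sublocale retr: ring_morph "retr f"
  unfolding retr_def by (rule ring_morph_ind[OF rtt_scaled scaled_0])

sublocale retrf: ring_morph "fmap (retr f)"
  by (rule ring_morph_fmap[OF retr.ring_morph_axioms])

lemma retr_sc: "retr f (sc c) = sc c"
  unfolding retr_def by (rule ind_sc[OF rtt_scaled scaled_0])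

lemma retr_tt: "i \<in> I0 \<Longrightarrow> j \<in> I0 \<Longrightarrow> fmap (retr f) (tt i j) = scf f * tau i j"
  unfolding retr_def by (rule fps_ext) (simp add: ind_tt[OF rtt_scaled scaled_0])

lemma retr_sub: "fmap (retr f) (sub b a F) = sub b a (fmap (retr f) F)"
  by (rule sub_morph[OF retr.ring_morph_axioms retr_sc])

text \<open>The image of \<open>y\<close> solves the equation \<open>h(u) h(u + \<kappa>) = f(u) f(u + \<kappa>)\<close>, since \<open>\<tau>\<close> is orthogonal;
  the solution with constant term 1 is unique.\<close>

lemma retr_yy: "fmap (retr f) yy = scf f"
proof (rule shift_root_unique[where a = k0])
  show "fps_nth (fmap (retr f) yy) 0 = 1" by (simp add: yy retr.one)
  show "fps_nth (scf f) 0 = (1 :: yang)" by (simp add: f0 sc_one)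
  have 1: "1 \<in> I0" by (rule one_in_idx[OF g0_valid])
  let ?c = "sub 1 k0 (scf f) :: yang fps"
  have cc: "central ?c" by (rule central_sub) simp
  have "fmap (retr f) yy * sub 1 k0 (fmap (retr f) yy) = fmap (retr f) zz"
    by (simp add: yy(2)[symmetric] retrf.mult retr_sub)
  also have "\<dots> = mm I0 (\<lambda>i j. tr g0 (\<lambda>i j. sub 1 k0 (fmap (retr f) (tt i j))) i j) (\<lambda>i j. fmap (retr f) (tt i j)) 1 1"
    unfolding zz_def retrf.mm fmap_tr[OF retr.ring_morph_axioms retr_sc] retr_sub ..
  also have "\<dots> = mm I0 (\<lambda>i j. ?c * tr g0 (\<lambda>i j. sub 1 k0 (tau i j)) i j) (\<lambda>i j. scf f * tau i j) 1 1"
    by (rule mm_cong) (auto simp: tr_def retr_tt 1 sub1.mult central_left_commute[OF cc])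
  also have "\<dots> = ?c * scf f"
    unfolding mm_scaled[OF cc central_scf] tau_orthogonal(1)[OF 1 1] by simp
  also have "\<dots> = scf f * sub 1 k0 (scf f)" by (rule centralD[OF cc])
  finally show "fmap (retr f) yy * sub 1 k0 (fmap (retr f) yy) = scf f * sub 1 k0 (scf f)" .
qed

lemma retr_tau: "i \<in> I0 \<Longrightarrow> j \<in> I0 \<Longrightarrow> fmap (retr f) (tau i j) = tau i j"
proof -
  assume ij: "i \<in> I0" "j \<in> I0"
  have "fmap (retr f) yi * scf f = 1"
    using retrf.mult[of yi yy] by (simp add: yi retr_yy retrf.one)
  then show ?thesis by (simp add: tau_def[of i j] retrf.mult retr_tt ij) (simp add: tau_def mult.assoc[symmetric])
qed

end

section \<open>The twisted matrices\<close>

definition tw :: "(int \<Rightarrow> int \<Rightarrow> complex fps) \<Rightarrow> (int \<Rightarrow> int \<Rightarrow> yang fps) \<Rightarrow> int \<Rightarrow> int \<Rightarrow> yang fps" where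
  "tw G M = mm I0 (mm I0 (\<lambda>i j. sub 1 (- k0 / 2) (M i j)) (\<lambda>i j. scf (G i j))) (\<lambda>i j. sub (-1) (k0 / 2) (tr g0 M i j))"

locale pair =
  fixes ty :: pair_type
  assumes sp: "symmetric_pair g0 ty"
begin

definition SX :: "int \<Rightarrow> int \<Rightarrow> yang fps" where "SX = tw (Gc g0 ty) tt"
definition SY :: "int \<Rightarrow> int \<Rightarrow> yang fps" where "SY = tw (Gc g0 ty) tau"
definition qq :: "yang fps" where "qq = sub 1 (- k0 / 2) yy * sub (-1) (k0 / 2) yy"
definition ww :: "yang fps" where "ww = qq * sub (-1) 0 qq"

lemma central_qq: "central qq"
  unfolding qq_def by (intro central_mult central_sub central_yy)

lemma qq_0: "fps_nth qq 0 = 1"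
  by (simp add: qq_def yy)

lemma qq_sym: "sub (-1) k0 qq = qq"
proof -
  have "sub (-1) k0 qq = sub (-1) (k0 / 2) yy * sub 1 (- k0 / 2) yy"
    by (simp add: qq_def subm.mult sub_sub)
  also have "\<dots> = qq" unfolding qq_def by (rule centralD[OF central_sub[OF central_yy]])
  finally show ?thesis .
qed

lemma SX_SY: "SX i j = qq * SY i j"
proof -
  let ?a = "sub 1 (- k0 / 2) yy" and ?b = "sub (-1) (k0 / 2) yy"
  have b: "central ?b" by (rule central_sub[OF central_yy])
  have 1: "(\<lambda>i j. sub 1 (- k0 / 2) (tt i j)) = (\<lambda>i j. ?a * sub 1 (- k0 / 2) (tau i j))"
    by (simp add: tt_tau sub1.mult)
  have tt: "tt = (\<lambda>i j. yy * tau i j)" by (intro ext) (rule tt_tau)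
  have "tr g0 tt i j = yy * tr g0 tau i j" for i j
    by (subst tt) (rule tr_scale[OF central_yy])
  then have 2: "(\<lambda>i j. sub (-1) (k0 / 2) (tr g0 tt i j)) = (\<lambda>i j. ?b * sub (-1) (k0 / 2) (tr g0 tau i j))"
    by (simp add: subm.mult)
  show ?thesis
    unfolding SX_def SY_def tw_def qq_def 1 2 mm_scale_left mm_scale_right[OF b]
    by (simp add: mult.assoc central_left_commute[OF b])
qed

text \<open>In \<open>\<Sigma>(u) \<Sigma>(- u)\<close> the factors \<open>\<tau>\<^sup>t(- u + \<kappa>/2)\<close> and \<open>\<tau>(- u - \<kappa>/2)\<close> meet and cancel by orthogonality, then
  \<open>G(u)\<close> and \<open>G(- u)\<close>, then the outer factors.\<close>

lemma SY_unitary: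
  assumes ij: "i \<in> I0" "j \<in> I0"
  shows "mm I0 SY (\<lambda>i j. sub (-1) 0 (SY i j)) i j = of_bool (i = j)"
proof -
  define A where "A = (\<lambda>i j. sub 1 (- k0 / 2) (tau i j))"
  define B where "B = (\<lambda>i j. sub (-1) (k0 / 2) (tr g0 tau i j))"
  define G where "G = (\<lambda>i j. scf (Gc g0 ty i j) :: yang fps)"
  define A' where "A' = (\<lambda>i j. sub (-1) (- k0 / 2) (tau i j))"
  define B' where "B' = (\<lambda>i j. sub 1 (k0 / 2) (tr g0 tau i j))"
  define G' where "G' = (\<lambda>i j. scf (sub (-1) 0 (Gc g0 ty i j)) :: yang fps)"
  let ?d = "\<lambda>i j. if i = j then 1 else 0 :: yang fps"
  have SY: "SY = mm I0 (mm I0 A G) B" by (simp add: SY_def tw_def A_def B_def G_def)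
  have t: "tr g0 (\<lambda>i j. sub 1 k0 (tau i j)) = (\<lambda>i j. sub 1 k0 (tr g0 tau i j))"
    by (intro ext sub_tr) simp
  have SY': "(\<lambda>i j. sub (-1) 0 (SY i j)) = mm I0 (mm I0 A' G') B'"
    unfolding SY A'_def G'_def B'_def subm.mm3
    by (simp add: A_def B_def G_def sub_sub sub_morph[OF sc.ring_morph_axioms] sc_complex_def)
  have BA: "mm I0 B A' i j = ?d i j" if "i \<in> I0" "j \<in> I0" for i j
  proof -
    have "mm I0 B A' i j = sub (-1) (- k0 / 2) (mm I0 (tr g0 (\<lambda>i j. sub 1 k0 (tau i j))) tau i j)"
      unfolding subm.mm t by (simp add: A'_def B_def sub_sub)
    then show ?thesis using that by (simp add: tau_orthogonal(1) subm.one subm.zero)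
  qed
  have AB: "mm I0 A B' i j = ?d i j" if "i \<in> I0" "j \<in> I0" for i j
  proof -
    have "mm I0 A B' i j = sub 1 (- k0 / 2) (mm I0 tau (tr g0 (\<lambda>i j. sub 1 k0 (tau i j))) i j)"
      unfolding sub1.mm t by (simp add: A_def B'_def sub_sub)
    then show ?thesis using that by (simp add: tau_orthogonal(2) sub1.one sub1.zero)
  qed
  have GG: "mm I0 G G' i j = ?d i j" if "i \<in> I0" "j \<in> I0" for i j
  proof -
    have "mm I0 G G' i j = scf (\<Sum>k\<in>I0. Gc g0 ty i k * sub (-1) 0 (Gc g0 ty k j))"
      by (simp add: mm_def G_def G'_def scf.sum scf.mult)
    then show ?thesis using that Gc_inverse[OF sp] by (simp add: scf.one scf.zero)
  qed
  have fin: "finite I0" by simp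
  have "mm I0 SY (\<lambda>i j. sub (-1) 0 (SY i j)) i j = mm I0 (mm I0 A G) (mm I0 (mm I0 B A') (mm I0 G' B')) i j"
    unfolding SY' unfolding SY by (simp only: mm_assoc)
  also have "\<dots> = mm I0 (mm I0 A G) (mm I0 G' B') i j"
    by (rule mm_cong_right) (rule mm_identity_left[OF fin BA])
  also have "\<dots> = mm I0 A (mm I0 (mm I0 G G') B') i j"
    by (simp only: mm_assoc)
  also have "\<dots> = mm I0 A B' i j"
    by (rule mm_cong_right) (rule mm_identity_left[OF fin GG])
  finally show ?thesis using AB[OF ij] by (simp add: of_bool_def)
qed

lemma SX_SX:
  assumes ij: "i \<in> I0" "j \<in> I0"
  shows "mm I0 SX (\<lambda>i j. sub (-1) 0 (SX i j)) i j = (if i = j then ww else 0)"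
proof -
  have c: "central (sub (-1) 0 qq)" by (rule central_sub[OF central_qq])
  have 1: "SX = (\<lambda>i j. qq * SY i j)" by (intro ext) (rule SX_SY)
  have 2: "(\<lambda>i j. sub (-1) 0 (SX i j)) = (\<lambda>i j. sub (-1) 0 qq * sub (-1) 0 (SY i j))"
    by (simp add: SX_SY subm.mult)
  show ?thesis
    unfolding 2 unfolding 1 mm_scaled[OF central_qq c] SY_unitary[OF ij] ww_def by simp
qed

lemma central_ww: "central ww"
  unfolding ww_def by (intro central_mult central_qq central_sub)

definition CX :: "yang set" where "CX = {fps_nth (SX i j) r | i j r. i \<in> I0 \<and> j \<in> I0}"
definition CY :: "yang set" where "CY = {fps_nth (SY i j) r | i j r. i \<in> I0 \<and> j \<in> I0}"
definition CW :: "yang set" where "CW = range (fps_nth ww)"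

lemma SX_in: "i \<in> I0 \<Longrightarrow> j \<in> I0 \<Longrightarrow> fps_nth (SX i j) n \<in> alg CX"
  by (rule alg.base) (auto simp: CX_def)
lemma SY_in: "i \<in> I0 \<Longrightarrow> j \<in> I0 \<Longrightarrow> fps_nth (SY i j) n \<in> alg CY"
  by (rule alg.base) (auto simp: CY_def)

lemma CW_CX: "CW \<subseteq> alg CX"
proof -
  have 1: "1 \<in> I0" by (rule one_in_idx[OF g0_valid])
  have "fps_nth ww n \<in> alg CX" for n
  proof -
    have "ww = mm I0 SX (\<lambda>i j. sub (-1) 0 (SX i j)) 1 1" using SX_SX[OF 1 1] by simp
    then have "fps_nth ww n = fps_nth (mm I0 SX (\<lambda>i j. sub (-1) 0 (SX i j)) 1 1) n" by (rule arg_cong)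
    also have "\<dots> = (\<Sum>k\<in>I0. fps_nth (SX 1 k * sub (-1) 0 (SX k 1)) n)"
      by (simp add: mm_def fps_sum_nth)
    also have "\<dots> \<in> alg CX"
    proof (rule nsubalgD(7)[OF nsubalg_alg])
      fix k assume "k \<in> I0"
      then show "fps_nth (SX 1 k * sub (-1) 0 (SX k 1)) n \<in> alg CX"
        by (intro fps_mult_in[OF nsubalg_alg] sub_in[OF nsubalg_alg] SX_in 1)
    qed
    finally show ?thesis .
  qed
  then show ?thesis by (auto simp: CW_def)
qed

lemma qq_in: 
  assumes "nsubalg V" "\<And>n. n > 0 \<Longrightarrow> fps_nth ww n \<in> V"
  shows "n > 0 \<Longrightarrow> fps_nth qq n \<in> V"
  by (rule even_symmetric_in[OF qq_0 assms(1) qq_sym]) (use assms(2) in \<open>auto simp: ww_def\<close>)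

lemma qq_in_CW: "fps_nth qq n \<in> alg CW"
proof (cases "n = 0")
  case False
  show ?thesis by (rule qq_in[OF nsubalg_alg]) (use False in \<open>auto intro: alg.base simp: CW_def\<close>)
qed (simp add: qq_0 alg.one)

lemma SY_recursion: "fps_nth (SX i j) n = fps_nth (SY i j) n + (\<Sum>k=1..n. fps_nth qq k * fps_nth (SY i j) (n - k))"
  by (simp add: SX_SY fps_mult_nth sum.atLeast_Suc_atMost qq_0)

lemma CY_CX: "CY \<subseteq> alg CX"
proof -
  have "fps_nth (SY i j) n \<in> alg CX" if "i \<in> I0" "j \<in> I0" for i j n
  proof (induction n rule: less_induct)
    case (less n)
    have "fps_nth (SY i j) n = fps_nth (SX i j) n - (\<Sum>k=1..n. fps_nth qq k * fps_nth (SY i j) (n - k))"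
      using SY_recursion[of i j n] by simp
    also have "\<dots> \<in> alg CX"
      using less qq_in_CW alg_mono_alg[OF CW_CX]
      by (intro nsubalgD(6)[OF nsubalg_alg] nsubalgD(7)[OF nsubalg_alg] nsubalgD(3)[OF nsubalg_alg] SX_in that) auto
    finally show ?case .
  qed
  then show ?thesis by (auto simp: CY_def)
qed

lemma retr_tw: 
  assumes "unit_series f"
    and M: "\<And>i j. i \<in> I0 \<Longrightarrow> j \<in> I0 \<Longrightarrow> fmap (retr f) (M i j) = M' i j" and ij: "i \<in> I0" "j \<in> I0"
  shows "fmap (retr f) (tw G M i j) = tw G M' i j"
proof -
  interpret unit_series f by fact
  have G: "fmap (retr f) (scf (G i j)) = scf (G i j)" for i j by (simp add: fps_eq_iff retr_sc)
  have 1: "mm I0 (\<lambda>i j. sub 1 (- k0 / 2) (fmap (retr f) (M i j))) (\<lambda>i j. scf (G i j)) i s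
    = mm I0 (\<lambda>i j. sub 1 (- k0 / 2) (M' i j)) (\<lambda>i j. scf (G i j)) i s" for s
    by (rule mm_cong) (simp_all add: M ij)
  show ?thesis
    unfolding tw_def retrf.mm3 retr_sub fmap_tr[OF retr.ring_morph_axioms retr_sc] G
    by (rule mm_cong) (simp_all only: 1, simp add: tr_def M ij)
qed

lemma retr_SY: "unit_series f \<Longrightarrow> i \<in> I0 \<Longrightarrow> j \<in> I0 \<Longrightarrow> fmap (retr f) (SY i j) = SY i j"
  unfolding SY_def by (rule retr_tw) (auto intro: unit_series.retr_tau)

lemma retr_on_Y: 
  assumes "unit_series f" "x \<in> alg CY" shows "retr f x = x"
proof -
  interpret unit_series f by fact
  show ?thesis using assms(2)
  proof (induction)
    case (base x)
    then obtain i j r where x: "x = fps_nth (SY i j) r" "i \<in> I0" "j \<in> I0" by (auto simp: CY_def)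
    then show ?case using arg_cong[OF retr_SY[OF assms(1) x(2,3)], of "\<lambda>F. fps_nth F r"] by simp
  qed (simp_all add: retr.simps retr_sc)
qed

lemma unit_series_1: "unit_series 1" by unfold_locales simp

lemma retr_1_SX: "i \<in> I0 \<Longrightarrow> j \<in> I0 \<Longrightarrow> fmap (retr 1) (SX i j) = SY i j"
  unfolding SX_def SY_def by (rule retr_tw[OF unit_series_1]) (simp_all add: unit_series.retr_tt[OF unit_series_1] scf.one)

lemma retr_1_X: assumes "x \<in> alg CX" shows "retr 1 x \<in> alg CY"
proof -
  interpret unit_series 1 by (rule unit_series_1)
  show ?thesis using assms
  proof induction
    case (base x)
    then obtain i j r where x: "x = fps_nth (SX i j) r" "i \<in> I0" "j \<in> I0" by (auto simp: CX_def)
    then show ?case using arg_cong[OF retr_1_SX[OF x(2,3)], of "\<lambda>F. fps_nth F r"] SY_in[OF x(2,3), of r] by simp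
  qed (auto simp: retr.simps retr_sc intro: alg.intros)
qed

lemma retr_qq: 
  assumes "unit_series f"
  shows "fmap (retr f) qq = scf (sub 1 (- k0 / 2) f * sub (-1) (k0 / 2) f)"
proof -
  interpret unit_series f by fact
  show ?thesis
    by (simp add: qq_def retrf.mult retr_sub retr_yy scf.mult sub_morph[OF sc.ring_morph_axioms] sc_complex_def)
qed

lemma retr_1_ww: "fmap (retr 1) ww = 1"
proof -
  interpret unit_series 1 by (rule unit_series_1)
  show ?thesis by (simp add: ww_def retrf.mult retr_sub retr_qq[OF unit_series_1] sub1.one subm.one scf.one)
qed

text \<open>On generators, \<open>S - \<Sigma> = (q - 1) \<Sigma>\<close>, and the coefficients of \<open>q - 1\<close> lie in every ideal that contains the
  coefficients of \<open>w - 1\<close>. Products are reduced to their factors by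
  \<open>x y - x' y' = (x - x') y + x' (y - y')\<close>.\<close>

lemma minus_retr_in_ideal:
  assumes J: "nsubalg J" "\<And>a x. a \<in> alg CX \<Longrightarrow> x \<in> J \<Longrightarrow> a * x \<in> J \<and> x * a \<in> J"
    and w: "\<And>n. n > 0 \<Longrightarrow> fps_nth ww n \<in> J" and x: "x \<in> alg CX"
  shows "x - retr 1 x \<in> J"
proof -
  interpret unit_series 1 by (rule unit_series_1)
  show ?thesis using x
  proof induction
    case (base x)
    then obtain i j r where x: "x = fps_nth (SX i j) r" "i \<in> I0" "j \<in> I0" by (auto simp: CX_def)
    have p: "retr 1 x = fps_nth (SY i j) r"
      using arg_cong[OF retr_1_SX[OF x(2,3)], of "\<lambda>F. fps_nth F r"] x by simp
    have "x - retr 1 x = (\<Sum>k=1..r. fps_nth qq k * fps_nth (SY i j) (r - k))"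
      unfolding p unfolding x(1) using SY_recursion[of i j r] by simp
    also have "\<dots> \<in> J"
    proof (rule nsubalgD(7)[OF J(1)])
      fix k assume "k \<in> {1..r}"
      then have "fps_nth qq k \<in> J" using qq_in[OF J(1) w, of k] by auto
      moreover have "fps_nth (SY i j) (r - k) \<in> alg CX"
        using SY_in[OF x(2,3)] alg_mono_alg[OF CY_CX] by blast
      ultimately show "fps_nth qq k * fps_nth (SY i j) (r - k) \<in> J" using J(2) by blast
    qed
    finally show ?case .
  next
    case one
    then show ?case using nsubalgD(1)[OF J(1)] by (simp add: retr.one)
  next
    case (add x y)
    have eq: "x + y - retr 1 (x + y) = (x - retr 1 x) + (y - retr 1 y)" by (simp add: retr.add)
    show ?case unfolding eq by (rule nsubalgD(2)[OF J(1) add.IH])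
  next
    case (mult x y)
    have eq: "x * y - retr 1 (x * y) = (x - retr 1 x) * y + retr 1 x * (y - retr 1 y)" by (simp add: retr.mult algebra_simps)
    have "retr 1 x \<in> alg CX" using retr_1_X[OF mult.hyps(1)] alg_mono_alg[OF CY_CX] by blast
    then show ?case
      unfolding eq using J(2)[OF mult.hyps(2) mult.IH(1)] J(2)[OF _ mult.IH(2)] by (intro nsubalgD(2)[OF J(1)]) auto
  next
    case (scale x c)
    have eq: "sc c * x - retr 1 (sc c * x) = sc c * (x - retr 1 x)" by (simp add: retr.mult retr_sc algebra_simps)
    show ?case unfolding eq by (rule nsubalgD(4)[OF J(1) scale.IH])
  qed
qed

end

section \<open>Separation of central elements by characters\<close>

text \<open>The algebra generated by the first \<open>n\<close> coefficients of \<open>y\<close>; the zeroth one is 1.\<close>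

definition Zk :: "nat \<Rightarrow> yang set" where "Zk n = alg {fps_nth yy m | m. m < n}"

lemma Zk_scalar:
  assumes "unit_series f" "x \<in> Zk n" shows "\<exists>c. retr f x = sc c"
proof -
  interpret unit_series f by fact
  show ?thesis using assms(2) unfolding Zk_def
  proof induction
    case (base x)
    then obtain m where "x = fps_nth yy m" by auto
    then have "retr f x = sc (fps_nth f m)" using arg_cong[OF retr_yy, of "\<lambda>F. fps_nth F m"] by simp
    then show ?case by blast
  next
    case one
    show ?case by (rule exI[of _ 1]) (simp only: retr.one sc_one)
  next
    case (add x y)
    then obtain c d where "retr f x = sc c" "retr f y = sc d" by blast
    then have "retr f (x + y) = sc (c + d)" by (simp only: retr.add sc_add)
    then show ?case by blast
  next
    case (mult x y)
    then obtain c d where "retr f x = sc c" "retr f y = sc d" by blast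
    then have "retr f (x * y) = sc (c * d)" by (simp only: retr.mult sc_mult)
    then show ?case by blast
  next
    case (scale x e)
    then obtain c where "retr f x = sc c" by blast
    then have "retr f (sc e * x) = sc (e * c)" by (simp only: retr.mult sc_mult retr_sc)
    then show ?case by blast
  qed
qed

lemma Zk_dependence:
  assumes "unit_series f" "unit_series f'" "\<And>m. m < n \<Longrightarrow> fps_nth f m = fps_nth f' m" "x \<in> Zk n"
  shows "retr f x = retr f' x"
proof -
  interpret f: unit_series f by fact
  interpret f': unit_series f' by fact
  show ?thesis using assms(4) unfolding Zk_def
  proof induction
    case (base x)
    then obtain m where m: "x = fps_nth yy m" "m < n" by auto
    then show ?case
      using arg_cong[OF f.retr_yy, of "\<lambda>F. fps_nth F m"] arg_cong[OF f'.retr_yy, of "\<lambda>F. fps_nth F m"] assms(3)[OF m(2)]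
      by simp
  qed (simp_all add: f.retr.simps f'.retr.simps f.retr_sc f'.retr_sc)
qed

lemma sum_closed:
  "0 \<in> P \<Longrightarrow> (\<And>x y. x \<in> P \<Longrightarrow> y \<in> P \<Longrightarrow> x + y \<in> P) \<Longrightarrow> (\<And>i. i \<in> A \<Longrightarrow> h i \<in> P) \<Longrightarrow> sum h A \<in> P"
  by (induction A rule: infinite_finite_induct) auto

lemma Zk_polynomial:
  assumes "x \<in> Zk (Suc n)"
  shows "\<exists>a d. (\<forall>j. a j \<in> Zk n) \<and> x = (\<Sum>j\<le>d. a j * fps_nth yy n ^ j)"
proof -
  let ?u = "fps_nth yy n"
  have cu: "central (?u ^ j)" for j
    using central_yy unfolding central_fps_iff by (induction j) (auto intro: central_mult)
  have nZ: "nsubalg (Zk n)" and Z1: "1 \<in> Zk n" unfolding Zk_def by (rule nsubalg_alg, rule alg.one)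
  define P where "P = {x. \<exists>a d. (\<forall>j. a j \<in> Zk n) \<and> x = (\<Sum>j\<le>d. a j * ?u ^ j)}"
  have PI: "(\<Sum>j\<le>d. a j * ?u ^ j) \<in> P" if "\<And>j. a j \<in> Zk n" for a d
    unfolding P_def by (rule CollectI, rule exI[of _ a], rule exI[of _ d]) (simp add: that)
  have PE: "\<exists>a d. (\<forall>j. a j \<in> Zk n) \<and> x = (\<Sum>j\<le>d. a j * ?u ^ j)" if "x \<in> P" for x
    using that unfolding P_def by (rule CollectD)
  have mono: "b * ?u ^ m \<in> P" if b: "b \<in> Zk n" for b m
  proof -
    have "(\<Sum>j\<le>m. (if j = m then b else 0) * ?u ^ j) = (\<Sum>j\<le>m. if j = m then b * ?u ^ m else 0)"
      by (intro sum.cong) auto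
    also have "\<dots> = b * ?u ^ m" by simp
    finally show ?thesis using PI[of "\<lambda>j. if j = m then b else 0" m] b nsubalgD(1)[OF nZ] by simp
  qed
  have padd: "x + y \<in> P" if xy: "x \<in> P" "y \<in> P" for x y
  proof -
    obtain a d where a: "\<forall>j. a j \<in> Zk n" "x = (\<Sum>j\<le>d. a j * ?u ^ j)" using PE[OF xy(1)] by blast
    obtain b e where b: "\<forall>j. b j \<in> Zk n" "y = (\<Sum>j\<le>e. b j * ?u ^ j)" using PE[OF xy(2)] by blast
    let ?a = "\<lambda>j. if j \<le> d then a j else 0" and ?b = "\<lambda>j. if j \<le> e then b j else 0" and ?m = "max d e"
    have "x = (\<Sum>j\<le>?m. ?a j * ?u ^ j)" unfolding a(2) by (intro sum.mono_neutral_cong_left) auto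
    moreover have "y = (\<Sum>j\<le>?m. ?b j * ?u ^ j)" unfolding b(2) by (intro sum.mono_neutral_cong_left) auto
    ultimately have "x + y = (\<Sum>j\<le>?m. (?a j + ?b j) * ?u ^ j)" by (simp only: distrib_right sum.distrib)
    moreover have "?a j + ?b j \<in> Zk n" for j
      by (intro nsubalgD(2)[OF nZ]) (use a(1) b(1) nsubalgD(1)[OF nZ] in simp_all)
    ultimately show ?thesis using PI[of "\<lambda>j. ?a j + ?b j" ?m] by simp
  qed
  have p0: "0 \<in> P" using mono[OF nsubalgD(1)[OF nZ], of 0] by simp
  have psum: "(\<And>i. i \<in> A \<Longrightarrow> h i \<in> P) \<Longrightarrow> sum h A \<in> P" for h :: "nat \<Rightarrow> yang" and A
    by (rule sum_closed[OF p0 padd])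
  have pmult: "x * y \<in> P" if xy: "x \<in> P" "y \<in> P" for x y
  proof -
    obtain a d where a: "\<forall>j. a j \<in> Zk n" "x = (\<Sum>j\<le>d. a j * ?u ^ j)" using PE[OF xy(1)] by blast
    obtain b e where b: "\<forall>j. b j \<in> Zk n" "y = (\<Sum>j\<le>e. b j * ?u ^ j)" using PE[OF xy(2)] by blast
    have "a i * ?u ^ i * (b j * ?u ^ j) = (a i * b j) * ?u ^ (i + j)" for i j
      by (simp only: mult.assoc power_add central_left_commute[OF cu[of i], of "b j", symmetric])
    then have "x * y = (\<Sum>i\<le>d. \<Sum>j\<le>e. (a i * b j) * ?u ^ (i + j))"
      by (simp only: a(2) b(2) sum_product)
    also have "\<dots> \<in> P"
      by (intro psum mono nsubalgD(3)[OF nZ]) (use a b in auto)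
    finally show ?thesis .
  qed
  have pscale: "sc c * x \<in> P" if x: "x \<in> P" for c x
  proof -
    obtain a d where a: "\<forall>j. a j \<in> Zk n" "x = (\<Sum>j\<le>d. a j * ?u ^ j)" using PE[OF x] by blast
    then have "sc c * x = (\<Sum>j\<le>d. (sc c * a j) * ?u ^ j)" by (simp add: sum_distrib_left mult.assoc)
    also have "\<dots> \<in> P" by (intro psum mono nsubalgD(4)[OF nZ]) (use a in auto)
    finally show ?thesis .
  qed
  have "nsubalg P" unfolding nsubalg_def by (intro conjI ballI allI p0 padd pmult pscale)
  moreover have "1 \<in> P" using mono[OF Z1, of 0] by simp
  moreover have "{fps_nth yy m | m. m < Suc n} \<subseteq> P"
  proof safe
    fix m assume "m < Suc n"
    show "fps_nth yy m \<in> P"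
    proof (cases "m = n")
      case True
      then show ?thesis using mono[OF Z1, of 1] by simp
    next
      case False
      then have "fps_nth yy m \<in> Zk n" using \<open>m < Suc n\<close> unfolding Zk_def by (intro alg.base) auto
      from mono[OF this, of 0] show ?thesis by simp
    qed
  qed
  ultimately have "alg {fps_nth yy m | m. m < Suc n} \<subseteq> P" by (rule alg_least)
  then show ?thesis using assms PE unfolding Zk_def[of "Suc n"] by blast
qed

text \<open>Induction on the number of generators. A new generator is an independent parameter of \<open>f\<close>: with the lower
  coefficients of \<open>f\<close> fixed, the value of \<open>retr f\<close> on a polynomial in the new generator is a
  polynomial function of the \<open>n\<close>-th coefficient. If it vanishes identically, so do the values of
  all coefficients, which are zero by induction.\<close>

lemma Zk_separated:
  "x \<in> Zk n \<Longrightarrow> (\<And>f. unit_series f \<Longrightarrow> retr f x = 0) \<Longrightarrow> x = 0"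
proof (induction n arbitrary: x)
  case 0
  interpret unit_series 1 by unfold_locales simp
  have "retr 1 x = x" using 0(1) unfolding Zk_def by induction (auto simp: retr.simps retr_sc)
  then show ?case using 0(2)[OF unit_series_axioms] by simp
next
  case (Suc n)
  obtain a d where a: "\<And>j. a j \<in> Zk n" "x = (\<Sum>j\<le>d. a j * fps_nth yy n ^ j)"
    using Zk_polynomial[OF Suc.prems(1)] by blast
  show ?case
  proof (cases "n = 0")
    case True
    have "x \<in> Zk 0"
    proof -
      have n0: "nsubalg (Zk 0)" unfolding Zk_def by (rule nsubalg_alg)
      show ?thesis unfolding a(2) using a(1) True by (intro nsubalgD(7)[OF n0]) (simp add: yy)
    qed
    then show ?thesis using Suc.IH[of x] Suc.prems(2) True by simp
  next
    case False
    have "a j = 0" if j: "j \<le> d" for j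
    proof (rule Suc.IH[OF a(1)])
      fix f assume f: "unit_series f"
      obtain al where al: "\<And>j. retr f (a j) = sc (al j)" using Zk_scalar[OF f a(1)] by metis
      have "(\<Sum>j\<le>d. al j * s ^ j) = 0" for s
      proof -
        \<comment> \<open>Only the \<open>n\<close>-th coefficient is changed, so the values of the \<open>a j\<close> stay the same.\<close>
        define f' where "f' = Abs_fps (\<lambda>m. if m = n then s else fps_nth f m)"
        have f': "unit_series f'" using f False by (simp add: f'_def unit_series_def)
        interpret f': unit_series f' by fact
        have "retr f' (fps_nth yy n) = sc s"
          using arg_cong[OF f'.retr_yy, of "\<lambda>F. fps_nth F n"] by (simp add: f'_def)
        moreover have "retr f' (a j) = sc (al j)" for j
          using Zk_dependence[OF f' f _ a(1)[of j]] al[of j] by (simp add: f'_def)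
        ultimately have "retr f' x = sc (\<Sum>j\<le>d. al j * s ^ j)"
          unfolding a(2) by (simp add: f'.retr.simps sc.simps)
        then have "sc (\<Sum>j\<le>d. al j * s ^ j) = (0 :: yang)" using Suc.prems(2)[OF f'] by simp
        then show ?thesis by (rule sc_inject)
      qed
      then have "al j = 0" using polyfun_eq_0[of al d] j by blast
      then show "retr f (a j) = 0" by (simp add: al sc.zero)
    qed
    then show ?thesis unfolding a(2) by simp
  qed
qed

lemma Zk_mono: "m \<le> n \<Longrightarrow> Zk m \<subseteq> Zk n"
  unfolding Zk_def by (rule alg_mono_alg) (auto intro!: alg.base)

lemma Z_in_Zk: "x \<in> alg (range (fps_nth yy)) \<Longrightarrow> \<exists>n. x \<in> Zk n"
proof (induction rule: alg.induct)
  case (base x)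
  then obtain m where "x = fps_nth yy m" by auto
  then have "x \<in> Zk (Suc m)" unfolding Zk_def by (auto intro!: alg.base)
  then show ?case by blast
next
  case one
  then show ?case unfolding Zk_def using alg.one by blast
next
  case (add x y)
  then obtain m n where "x \<in> Zk m" "y \<in> Zk n" by blast
  then have "x \<in> Zk (max m n)" "y \<in> Zk (max m n)" using Zk_mono[of m "max m n"] Zk_mono[of n "max m n"] by auto
  then have "x + y \<in> Zk (max m n)" unfolding Zk_def by (rule alg.add)
  then show ?case by blast
next
  case (mult x y)
  then obtain m n where "x \<in> Zk m" "y \<in> Zk n" by blast
  then have "x \<in> Zk (max m n)" "y \<in> Zk (max m n)" using Zk_mono[of m "max m n"] Zk_mono[of n "max m n"] by auto
  then have "x * y \<in> Zk (max m n)" unfolding Zk_def by (rule alg.mult)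
  then show ?case by blast
next
  case (scale x c)
  then show ?case unfolding Zk_def by (blast intro: alg.scale)
qed

context pair
begin

lemma CW_Z: "alg CW \<subseteq> alg (range (fps_nth yy))"
proof (rule alg_mono_alg)
  let ?V = "alg (range (fps_nth yy))"
  have y: "fps_nth yy n \<in> ?V" for n by (intro alg.base) simp
  have "fps_nth ww n \<in> ?V" for n
    unfolding ww_def qq_def by (intro fps_mult_in[OF nsubalg_alg] sub_in[OF nsubalg_alg] y)
  then show "CW \<subseteq> ?V" by (auto simp: CW_def)
qed

lemma W_separated:
  assumes "x \<in> alg CW" "x \<noteq> 0"
  shows "\<exists>f. unit_series f \<and> retr f x \<noteq> 0"
  using assms CW_Z Z_in_Zk[of x] Zk_separated by blast

lemma W_scalar:
  assumes "x \<in> alg CW" "unit_series f" shows "\<exists>c. retr f x = sc c"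
  using assms CW_Z Z_in_Zk[of x] Zk_scalar by blast

lemma W_central: "x \<in> alg CW \<Longrightarrow> central x"
  using alg_least[OF nsubalg_central, of CW] central_ww unfolding CW_def central_fps_iff by auto

end

section \<open>Quotients and tensor products of record algebras\<close>

lemma calgebra_first_iso:
  assumes P: "calgebra P" and X: "calgebra X" and K: "ideal K P"
    and h: "h ` carrier P = carrier X"
    and add: "\<And>x y. x \<in> carrier P \<Longrightarrow> y \<in> carrier P \<Longrightarrow> h (x \<oplus>\<^bsub>P\<^esub> y) = h x \<oplus>\<^bsub>X\<^esub> h y"
    and mult: "\<And>x y. x \<in> carrier P \<Longrightarrow> y \<in> carrier P \<Longrightarrow> h (x \<otimes>\<^bsub>P\<^esub> y) = h x \<otimes>\<^bsub>X\<^esub> h y"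
    and one: "h \<one>\<^bsub>P\<^esub> = \<one>\<^bsub>X\<^esub>"
    and smult: "\<And>c x. x \<in> carrier P \<Longrightarrow> h (c \<odot>\<^bsub>P\<^esub> x) = c \<odot>\<^bsub>X\<^esub> h x"
    and ker: "\<And>x. x \<in> carrier P \<Longrightarrow> h x = \<zero>\<^bsub>X\<^esub> \<longleftrightarrow> x \<in> K"
  shows "\<exists>\<phi>. \<phi> \<in> alg_iso X (quot_alg P K)"
proof -
  interpret P: calgebra P by fact
  interpret X: calgebra X by fact
  let ?q = "quot_map P K"
  have hc: "h x \<in> carrier X" if "x \<in> carrier P" for x
    unfolding h[symmetric] using that by (rule imageI)
  have rep: "\<exists>f\<in>carrier P. x = h f" if "x \<in> carrier X" for x
    using that unfolding h[symmetric] by blast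
  have minus: "h (x \<ominus>\<^bsub>P\<^esub> y) = h x \<ominus>\<^bsub>X\<^esub> h y" if "x \<in> carrier P" "y \<in> carrier P" for x y
  proof -
    have nc: "\<ominus>\<^bsub>P\<^esub> y \<in> carrier P" by (rule P.a_inv_closed[OF that(2)])
    have "h \<zero>\<^bsub>P\<^esub> = \<zero>\<^bsub>X\<^esub>"
      unfolding ker[OF P.zero_closed] by (rule additive_subgroup.zero_closed[OF ideal.axioms(1)[OF K]])
    then have "h (\<ominus>\<^bsub>P\<^esub> y) \<oplus>\<^bsub>X\<^esub> h y = \<zero>\<^bsub>X\<^esub>"
      unfolding add[OF nc that(2), symmetric] P.l_neg[OF that(2)] .
    then have "\<ominus>\<^bsub>X\<^esub> h y = h (\<ominus>\<^bsub>P\<^esub> y)" by (rule X.minus_equality[OF _ hc[OF that(2)] hc[OF nc]])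
    then show ?thesis unfolding a_minus_def add[OF that(1) nc] by simp
  qed
  have inj: "?q x = ?q y \<longleftrightarrow> h x = h y" if "x \<in> carrier P" "y \<in> carrier P" for x y
  proof -
    have "?q x = ?q y \<longleftrightarrow> x \<ominus>\<^bsub>P\<^esub> y \<in> K" by (rule P.quot_map_eq_iff[OF K that])
    also have "\<dots> \<longleftrightarrow> h (x \<ominus>\<^bsub>P\<^esub> y) = \<zero>\<^bsub>X\<^esub>" by (rule ker[OF P.minus_closed[OF that], symmetric])
    also have "\<dots> \<longleftrightarrow> h x = h y" unfolding minus[OF that] by (rule X.r_right_minus_eq[OF hc[OF that(1)] hc[OF that(2)]])
    finally show ?thesis .
  qed
  define s where "s = (\<lambda>x. SOME f. f \<in> carrier P \<and> h f = x)"
  have s: "s x \<in> carrier P \<and> h (s x) = x" if "x \<in> carrier X" for x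
    unfolding s_def by (rule someI_ex) (use rep[OF that] in blast)
  define \<phi> where "\<phi> = (\<lambda>x. ?q (s x))"
  have \<phi>: "\<phi> (h f) = ?q f" if "f \<in> carrier P" for f
  proof -
    have a: "s (h f) \<in> carrier P" "h (s (h f)) = h f" using s[OF hc[OF that]] by simp_all
    show ?thesis unfolding \<phi>_def inj[OF a(1) that] by (rule a(2))
  qed
  have "bij_betw \<phi> (carrier X) (carrier (quot_alg P K))"
  proof (rule bij_betw_imageI)
    show "inj_on \<phi> (carrier X)"
    proof (rule inj_onI)
      fix x y assume xy: "x \<in> carrier X" "y \<in> carrier X" "\<phi> x = \<phi> y"
      obtain f where f: "f \<in> carrier P" "x = h f" using rep[OF xy(1)] by (elim bexE)
      obtain e where e: "e \<in> carrier P" "y = h e" using rep[OF xy(2)] by (elim bexE)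
      have "?q f = ?q e" using xy(3) unfolding f(2) e(2) \<phi>[OF f(1)] \<phi>[OF e(1)] .
      then show "x = y" unfolding f(2) e(2) inj[OF f(1) e(1)] .
    qed
    show "\<phi> ` carrier X = carrier (quot_alg P K)"
      unfolding P.quot_carrier h[symmetric] image_image by (rule image_cong[OF refl \<phi>])
  qed
  moreover have "\<phi> \<in> ring_hom X (quot_alg P K)"
  proof (rule ring_hom_memI)
    fix x assume x: "x \<in> carrier X"
    obtain f where f: "f \<in> carrier P" "x = h f" using rep[OF x] by (elim bexE)
    show "\<phi> x \<in> carrier (quot_alg P K)" unfolding f(2) \<phi>[OF f(1)] by (rule P.quot_map_closed[OF f(1)])
    fix y assume y: "y \<in> carrier X"
    obtain e where e: "e \<in> carrier P" "y = h e" using rep[OF y] by (elim bexE)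
    show "\<phi> (x \<otimes>\<^bsub>X\<^esub> y) = \<phi> x \<otimes>\<^bsub>quot_alg P K\<^esub> \<phi> y"
      unfolding f(2) e(2) mult[OF f(1) e(1), symmetric] \<phi>[OF P.m_closed[OF f(1) e(1)]] \<phi>[OF f(1)] \<phi>[OF e(1)]
      by (rule P.quot_map_mult[OF K f(1) e(1)])
    show "\<phi> (x \<oplus>\<^bsub>X\<^esub> y) = \<phi> x \<oplus>\<^bsub>quot_alg P K\<^esub> \<phi> y"
      unfolding f(2) e(2) add[OF f(1) e(1), symmetric] \<phi>[OF P.a_closed[OF f(1) e(1)]] \<phi>[OF f(1)] \<phi>[OF e(1)]
      by (rule P.quot_map_add[OF K f(1) e(1)])
  next
    show "\<phi> \<one>\<^bsub>X\<^esub> = \<one>\<^bsub>quot_alg P K\<^esub>"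
      unfolding one[symmetric] \<phi>[OF P.one_closed] by (rule P.quot_map_one[OF K])
  qed
  moreover have "\<phi> (c \<odot>\<^bsub>X\<^esub> x) = c \<odot>\<^bsub>quot_alg P K\<^esub> \<phi> x" if x: "x \<in> carrier X" for c x
  proof -
    obtain f where f: "f \<in> carrier P" "x = h f" using rep[OF x] by (elim bexE)
    show ?thesis
      unfolding f(2) smult[OF f(1), symmetric] \<phi>[OF P.smult_closed[OF f(1)]] \<phi>[OF f(1)] P.quot_map_smult[OF K f(1)] ..
  qed
  ultimately have "\<phi> \<in> alg_iso X (quot_alg P K)"
    unfolding alg_iso_def ring_iso_def mem_Collect_eq by (intro conjI allI ballI)
  then show ?thesis by (intro exI[of _ \<phi>])
qed

text \<open>The convolution product of finitely supported functions for an arbitrary binary operation on the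
  support. The product before passing to the quotient by the bilinearity relations is of this form.\<close>

definition pmul :: "('k \<Rightarrow> 'k \<Rightarrow> 'k) \<Rightarrow> ('k \<Rightarrow>\<^sub>0 complex) \<Rightarrow> ('k \<Rightarrow>\<^sub>0 complex) \<Rightarrow> 'k \<Rightarrow>\<^sub>0 complex" where
  "pmul m f g = (\<Sum>p\<in>Poly_Mapping.keys f. \<Sum>q\<in>Poly_Mapping.keys g.
     Poly_Mapping.single (m p q) (Poly_Mapping.lookup f p * Poly_Mapping.lookup g q))"

lemma pmul_add_left: "pmul m (f + f') g = pmul m f g + pmul m f' g"
  unfolding pmul_def
  by (rule setsum_keys_plus_distrib[where f = "\<lambda>p c. \<Sum>q\<in>Poly_Mapping.keys g. Poly_Mapping.single (m p q) (c * Poly_Mapping.lookup g q)"])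
     (simp_all add: distrib_right single_add sum.distrib)

lemma pmul_add_right: "pmul m f (g + g') = pmul m f g + pmul m f g'"
proof -
  have "(\<Sum>q\<in>Poly_Mapping.keys (g + g'). Poly_Mapping.single (m p q) (c * Poly_Mapping.lookup (g + g') q))
    = (\<Sum>q\<in>Poly_Mapping.keys g. Poly_Mapping.single (m p q) (c * Poly_Mapping.lookup g q))
    + (\<Sum>q\<in>Poly_Mapping.keys g'. Poly_Mapping.single (m p q) (c * Poly_Mapping.lookup g' q))" for p c
    by (rule setsum_keys_plus_distrib[where f = "\<lambda>q d. Poly_Mapping.single (m p q) (c * d)"])
       (simp_all add: distrib_left single_add)
  then show ?thesis unfolding pmul_def by (simp add: sum.distrib)
qed

lemma pmul_zero [simp]: "pmul m 0 g = 0" "pmul m f 0 = 0"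
  by (simp_all add: pmul_def)

lemma pmul_single: "pmul m (Poly_Mapping.single p a) (Poly_Mapping.single q b) = Poly_Mapping.single (m p q) (a * b)"
  by (cases "a = 0"; cases "b = 0") (simp_all add: pmul_def)

lemma keys_induct [consumes 1, case_names zero add single]:
  assumes "Poly_Mapping.keys f \<subseteq> C" "Q 0" "\<And>f g. Q f \<Longrightarrow> Q g \<Longrightarrow> Q (f + g)"
    "\<And>p (c :: complex). p \<in> C \<Longrightarrow> Q (Poly_Mapping.single p c)"
  shows "Q f"
proof -
  have "finite S \<Longrightarrow> S \<subseteq> C \<Longrightarrow> Q (\<Sum>k\<in>S. Poly_Mapping.single k (Poly_Mapping.lookup f k))" for S
    by (induction S rule: finite_induct) (auto intro: assms)
  from this[of "Poly_Mapping.keys f"] show ?thesis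
    unfolding poly_mapping_sum_single[symmetric] using assms(1) by simp
qed

lemma pmul_assoc:
  assumes "Poly_Mapping.keys f \<subseteq> C" "Poly_Mapping.keys g \<subseteq> C" "Poly_Mapping.keys h \<subseteq> C"
    and a: "\<And>p q r. p \<in> C \<Longrightarrow> q \<in> C \<Longrightarrow> r \<in> C \<Longrightarrow> m (m p q) r = m p (m q r)"
  shows "pmul m (pmul m f g) h = pmul m f (pmul m g h)"
  using assms(1)
proof (induction rule: keys_induct)
  case (single p c)
  note p = this
  show ?case using assms(2)
  proof (induction rule: keys_induct)
    case (single q d)
    note q = this
    show ?case using assms(3)
    proof (induction rule: keys_induct)
      case (single r e)
      then show ?case using p q by (simp add: pmul_single a mult.assoc)
    qed (simp_all only: pmul_zero pmul_add_left pmul_add_right)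
  qed (simp_all only: pmul_zero pmul_add_left pmul_add_right)
qed (simp_all only: pmul_zero pmul_add_left pmul_add_right)

lemma pmul_one:
  assumes "Poly_Mapping.keys f \<subseteq> C" 
  shows "(\<And>p. p \<in> C \<Longrightarrow> m u p = p) \<Longrightarrow> pmul m (Poly_Mapping.single u 1) f = f"
    and "(\<And>p. p \<in> C \<Longrightarrow> m p u = p) \<Longrightarrow> pmul m f (Poly_Mapping.single u 1) = f"
proof -
  assume l: "\<And>p. p \<in> C \<Longrightarrow> m u p = p"
  show "pmul m (Poly_Mapping.single u 1) f = f" using assms
    by (induction rule: keys_induct) (simp_all add: pmul_add_right pmul_single l)
next
  assume l: "\<And>p. p \<in> C \<Longrightarrow> m p u = p"
  show "pmul m f (Poly_Mapping.single u 1) = f" using assms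
    by (induction rule: keys_induct) (simp_all add: pmul_add_left pmul_single l)
qed

lemma keys_add_closed: "Poly_Mapping.keys f \<subseteq> C \<Longrightarrow> Poly_Mapping.keys g \<subseteq> C \<Longrightarrow> Poly_Mapping.keys (f + g) \<subseteq> C"
  using Poly_Mapping.keys_add[of f g] by blast

lemma keys_pmul:
  assumes "Poly_Mapping.keys f \<subseteq> C" "Poly_Mapping.keys g \<subseteq> C" "\<And>p q. p \<in> C \<Longrightarrow> q \<in> C \<Longrightarrow> m p q \<in> C"
  shows "Poly_Mapping.keys (pmul m f g) \<subseteq> C"
  using assms(1)
proof (induction rule: keys_induct)
  case (single p c)
  note p = this
  show ?case using assms(2)
  proof (induction rule: keys_induct)
    case (add f g)
    then show ?case unfolding pmul_add_right by (rule keys_add_closed)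
  qed (auto simp: pmul_single assms(3) p)
next
  case (add f g)
  then show ?case unfolding pmul_add_left by (rule keys_add_closed)
qed simp

abbreviation pair_op :: "(complex, 'a) module \<Rightarrow> (complex, 'b) module \<Rightarrow> 'a \<times> 'b \<Rightarrow> 'a \<times> 'b \<Rightarrow> 'a \<times> 'b" where
  "pair_op A B \<equiv> \<lambda>p q. (fst p \<otimes>\<^bsub>A\<^esub> fst q, snd p \<otimes>\<^bsub>B\<^esub> snd q)"

lemma pair_alg_simps [simp]:
  "carrier (pair_alg A B) = {f. Poly_Mapping.keys f \<subseteq> carrier A \<times> carrier B}"
  "mult (pair_alg A B) = pmul (pair_op A B)"
  "one (pair_alg A B) = Poly_Mapping.single (\<one>\<^bsub>A\<^esub>, \<one>\<^bsub>B\<^esub>) 1"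
  "zero (pair_alg A B) = 0" "add (pair_alg A B) = (+)"
  "smult (pair_alg A B) = (\<lambda>c. Poly_Mapping.map ((*) c))"
  by (simp_all add: pair_alg_def pmul_def fun_eq_iff)

lemma lookup_map_scale: "Poly_Mapping.lookup (Poly_Mapping.map ((*) c) f) k = c * (Poly_Mapping.lookup f k :: complex)"
  by (simp add: Poly_Mapping.map.rep_eq when_def)

lemma map_scale_single: "Poly_Mapping.map ((*) c) (Poly_Mapping.single p d) = Poly_Mapping.single p (c * d :: complex)"
  by (rule poly_mapping_eqI) (simp add: lookup_map_scale lookup_single when_def)

lemma map_scale_add: "Poly_Mapping.map ((*) c) (f + g) = Poly_Mapping.map ((*) c) f + Poly_Mapping.map ((*) (c :: complex)) g"
  by (rule poly_mapping_eqI) (simp add: lookup_map_scale lookup_add distrib_left)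

lemma map_scale_zero: "Poly_Mapping.map ((*) c) (0 :: 'k \<Rightarrow>\<^sub>0 complex) = 0"
  by (rule poly_mapping_eqI) (simp add: lookup_map_scale)

lemma calgebra_pair_alg:
  assumes A: "ring A" and B: "ring B"
  shows "calgebra (pair_alg A B)"
proof -
  interpret A: ring A by fact
  interpret B: ring B by fact
  let ?C = "carrier A \<times> carrier B" and ?P = "pair_alg A B" and ?m = "pair_op A B"
  have scal: "c \<odot>\<^bsub>?P\<^esub> \<one>\<^bsub>?P\<^esub> = Poly_Mapping.single (\<one>\<^bsub>A\<^esub>, \<one>\<^bsub>B\<^esub>) c" for c
    by (simp add: map_scale_single)
  have left: "Poly_Mapping.map ((*) c) f = pmul ?m (Poly_Mapping.single (\<one>\<^bsub>A\<^esub>, \<one>\<^bsub>B\<^esub>) c) f"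
    if "Poly_Mapping.keys f \<subseteq> ?C" for c f using that
    by (induction rule: keys_induct) (auto simp: map_scale_zero map_scale_add map_scale_single pmul_add_right pmul_single)
  have right: "pmul ?m (Poly_Mapping.single (\<one>\<^bsub>A\<^esub>, \<one>\<^bsub>B\<^esub>) c) f = pmul ?m f (Poly_Mapping.single (\<one>\<^bsub>A\<^esub>, \<one>\<^bsub>B\<^esub>) c)"
    if "Poly_Mapping.keys f \<subseteq> ?C" for c f using that
    by (induction rule: keys_induct) (auto simp: pmul_add_left pmul_add_right pmul_single mult.commute)
  have keys_one: "Poly_Mapping.keys (Poly_Mapping.single (\<one>\<^bsub>A\<^esub>, \<one>\<^bsub>B\<^esub>) c) \<subseteq> ?C" for c :: complex
    by simp
  show ?thesis
  proof (intro calgebra.intro calgebra_axioms.intro)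
    show "ring ?P"
    proof (intro ringI abelian_groupI monoidI)
      fix x assume "x \<in> carrier ?P"
      then show "\<exists>y\<in>carrier ?P. y \<oplus>\<^bsub>?P\<^esub> x = \<zero>\<^bsub>?P\<^esub>"
        by (intro bexI[of _ "- x"]) simp_all
    next
      fix x y assume xy: "x \<in> carrier ?P" "y \<in> carrier ?P"
      then show "x \<oplus>\<^bsub>?P\<^esub> y \<in> carrier ?P" using keys_add_closed[of x ?C y] by simp
      show "x \<otimes>\<^bsub>?P\<^esub> y \<in> carrier ?P" using keys_pmul[of x ?C y ?m] xy by auto
      show "x \<oplus>\<^bsub>?P\<^esub> y = y \<oplus>\<^bsub>?P\<^esub> x" by (simp add: add.commute)
      fix z assume z: "z \<in> carrier ?P"
      show "x \<otimes>\<^bsub>?P\<^esub> y \<otimes>\<^bsub>?P\<^esub> z = x \<otimes>\<^bsub>?P\<^esub> (y \<otimes>\<^bsub>?P\<^esub> z)"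
        using pmul_assoc[of x ?C y z ?m] xy z by (auto simp: A.m_assoc B.m_assoc)
    next
      fix x assume "x \<in> carrier ?P"
      then show "\<one>\<^bsub>?P\<^esub> \<otimes>\<^bsub>?P\<^esub> x = x" "x \<otimes>\<^bsub>?P\<^esub> \<one>\<^bsub>?P\<^esub> = x"
        using pmul_one[of x ?C ?m "(\<one>\<^bsub>A\<^esub>, \<one>\<^bsub>B\<^esub>)"] by auto
    qed (simp_all add: pmul_add_left pmul_add_right add.assoc)
    show "c \<odot>\<^bsub>?P\<^esub> \<one>\<^bsub>?P\<^esub> \<in> carrier ?P" for c unfolding scal using keys_one[of c] by simp
    show "1 \<odot>\<^bsub>?P\<^esub> \<one>\<^bsub>?P\<^esub> = \<one>\<^bsub>?P\<^esub>" unfolding scal by simp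
    show "(a + b) \<odot>\<^bsub>?P\<^esub> \<one>\<^bsub>?P\<^esub> = a \<odot>\<^bsub>?P\<^esub> \<one>\<^bsub>?P\<^esub> \<oplus>\<^bsub>?P\<^esub> b \<odot>\<^bsub>?P\<^esub> \<one>\<^bsub>?P\<^esub>" for a b
      unfolding scal by (simp add: single_add)
    show "(a * b) \<odot>\<^bsub>?P\<^esub> \<one>\<^bsub>?P\<^esub> = (a \<odot>\<^bsub>?P\<^esub> \<one>\<^bsub>?P\<^esub>) \<otimes>\<^bsub>?P\<^esub> (b \<odot>\<^bsub>?P\<^esub> \<one>\<^bsub>?P\<^esub>)" for a b
      unfolding scal by (simp add: pmul_single)
    fix x c assume "x \<in> carrier ?P"
    then have k: "Poly_Mapping.keys x \<subseteq> ?C" by simp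
    show "c \<odot>\<^bsub>?P\<^esub> x = (c \<odot>\<^bsub>?P\<^esub> \<one>\<^bsub>?P\<^esub>) \<otimes>\<^bsub>?P\<^esub> x"
      unfolding scal using left[OF k] by simp
    show "(c \<odot>\<^bsub>?P\<^esub> \<one>\<^bsub>?P\<^esub>) \<otimes>\<^bsub>?P\<^esub> x = x \<otimes>\<^bsub>?P\<^esub> (c \<odot>\<^bsub>?P\<^esub> \<one>\<^bsub>?P\<^esub>)"
      unfolding scal using right[OF k] by simp
  qed
qed

lemma bilin_rels_carrier:
  assumes "calgebra A" "calgebra B"
  shows "bilin_rels A B \<subseteq> carrier (pair_alg A B)"
proof -
  interpret A: calgebra A by fact
  interpret B: calgebra B by fact
  let ?C = "carrier A \<times> carrier B"
  have d: "Poly_Mapping.keys (f - h) \<subseteq> ?C" if "Poly_Mapping.keys f \<subseteq> ?C" "Poly_Mapping.keys h \<subseteq> ?C"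
    for f h :: "'a \<times> 'b \<Rightarrow>\<^sub>0 complex"
    using that keys_diff[of f h] by blast
  have s: "Poly_Mapping.keys (Poly_Mapping.single (a, b) c) \<subseteq> ?C" if "a \<in> carrier A" "b \<in> carrier B" for a b and c :: complex
    using that by simp
  show ?thesis
    unfolding bilin_rels_def pair_alg_simps
    by (intro Un_least subsetI; elim CollectE exE conjE; simp only: mem_Collect_eq; intro d s)
       (simp_all add: A.smult_closed B.smult_closed)
qed

section \<open>From the type back to the record\<close>

text \<open>A ring type together with its image in a record. Through the injection \<open>h\<close> every operation
  of the record becomes one of the type.\<close>

locale typed_ring =
  fixes R :: "('b, 'm) ring_scheme" (structure) and h :: "'a::ring_1 \<Rightarrow> 'b"
  assumes inj: "inj h" and car: "carrier R = range h"
    and mult: "h x \<otimes> h y = h (x * y)" and add: "h x \<oplus> h y = h (x + y)"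
    and one: "\<one> = h 1" and zero: "\<zero> = h 0"
begin

lemma is_ring: "ring R"
proof (intro ringI abelian_groupI monoidI)
  fix x assume "x \<in> carrier R"
  then obtain a where a: "x = h a" unfolding car by blast
  have "h (- a) \<oplus> x = \<zero>" unfolding a add zero by simp
  then show "\<exists>y\<in>carrier R. y \<oplus> x = \<zero>" unfolding car by blast
qed (auto simp: car mult add one zero mult.assoc add.assoc add.commute add.left_commute distrib_left distrib_right)

sublocale ring R by (rule is_ring)

lemma h_closed [simp]: "h x \<in> carrier R" by (simp add: car)

lemma uminus: "\<ominus> h x = h (- x)"
  by (rule minus_equality) (simp_all add: add zero)

lemma diff: "h x \<ominus> h y = h (x - y)"
  by (simp add: a_minus_def uminus add)

lemma finsum: "finite A \<Longrightarrow> (\<Oplus>i\<in>A. h (f i)) = h (\<Sum>i\<in>A. f i)"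
  by (induction A rule: finite_induct) (simp_all add: zero add)

lemma inverse: "x * y = 1 \<Longrightarrow> y * x = 1 \<Longrightarrow> inv (h x) = h y"
  by (rule inv_char) (simp_all add: mult one)

lemma eq_iff: "h x = h y \<longleftrightarrow> x = y"
  using inj by (simp add: inj_eq)

end

abbreviation rep :: "yang \<Rightarrow> free set" where "rep \<equiv> Rep_yang"

lemma rep_range: "carrier X0 = range rep"
  using type_definition.Rep_range[OF type_definition_yang] by simp

interpretation X: typed_ring X0 rep
  by standard (simp_all add: inj_def Rep_yang_inject rep_range Rep_simps)

text \<open>Series over the record are functions on the natural numbers.\<close>

definition rs :: "yang fps \<Rightarrow> nat \<Rightarrow> free set" where
  "rs F = (\<lambda>n. rep (fps_nth F n))"

lemma ser_alg_simps [simp]: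
  "carrier (ser_alg A) = {f. \<forall>r. f r \<in> carrier A}"
  "mult (ser_alg A) = (\<lambda>f g n. \<Oplus>\<^bsub>A\<^esub>k\<in>{..n}. f k \<otimes>\<^bsub>A\<^esub> g (n - k))"
  "one (ser_alg A) = (\<lambda>n. if n = 0 then \<one>\<^bsub>A\<^esub> else \<zero>\<^bsub>A\<^esub>)"
  "zero (ser_alg A) = (\<lambda>n. \<zero>\<^bsub>A\<^esub>)"
  "add (ser_alg A) = (\<lambda>f g n. f n \<oplus>\<^bsub>A\<^esub> g n)"
  "smult (ser_alg A) = (\<lambda>c f n. c \<odot>\<^bsub>A\<^esub> f n)"
  by (simp_all add: ser_alg_def)

interpretation ser: typed_ring "ser_yangian g0" rs
proof
  show "inj rs" by (rule injI) (simp add: rs_def fun_eq_iff fps_eq_iff Rep_yang_inject)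
  show "carrier (ser_yangian g0) = range rs"
  proof (intro equalityI subsetI)
    fix f assume "f \<in> carrier (ser_yangian g0)"
    then have "f = rs (Abs_fps (\<lambda>n. Abs_yang (f n)))" by (simp add: rs_def fun_eq_iff Abs_yang_inverse)
    then show "f \<in> range rs" by blast
  qed (auto simp: rs_def)
  show "rs x \<otimes>\<^bsub>ser_yangian g0\<^esub> rs y = rs (x * y)" for x y
    by (simp add: rs_def fun_eq_iff X.mult X.finsum fps_mult_nth atMost_atLeast0)
  show "rs x \<oplus>\<^bsub>ser_yangian g0\<^esub> rs y = rs (x + y)" for x y
    by (simp add: rs_def fun_eq_iff X.add)
qed (simp_all add: rs_def fun_eq_iff Rep_simps)

lemma rs_subst: "ser_subst X0 b a (rs F) = rs (sub b a F)"
proof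
  fix n
  have "ser_subst X0 b a (rs F) n = (\<Oplus>\<^bsub>X0\<^esub>r\<in>{..n}. rep (sc (fps_nth (mob b a ^ r) n) * fps_nth F r))"
    by (simp add: ser_subst_def rs_def Rep_smult mob_def)
  then show "ser_subst X0 b a (rs F) n = rs (sub b a F) n"
    by (simp add: X.finsum sub_nth rs_def)
qed

lemma rs_smult: "c \<odot>\<^bsub>ser_yangian g0\<^esub> rs F = rs (fps_const (sc c) * F)"
  by (simp add: rs_def fun_eq_iff Rep_smult)

definition reps :: "(nat \<Rightarrow> free set) imat \<Rightarrow> (int \<Rightarrow> int \<Rightarrow> yang fps) \<Rightarrow> bool" where
  "reps M' M \<longleftrightarrow> (\<forall>i\<in>I0. \<forall>j\<in>I0. M' i j = rs (M i j))"

lemma repsD: "reps M' M \<Longrightarrow> i \<in> I0 \<Longrightarrow> j \<in> I0 \<Longrightarrow> M' i j = rs (M i j)"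
  by (simp add: reps_def)

lemma reps_mult:
  assumes "reps M' M" "reps N' N" shows "reps (mat_times g0 M' N') (mm I0 M N)"
  unfolding reps_def
proof (intro ballI)
  fix i j assume ij: "i \<in> I0" "j \<in> I0"
  have "mat_times g0 M' N' i j = (\<Oplus>\<^bsub>ser_yangian g0\<^esub>k\<in>I0. rs (M i k * N k j))"
    unfolding mat_mult_def
    by (rule ser.finsum_cong') (auto simp: repsD[OF assms(1)] repsD[OF assms(2)] ij ser.mult simp del: ser_alg_simps)
  then show "mat_times g0 M' N' i j = rs (mm I0 M N i j)"
    by (simp add: ser.finsum mm_def del: ser_alg_simps)
qed

lemma reps_subst: "reps M' M \<Longrightarrow> reps (mat_subst g0 b a M') (\<lambda>i j. sub b a (M i j))"
  by (simp add: reps_def mat_subst_def rs_subst)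

lemma reps_transp: "reps M' M \<Longrightarrow> reps (transp g0 M') (tr g0 M)"
  by (simp add: reps_def mat_transp_def tr_def rs_smult del: ser_alg_simps)

lemma reps_cong: "reps M' M \<Longrightarrow> (\<And>i j. i \<in> I0 \<Longrightarrow> j \<in> I0 \<Longrightarrow> M i j = N i j) \<Longrightarrow> reps M' N"
  by (simp add: reps_def)

lemma reps_T: "reps (T_mat g0) tt"
  by (simp add: reps_def rs_def fun_eq_iff Rep_tt)

lemma one_I0: "1 \<in> I0" by (rule one_in_idx[OF g0_valid])

lemma is_scalar_unique:
  assumes "is_scalar_mat g0 M z" "is_scalar_mat g0 M z'" shows "z = z'"
  using assms one_I0 unfolding is_scalar_mat_def mat_scalar_def by metis

lemma is_scalar_reps:
  assumes "reps M' (\<lambda>i j. if i = j then z else 0)" shows "is_scalar_mat g0 M' (rs z)"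
  using assms by (auto simp: is_scalar_mat_def mat_scalar_def reps_def ser.zero simp del: ser_alg_simps)

text \<open>Here and for \<open>y\<close>, the definite description picks the series constructed above: it has the
  required properties, and it is the only one.\<close>

lemma z_ser_rs: "z_ser g0 = rs zz"
  unfolding z_ser_def
proof (rule the_equality)
  let ?T' = "mat_subst g0 1 (kappa g0) (transp g0 (T_mat g0))"
  have T': "reps ?T' (tr g0 (\<lambda>i j. sub 1 k0 (tt i j)))"
    by (rule reps_cong[OF reps_subst[OF reps_transp[OF reps_T]]]) (simp add: sub_tr)
  have 1: "is_scalar_mat g0 (mat_times g0 ?T' (T_mat g0)) (rs zz)"
    by (rule is_scalar_reps[OF reps_cong[OF reps_mult[OF T' reps_T] zz_both(1)]])
  have 2: "is_scalar_mat g0 (mat_times g0 (T_mat g0) ?T') (rs zz)"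
    by (rule is_scalar_reps[OF reps_cong[OF reps_mult[OF reps_T T'] zz_both(2)]])
  show "rs zz \<in> carrier (ser_yangian g0) \<and> rs zz 0 = \<one>\<^bsub>X0\<^esub> \<and>
     is_scalar_mat g0 (mat_times g0 ?T' (T_mat g0)) (rs zz) \<and> is_scalar_mat g0 (mat_times g0 (T_mat g0) ?T') (rs zz)"
    using 1 2 by (simp add: rs_def zz_0 Rep_one)
  fix z assume "z \<in> carrier (ser_yangian g0) \<and> z 0 = \<one>\<^bsub>X0\<^esub> \<and>
     is_scalar_mat g0 (mat_times g0 ?T' (T_mat g0)) z \<and> is_scalar_mat g0 (mat_times g0 (T_mat g0) ?T') z"
  then show "z = rs zz" using is_scalar_unique[OF _ 1] by blast
qed

lemma y_ser_rs: "y_ser g0 = rs yy"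
  unfolding y_ser_def z_ser_rs
proof (rule the_equality)
  show "rs yy \<in> carrier (ser_yangian g0) \<and> rs yy 0 = \<one>\<^bsub>X0\<^esub> \<and> rs zz = rs yy \<otimes>\<^bsub>ser_yangian g0\<^esub> ser_subst X0 1 k0 (rs yy)"
    unfolding rs_subst ser.mult yy(2) by (simp add: rs_def yy(1) Rep_one)
  fix y assume y: "y \<in> carrier (ser_yangian g0) \<and> y 0 = \<one>\<^bsub>X0\<^esub> \<and> rs zz = y \<otimes>\<^bsub>ser_yangian g0\<^esub> ser_subst X0 1 k0 y"
  then obtain Y where Y: "y = rs Y" unfolding ser.car by blast
  have "zz = Y * sub 1 k0 Y" using y unfolding Y rs_subst ser.mult ser.eq_iff by blast
  moreover have "fps_nth Y 0 = 1" using y unfolding Y rs_def by (simp add: Rep_one[symmetric] Rep_yang_inject)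
  ultimately show "y = rs yy"
    unfolding Y using shift_root_unique[of Y yy k0] yy by simp
qed

lemma reps_tau: "reps (tau_mat g0) tau"
proof -
  have "inv\<^bsub>ser_yangian g0\<^esub> (y_ser g0) = rs yi"
    unfolding y_ser_rs by (rule ser.inverse[OF yi])
  then show ?thesis
    by (simp add: reps_def tau_mat_def repsD[OF reps_T] ser.mult tau_def del: ser_alg_simps)
qed

lemma reps_G: "reps (G_ser g0 ty) (\<lambda>i j. scf (Gc g0 ty i j))"
  by (simp add: reps_def G_ser_def rs_def Rep_sc Gc_def)

lemma reps_twist: "reps M' M \<Longrightarrow> reps (twist g0 ty M') (tw (Gc g0 ty) M)"
  unfolding twist_def tw_def
  by (intro reps_mult reps_subst reps_transp reps_G)

lemma reps_coeffs: "reps M' M \<Longrightarrow> mat_coeffs I0 M' = rep ` {fps_nth (M i j) r | i j r. i \<in> I0 \<and> j \<in> I0}"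
proof -
  assume r: "reps M' M"
  have e: "M' i j r = rep (fps_nth (M i j) r)" if "i \<in> I0" "j \<in> I0" for i j r
    using repsD[OF r that] by (simp add: rs_def)
  have "mat_coeffs I0 M' = {rep (fps_nth (M i j) r) | i j r. i \<in> I0 \<and> j \<in> I0}"
    unfolding mat_coeffs_def by (intro Collect_cong) (metis e)
  also have "\<dots> = rep ` {fps_nth (M i j) r | i j r. i \<in> I0 \<and> j \<in> I0}" by blast
  finally show ?thesis .
qed

section \<open>The twisted algebras as records\<close>

abbreviation sub_rec :: "yang set \<Rightarrow> (complex, free set) module" where
  "sub_rec B \<equiv> X0\<lparr>carrier := rep ` B\<rparr>"

lemma calgebra_sub_rec:
  assumes B: "nsubalg B" "1 \<in> B" shows "calgebra (sub_rec B)"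
proof -
  note c = nsubalgD[OF B(1)]
  have scal: "c \<odot>\<^bsub>X0\<^esub> \<one>\<^bsub>X0\<^esub> = rep (sc c)" for c by (simp add: Rep_sc)
  have scB: "sc c \<in> B" for c using c(4)[OF B(2), of c] by simp
  show ?thesis
  proof (intro calgebra.intro calgebra_axioms.intro)
    show "ring (sub_rec B)"
    proof (intro ringI abelian_groupI monoidI)
      fix x assume "x \<in> carrier (sub_rec B)"
      then obtain a where a: "x = rep a" "a \<in> B" by auto
      then have "rep (- a) \<oplus>\<^bsub>X0\<^esub> x = \<zero>\<^bsub>X0\<^esub>" by (simp add: X.add X.zero)
      then show "\<exists>y\<in>carrier (sub_rec B). y \<oplus>\<^bsub>sub_rec B\<^esub> x = \<zero>\<^bsub>sub_rec B\<^esub>" using c(5)[OF a(2)] by auto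
    qed (use B c in \<open>auto simp: X.add X.mult X.one X.zero X.eq_iff algebra_simps\<close>)
    fix x c assume "x \<in> carrier (sub_rec B)"
    then obtain a where a: "x = rep a" "a \<in> B" by auto
    show "(c \<odot>\<^bsub>sub_rec B\<^esub> \<one>\<^bsub>sub_rec B\<^esub>) \<otimes>\<^bsub>sub_rec B\<^esub> x = x \<otimes>\<^bsub>sub_rec B\<^esub> (c \<odot>\<^bsub>sub_rec B\<^esub> \<one>\<^bsub>sub_rec B\<^esub>)"
      by (simp add: a scal X.mult sc_commute[of c a])
    show "c \<odot>\<^bsub>sub_rec B\<^esub> x = (c \<odot>\<^bsub>sub_rec B\<^esub> \<one>\<^bsub>sub_rec B\<^esub>) \<otimes>\<^bsub>sub_rec B\<^esub> x"
      by (simp add: a scal X.mult Rep_smult[symmetric])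
  next
    show "c \<odot>\<^bsub>sub_rec B\<^esub> \<one>\<^bsub>sub_rec B\<^esub> \<in> carrier (sub_rec B)" for c
      using scB[of c] scal[of c] by simp
    show "1 \<odot>\<^bsub>sub_rec B\<^esub> \<one>\<^bsub>sub_rec B\<^esub> = \<one>\<^bsub>sub_rec B\<^esub>" using X0.scalar_one by simp
    show "(a + b) \<odot>\<^bsub>sub_rec B\<^esub> \<one>\<^bsub>sub_rec B\<^esub> = a \<odot>\<^bsub>sub_rec B\<^esub> \<one>\<^bsub>sub_rec B\<^esub> \<oplus>\<^bsub>sub_rec B\<^esub> b \<odot>\<^bsub>sub_rec B\<^esub> \<one>\<^bsub>sub_rec B\<^esub>" for a b
      using X0.scalar_add[of a b] by simp
    show "(a * b) \<odot>\<^bsub>sub_rec B\<^esub> \<one>\<^bsub>sub_rec B\<^esub> = (a \<odot>\<^bsub>sub_rec B\<^esub> \<one>\<^bsub>sub_rec B\<^esub>) \<otimes>\<^bsub>sub_rec B\<^esub> (b \<odot>\<^bsub>sub_rec B\<^esub> \<one>\<^bsub>sub_rec B\<^esub>)" for a b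
      using X0.scalar_mult[of a b] by simp
  qed
qed

lemma sub_rec_uminus:
  assumes "nsubalg B" "1 \<in> B" "a \<in> B" shows "\<ominus>\<^bsub>sub_rec B\<^esub> rep a = rep (- a)"
proof -
  interpret calgebra "sub_rec B" by (rule calgebra_sub_rec[OF assms(1,2)])
  show ?thesis using assms nsubalgD(5)[OF assms(1,3)] by (intro minus_equality) (auto simp: X.add X.zero)
qed

lemma sub_rec_diff:
  assumes "nsubalg B" "1 \<in> B" "a \<in> B" "b \<in> B" shows "rep a \<ominus>\<^bsub>sub_rec B\<^esub> rep b = rep (a - b)"
  by (simp add: a_minus_def sub_rec_uminus[OF assms(1,2,4)] X.add)

lemma csubalg_sub_rec:
  assumes B: "nsubalg B" "1 \<in> B" and D: "nsubalg D" "1 \<in> D" "D \<subseteq> B"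
  shows "csubalg (rep ` D) (sub_rec B)"
proof -
  interpret calgebra "sub_rec B" by (rule calgebra_sub_rec[OF B])
  note d = nsubalgD[OF D(1)]
  have "subring (rep ` D) (sub_rec B)"
  proof (rule subringI)
    fix h assume "h \<in> rep ` D"
    then obtain a where a: "h = rep a" "a \<in> D" by blast
    then show "\<ominus>\<^bsub>sub_rec B\<^esub> h \<in> rep ` D" using sub_rec_uminus[OF B, of a] D(3) d(5)[OF a(2)] by auto
  qed (use D d in \<open>auto simp: X.add X.mult X.one\<close>)
  moreover have "c \<odot>\<^bsub>sub_rec B\<^esub> x \<in> rep ` D" if "x \<in> rep ` D" for c x
    using that d(4) by (auto simp: Rep_smult[symmetric])
  ultimately show ?thesis by (simp add: csubalg_def)
qed

lemma subalg_gen_sub_rec: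
  assumes B: "nsubalg B" "1 \<in> B" and S: "S \<subseteq> B"
  shows "subalg_gen (sub_rec B) (rep ` S) = sub_rec (alg S)"
proof -
  interpret calgebra "sub_rec B" by (rule calgebra_sub_rec[OF B])
  have "\<Inter>{C. csubalg C (sub_rec B) \<and> rep ` S \<subseteq> C} = rep ` alg S"
  proof (intro equalityI)
    have "csubalg (rep ` alg S) (sub_rec B)"
      by (rule csubalg_sub_rec[OF B nsubalg_alg alg.one alg_least[OF B S]])
    moreover have "rep ` S \<subseteq> rep ` alg S" using alg.base by blast
    ultimately show "\<Inter>{C. csubalg C (sub_rec B) \<and> rep ` S \<subseteq> C} \<subseteq> rep ` alg S" by blast
    show "rep ` alg S \<subseteq> \<Inter>{C. csubalg C (sub_rec B) \<and> rep ` S \<subseteq> C}"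
    proof (intro Inter_greatest)
      fix C assume "C \<in> {C. csubalg C (sub_rec B) \<and> rep ` S \<subseteq> C}"
      then have C: "subring C (sub_rec B)" "\<And>c x. x \<in> C \<Longrightarrow> c \<odot>\<^bsub>X0\<^esub> x \<in> C" "rep ` S \<subseteq> C"
        by (auto simp: csubalg_def)
      let ?D = "{x. rep x \<in> C}"
      have "nsubalg ?D"
        unfolding nsubalg_def
      proof (intro conjI ballI allI; simp only: mem_Collect_eq)
        show "rep 0 \<in> C" using subringE(2)[OF C(1)] by (simp add: X.zero)
        show "rep (x + y) \<in> C" "rep (x * y) \<in> C" if "rep x \<in> C" "rep y \<in> C" for x y
          using subringE(7)[OF C(1) that] subringE(6)[OF C(1) that] by (simp_all add: X.add X.mult)
        show "rep (sc c * x) \<in> C" if "rep x \<in> C" for c x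
          unfolding Rep_smult by (rule C(2)[OF that])
      qed
      moreover have "1 \<in> ?D" using subringE(3)[OF C(1)] by (simp add: X.one)
      moreover have "S \<subseteq> ?D" using C(3) by blast
      ultimately have "alg S \<subseteq> ?D" by (rule alg_least)
      then show "rep ` alg S \<subseteq> C" by blast
    qed
  qed
  then show ?thesis by (simp add: subalg_gen_def)
qed

lemma X0_sub_rec: "X0 = sub_rec UNIV"
  by (simp add: rep_range[symmetric])

lemma nsubalg_UNIV: "nsubalg UNIV" by (simp add: nsubalg_def)

definition CT :: "yang set" where "CT = {fps_nth (tau i j) r | i j r. i \<in> I0 \<and> j \<in> I0}"

lemma yangian_sub_rec: "yangian_sub g0 = sub_rec (alg CT)"
  unfolding yangian_sub_def reps_coeffs[OF reps_tau] CT_def[symmetric]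
  by (subst X0_sub_rec) (rule subalg_gen_sub_rec[OF nsubalg_UNIV], simp_all)

context pair
begin

lemma X_tw_rec: "X_tw g0 ty = sub_rec (alg CX)"
  unfolding X_tw_def S_mat_def reps_coeffs[OF reps_twist[OF reps_T]] CX_def SX_def
  by (subst X0_sub_rec) (rule subalg_gen_sub_rec[OF nsubalg_UNIV], simp_all)

lemma CY_CT: "CY \<subseteq> alg CT"
proof -
  have t: "fps_nth (tau i j) n \<in> alg CT" if "i \<in> I0" "j \<in> I0" for i j n
    by (rule alg.base) (use that in \<open>auto simp: CT_def\<close>)
  have sc1: "sc c \<in> alg CT" for c using alg.scale[OF alg.one, of c CT] by simp
  have G: "fps_nth (scf F) n \<in> alg CT" for F n by (simp add: sc1)
  have r: "fps_nth (tr g0 tau i j) n \<in> alg CT" if "i \<in> I0" "j \<in> I0" for i j n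
    unfolding tr_def by (simp, rule alg.scale[OF t]) (use that in simp_all)
  note f = fps_mult_in[OF nsubalg_alg] sub_in[OF nsubalg_alg]
  have 1: "fps_nth (mm I0 (\<lambda>i j. sub 1 (- k0 / 2) (tau i j)) (\<lambda>i j. scf (Gc g0 ty i j)) i j) n \<in> alg CT"
    if "i \<in> I0" "j \<in> I0" for i j n
    unfolding mm_def fps_sum_nth
    by (rule nsubalgD(7)[OF nsubalg_alg]) (intro f G t that, assumption)
  have "fps_nth (SY i j) n \<in> alg CT" if "i \<in> I0" "j \<in> I0" for i j n
    unfolding SY_def tw_def mm_def[of I0 "mm _ _ _"] fps_sum_nth
    by (rule nsubalgD(7)[OF nsubalg_alg]) (intro f 1 r that, assumption+)
  then show ?thesis by (auto simp: CY_def)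
qed

lemma Y_tilde_rec: "Y_tilde_tw g0 ty = sub_rec (alg CY)"
  unfolding Y_tilde_tw_def Sigma_mat_def reps_coeffs[OF reps_twist[OF reps_tau]] yangian_sub_rec
  using subalg_gen_sub_rec[OF nsubalg_alg alg.one CY_CT] unfolding CY_def SY_def .

lemma SS_reps: "reps (SS_mat g0 ty) (\<lambda>i j. if i = j then ww else 0)"
proof -
  have S: "reps (S_mat g0 ty) SX" unfolding S_mat_def SX_def by (rule reps_twist[OF reps_T])
  show ?thesis
    unfolding SS_mat_def by (rule reps_cong[OF reps_mult[OF S reps_subst[OF S]] SX_SX])
qed

lemma w_ser_rs: "w_ser g0 ty = rs ww"
  unfolding w_ser_def
proof (rule the_equality)
  have 1: "is_scalar_mat g0 (SS_mat g0 ty) (rs ww)" by (rule is_scalar_reps[OF SS_reps])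
  then show "rs ww \<in> carrier (ser_yangian g0) \<and> is_scalar_mat g0 (SS_mat g0 ty) (rs ww)"
    by (simp only: ser.h_closed simp_thms)
  show "w = rs ww" if "w \<in> carrier (ser_yangian g0) \<and> is_scalar_mat g0 (SS_mat g0 ty) w" for w
    using is_scalar_unique[OF _ 1] that by blast
qed

lemma W_tw_rec: "W_tw g0 ty = sub_rec (alg CW)"
proof -
  have "range (w_ser g0 ty) = rep ` CW" by (auto simp: w_ser_rs rs_def CW_def)
  then show ?thesis
    unfolding W_tw_def X_tw_rec using subalg_gen_sub_rec[OF nsubalg_alg alg.one CW_CX] by simp
qed

definition unit_gens :: "yang set" where
  "unit_gens = {fps_nth (if i = j then ww - 1 else 0) r | i j r. i \<in> I0 \<and> j \<in> I0}"

abbreviation J :: "free set set" where "J \<equiv> unitarity_ideal g0 ty"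

lemma J_eq: "J = Idl\<^bsub>sub_rec (alg CX)\<^esub> (rep ` unit_gens)"
proof -
  have "reps (\<lambda>i j. SS_mat g0 ty i j \<ominus>\<^bsub>ser_yangian g0\<^esub> mat_scalar (ser_yangian g0) \<one>\<^bsub>ser_yangian g0\<^esub> i j)
      (\<lambda>i j. if i = j then ww - 1 else 0)"
    unfolding reps_def mat_scalar_def
    by (auto simp: repsD[OF SS_reps] ser.one ser.zero ser.diff simp del: ser_alg_simps)
  from reps_coeffs[OF this] show ?thesis
    unfolding unitarity_ideal_def X_tw_rec unit_gens_def by simp
qed

lemma unit_gens_CX: "unit_gens \<subseteq> alg CX"
proof -
  note n = nsubalgD[OF nsubalg_alg[of CX]]
  have "fps_nth ww r \<in> alg CX" for r using CW_CX by (auto simp: CW_def)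
  moreover have "fps_nth (1 :: yang fps) r \<in> alg CX" for r using alg.one[of CX] n(1) by simp
  ultimately have "fps_nth (ww - 1) r \<in> alg CX" for r unfolding fps_sub_nth by (rule n(6))
  then have 1: "fps_nth (if i = j then ww - 1 else 0) r \<in> alg CX" for i j :: int and r
    using n(1) by (cases "i = j") (simp_all only: if_True if_False fps_zero_nth refl simp_thms)
  show ?thesis
  proof
    fix x assume "x \<in> unit_gens"
    then obtain i j :: int and r where "x = fps_nth (if i = j then ww - 1 else 0) r" unfolding unit_gens_def by blast
    then show "x \<in> alg CX" using 1[of i j r] by (simp only:)
  qed
qed

lemma J_ideal: "ideal J (sub_rec (alg CX))"
proof -
  interpret calgebra "sub_rec (alg CX)" by (rule calgebra_sub_rec[OF nsubalg_alg alg.one])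
  show ?thesis unfolding J_eq by (rule genideal_ideal) (use unit_gens_CX in auto)
qed

lemma ww_J: "n > 0 \<Longrightarrow> rep (fps_nth ww n) \<in> J"
proof -
  interpret calgebra "sub_rec (alg CX)" by (rule calgebra_sub_rec[OF nsubalg_alg alg.one])
  assume n: "n > 0"
  have "rep ` unit_gens \<subseteq> J" unfolding J_eq by (rule genideal_self) (use unit_gens_CX in auto)
  moreover have "fps_nth ww n \<in> unit_gens"
    unfolding unit_gens_def using one_I0 n by (intro CollectI exI[of _ 1] exI[of _ n]) simp
  ultimately show ?thesis by blast
qed

text \<open>The elements killed by \<open>retr 1\<close> form an ideal, which contains the coefficients of \<open>w - 1\<close>.\<close>

lemma J_retr: "y \<in> J \<Longrightarrow> \<exists>x\<in>alg CX. y = rep x \<and> retr 1 x = 0"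
proof -
  interpret calgebra "sub_rec (alg CX)" by (rule calgebra_sub_rec[OF nsubalg_alg alg.one])
  interpret u: unit_series 1 by (rule unit_series_1)
  note n = nsubalgD[OF nsubalg_alg[of CX]]
  let ?K = "rep ` {x \<in> alg CX. retr 1 x = 0}"
  have "ideal ?K (sub_rec (alg CX))"
  proof (rule idealI[OF ring_axioms])
    show "subgroup ?K (add_monoid (sub_rec (alg CX)))"
    proof (rule add.subgroupI)
      show "?K \<subseteq> carrier (sub_rec (alg CX))" by auto
      show "?K \<noteq> {}" using n(1) u.retr.zero by blast
    next
      fix a assume "a \<in> ?K"
      then obtain x where x: "a = rep x" "x \<in> alg CX" "retr 1 x = 0" by blast
      then show "\<ominus>\<^bsub>sub_rec (alg CX)\<^esub> a \<in> ?K"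
        using sub_rec_uminus[OF nsubalg_alg alg.one x(2)] n(5)[OF x(2)] by (simp add: u.retr.uminus)
      fix b assume "b \<in> ?K"
      then obtain y where y: "b = rep y" "y \<in> alg CX" "retr 1 y = 0" by blast
      show "a \<oplus>\<^bsub>sub_rec (alg CX)\<^esub> b \<in> ?K"
        using n(2)[OF x(2) y(2)] x y by (simp add: X.add u.retr.add)
    qed
  next
    fix a b assume "a \<in> ?K" "b \<in> carrier (sub_rec (alg CX))"
    then obtain x y where x: "a = rep x" "x \<in> alg CX" "retr 1 x = 0" and y: "b = rep y" "y \<in> alg CX" by auto
    show "b \<otimes>\<^bsub>sub_rec (alg CX)\<^esub> a \<in> ?K"
      using n(3)[OF y(2) x(2)] x y by (simp add: X.mult u.retr.mult)
    show "a \<otimes>\<^bsub>sub_rec (alg CX)\<^esub> b \<in> ?K"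
      using n(3)[OF x(2) y(2)] x y by (simp add: X.mult u.retr.mult)
  qed
  moreover have "rep ` unit_gens \<subseteq> ?K"
  proof -
    have "retr 1 (fps_nth (if i = j then ww - 1 else 0) r) = 0" for i j r
      using arg_cong[OF retr_1_ww, of "\<lambda>F. fps_nth F r"] by (auto simp: u.retr.simps)
    then have 1: "retr 1 (fps_nth (if i = j then ww - 1 else 0) r) = 0" for i j :: int and r .
    have "retr 1 x = 0" if "x \<in> unit_gens" for x
    proof -
      obtain i j :: int and r where "x = fps_nth (if i = j then ww - 1 else 0) r"
        using \<open>x \<in> unit_gens\<close> unfolding unit_gens_def by blast
      then show ?thesis using 1[of i j r] by (simp only:)
    qed
    then show ?thesis using unit_gens_CX by blast
  qed
  ultimately have "J \<subseteq> ?K" unfolding J_eq by (rule genideal_minimal)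
  then show "y \<in> J \<Longrightarrow> \<exists>x\<in>alg CX. y = rep x \<and> retr 1 x = 0" by blast
qed

lemma X_minus_retr_J: "x \<in> alg CX \<Longrightarrow> rep (x - retr 1 x) \<in> J"
proof -
  interpret calgebra "sub_rec (alg CX)" by (rule calgebra_sub_rec[OF nsubalg_alg alg.one])
  interpret J: ideal J "sub_rec (alg CX)" by (rule J_ideal)
  assume x: "x \<in> alg CX"
  let ?J = "{x. rep x \<in> J}"
  have sub: "a \<in> alg CX" if "rep a \<in> J" for a
    using J.a_subset that by (auto simp: X.eq_iff)
  have "x - retr 1 x \<in> ?J"
  proof (rule minus_retr_in_ideal[OF _ _ _ x])
    show "nsubalg ?J"
      unfolding nsubalg_def
    proof (intro conjI ballI allI; simp only: mem_Collect_eq)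
      show "rep 0 \<in> J" using J.zero_closed by (simp add: X.zero)
      fix a b assume ab: "rep a \<in> J" "rep b \<in> J"
      show "rep (a + b) \<in> J" using J.a_closed[OF ab] by (simp add: X.add)
      show "rep (a * b) \<in> J" using J.I_l_closed[OF ab(2), of "rep a"] sub[OF ab(1)] by (simp add: X.mult)
    next
      fix c a assume "rep a \<in> J"
      then show "rep (sc c * a) \<in> J" using ideal_smult[OF J_ideal, of "rep a" c] by (simp add: Rep_smult)
    qed
    show "a * x \<in> ?J \<and> x * a \<in> ?J" if "a \<in> alg CX" "x \<in> ?J" for a x
      using J.I_l_closed[of "rep x" "rep a"] J.I_r_closed[of "rep x" "rep a"] that by (simp add: X.mult)
    show "fps_nth ww n \<in> ?J" if "n > 0" for n using ww_J[OF that] by simp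
  qed
  then show ?thesis by simp
qed

text \<open>Injectivity: an element of the algebra of \<open>\<Sigma>\<close> that lies in the ideal is both fixed and killed
  by \<open>retr 1\<close>. Surjectivity: \<open>x\<close> and \<open>retr 1 x\<close> have the same class.\<close>

lemma Y_iso: "quot_map (X_tw g0 ty) J \<in> alg_iso (Y_tilde_tw g0 ty) (Y_tw g0 ty)"
proof -
  let ?A = "sub_rec (alg CX)"
  interpret calgebra ?A by (rule calgebra_sub_rec[OF nsubalg_alg alg.one])
  interpret u: unit_series 1 by (rule unit_series_1)
  note J = J_ideal
  let ?q = "quot_map ?A J" and ?B = "sub_rec (alg CY)"
  have YX: "alg CY \<subseteq> alg CX" by (rule alg_mono_alg[OF CY_CX])
  have cA: "x \<in> carrier ?A" if "x \<in> carrier ?B" for x using that YX by auto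
  have eq: "?q (rep x) = ?q (rep y) \<longleftrightarrow> rep (x - y) \<in> J" if "x \<in> alg CX" "y \<in> alg CX" for x y
    using quot_map_eq_iff[OF J, of "rep x" "rep y"] that sub_rec_diff[OF nsubalg_alg alg.one that] by simp
  have "bij_betw ?q (carrier ?B) (carrier (quot_alg ?A J))"
  proof (rule bij_betw_imageI)
    show "inj_on ?q (carrier ?B)"
    proof (rule inj_onI)
      fix a b assume ab: "a \<in> carrier ?B" "b \<in> carrier ?B" "?q a = ?q b"
      then obtain x y where x: "a = rep x" "x \<in> alg CY" and y: "b = rep y" "y \<in> alg CY" by auto
      have "rep (x - y) \<in> J" using eq[of x y] x y YX ab(3) by auto
      then obtain d where "rep (x - y) = rep d" "retr 1 d = 0" using J_retr by blast
      then have "retr 1 (x - y) = 0" by (simp add: X.eq_iff)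
      moreover have "retr 1 (x - y) = x - y"
        by (rule retr_on_Y[OF unit_series_1]) (rule nsubalgD(6)[OF nsubalg_alg x(2) y(2)])
      ultimately show "a = b" using x y by simp
    qed
    show "?q ` carrier ?B = carrier (quot_alg ?A J)"
    proof (intro equalityI subsetI)
      fix a assume "a \<in> ?q ` carrier ?B"
      then show "a \<in> carrier (quot_alg ?A J)" using quot_map_closed cA by blast
    next
      fix a assume "a \<in> carrier (quot_alg ?A J)"
      then obtain x where x: "x \<in> alg CX" "a = ?q (rep x)" unfolding quot_carrier by auto
      have r: "retr 1 x \<in> alg CY" by (rule retr_1_X[OF x(1)])
      have "?q (rep x) = ?q (rep (retr 1 x))" using eq[of x "retr 1 x"] X_minus_retr_J[OF x(1)] x(1) r YX by blast
      then show "a \<in> ?q ` carrier ?B" using r x(2) by auto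
    qed
  qed
  moreover have "?q \<in> ring_hom ?B (quot_alg ?A J)"
  proof (rule ring_hom_memI)
    fix x y assume x: "x \<in> carrier ?B"
    show "?q x \<in> carrier (quot_alg ?A J)" by (rule quot_map_closed[OF cA[OF x]])
    assume y: "y \<in> carrier ?B"
    show "?q (x \<otimes>\<^bsub>?B\<^esub> y) = ?q x \<otimes>\<^bsub>quot_alg ?A J\<^esub> ?q y"
      using quot_map_mult[OF J cA[OF x] cA[OF y]] by simp
    show "?q (x \<oplus>\<^bsub>?B\<^esub> y) = ?q x \<oplus>\<^bsub>quot_alg ?A J\<^esub> ?q y"
      using quot_map_add[OF J cA[OF x] cA[OF y]] by simp
  next
    show "?q \<one>\<^bsub>?B\<^esub> = \<one>\<^bsub>quot_alg ?A J\<^esub>" using quot_map_one[OF J] by simp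
  qed
  moreover have "?q (c \<odot>\<^bsub>?B\<^esub> x) = c \<odot>\<^bsub>quot_alg ?A J\<^esub> ?q x" if "x \<in> carrier ?B" for c x
    using quot_map_smult[OF J cA[OF that], of c] by simp
  ultimately show ?thesis
    unfolding X_tw_rec Y_tilde_rec Y_tw_def by (simp add: alg_iso_def ring_iso_def)
qed

end

section \<open>The tensor product\<close>

lemma bilin_relsI:
  "a \<in> carrier A \<Longrightarrow> a' \<in> carrier A \<Longrightarrow> b \<in> carrier B \<Longrightarrow>
    Poly_Mapping.single (a \<oplus>\<^bsub>A\<^esub> a', b) 1 - Poly_Mapping.single (a, b) 1 - Poly_Mapping.single (a', b) 1 \<in> bilin_rels A B"
  "a \<in> carrier A \<Longrightarrow> b \<in> carrier B \<Longrightarrow> b' \<in> carrier B \<Longrightarrow>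
    Poly_Mapping.single (a, b \<oplus>\<^bsub>B\<^esub> b') 1 - Poly_Mapping.single (a, b) 1 - Poly_Mapping.single (a, b') 1 \<in> bilin_rels A B"
  "a \<in> carrier A \<Longrightarrow> b \<in> carrier B \<Longrightarrow>
    Poly_Mapping.single (c \<odot>\<^bsub>A\<^esub> a, b) 1 - Poly_Mapping.single (a, b) c \<in> bilin_rels A B"
  "a \<in> carrier A \<Longrightarrow> b \<in> carrier B \<Longrightarrow>
    Poly_Mapping.single (a, c \<odot>\<^bsub>B\<^esub> b) 1 - Poly_Mapping.single (a, b) c \<in> bilin_rels A B"
  unfolding bilin_rels_def by blast+

context pair
begin

abbreviation "WA \<equiv> sub_rec (alg CW)"
abbreviation "YA \<equiv> sub_rec (alg CY)"
abbreviation "PA \<equiv> pair_alg WA YA"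
abbreviation "KA \<equiv> Idl\<^bsub>PA\<^esub> (bilin_rels WA YA)"

text \<open>Multiplication, as a map on formal linear combinations of pairs. It will be shown to be onto, with
  the ideal of the bilinearity relations as kernel.\<close>

definition mu :: "(free set \<times> free set \<Rightarrow>\<^sub>0 complex) \<Rightarrow> yang" where
  "mu = lin (\<lambda>p. Abs_yang (fst p) * Abs_yang (snd p))"

lemma mu_single: "mu (Poly_Mapping.single (rep a, rep b) c) = sc c * (a * b)"
  by (simp add: mu_def lin_single Rep_yang_inverse)

lemma WA: "calgebra WA" and YA: "calgebra YA"
  by (rule calgebra_sub_rec[OF nsubalg_alg alg.one])+

lemma PA: "calgebra PA"
  by (rule calgebra_pair_alg) (rule calgebra.axioms(1)[OF WA], rule calgebra.axioms(1)[OF YA])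

lemma PA_induct [consumes 1, case_names zero add single]:
  assumes "f \<in> carrier PA" "Q 0" "\<And>f g. Q f \<Longrightarrow> Q g \<Longrightarrow> Q (f + g)"
    "\<And>a b (c :: complex). a \<in> alg CW \<Longrightarrow> b \<in> alg CY \<Longrightarrow> Q (Poly_Mapping.single (rep a, rep b) c)"
  shows "Q f"
proof -
  have "Poly_Mapping.keys f \<subseteq> rep ` alg CW \<times> rep ` alg CY" using assms(1) by simp
  then show ?thesis by (induction rule: keys_induct) (use assms(2-) in auto)
qed

lemma mu_add: "mu (f + g) = mu f + mu g" and mu_zero: "mu 0 = 0"
  by (simp_all add: mu_def lin_add lin_zero)

lemma mu_X: "f \<in> carrier PA \<Longrightarrow> mu f \<in> alg CX"
proof (induction rule: PA_induct)
  case (single a b c)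
  then have "a \<in> alg CX" "b \<in> alg CX" using alg_mono_alg[OF CW_CX] alg_mono_alg[OF CY_CX] by auto
  then show ?case unfolding mu_single by (intro alg.scale alg.mult)
qed (auto simp: mu_add mu_zero nsubalgD(1)[OF nsubalg_alg] intro: alg.add)

lemma mu_mult:
  assumes "f \<in> carrier PA" "g \<in> carrier PA" shows "mu (f \<otimes>\<^bsub>PA\<^esub> g) = mu f * mu g"
  using assms(1)
proof (induction rule: PA_induct)
  case (single a b c)
  note ab = this
  show ?case using assms(2)
  proof (induction rule: PA_induct)
    case (single a' b' c')
    have "sc c * (a * b) * (sc c' * (a' * b')) = sc (c * c') * ((a * a') * (b * b'))"
    proof -
      have "sc c * (a * b) * (sc c' * (a' * b')) = sc c * (sc c' * (a * b * (a' * b')))"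
        by (simp only: mult.assoc central_left_commute[OF central_sc[of c']])
      also have "a * b * (a' * b') = (a * a') * (b * b')"
        by (simp only: mult.assoc central_left_commute[OF W_central[OF single(1)]])
      finally show ?thesis by (simp only: sc_mult mult.assoc)
    qed
    then show ?case by (simp add: pmul_single X.mult mu_single)
  qed (simp_all add: mu_zero mu_add pmul_add_right distrib_left)
qed (simp_all add: mu_zero mu_add pmul_add_left distrib_right)

lemma mu_smult: "f \<in> carrier PA \<Longrightarrow> mu (c \<odot>\<^bsub>PA\<^esub> f) = sc c * mu f"
  by (induction rule: PA_induct)
     (simp_all add: map_scale_zero map_scale_add map_scale_single mu_zero mu_add mu_single distrib_left sc_mult mult.assoc)

lemma mu_one: "mu \<one>\<^bsub>PA\<^esub> = 1"
  by (simp add: X.one mu_single sc_one)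

lemma mu_surj: "x \<in> alg CX \<Longrightarrow> \<exists>f\<in>carrier PA. mu f = x"
proof -
  interpret calgebra PA by (rule PA)
  let ?M = "mu ` carrier PA"
  have "alg CX \<subseteq> ?M"
  proof (rule alg_least)
    show n: "nsubalg ?M"
      unfolding nsubalg_def
    proof (intro conjI ballI allI)
      have "mu 0 \<in> ?M" by (rule imageI) (use zero_closed in simp)
      then show "0 \<in> ?M" unfolding mu_zero .
      fix x y assume x: "x \<in> ?M" and y: "y \<in> ?M"
      from x obtain f where f: "x = mu f" "f \<in> carrier PA" by (rule imageE)
      from y obtain g where g: "y = mu g" "g \<in> carrier PA" by (rule imageE)
      show "x + y \<in> ?M" unfolding f(1) g(1) mu_add[symmetric]
        by (rule imageI) (use a_closed[OF f(2) g(2)] in simp)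
      show "x * y \<in> ?M" unfolding f(1) g(1) mu_mult[OF f(2) g(2), symmetric]
        by (rule imageI) (rule m_closed[OF f(2) g(2)])
    next
      fix c x assume "x \<in> ?M"
      then obtain f where f: "x = mu f" "f \<in> carrier PA" by (rule imageE)
      show "sc c * x \<in> ?M" unfolding f(1) mu_smult[OF f(2), symmetric]
        by (rule imageI) (rule smult_closed[OF f(2)])
    qed
    show "1 \<in> ?M" unfolding mu_one[symmetric] by (rule imageI) (rule one_closed)
    show "CX \<subseteq> ?M"
    proof
      fix x assume "x \<in> CX"
      then obtain i j r where x: "x = fps_nth (SX i j) r" "i \<in> I0" "j \<in> I0" by (auto simp: CX_def)
      have "fps_nth qq k * fps_nth (SY i j) l \<in> ?M" for k l
      proof (rule image_eqI)
        show "fps_nth qq k * fps_nth (SY i j) l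
            = mu (Poly_Mapping.single (rep (fps_nth qq k), rep (fps_nth (SY i j) l)) 1)"
          unfolding mu_single sc_one mult_1_left by (rule refl)
        show "Poly_Mapping.single (rep (fps_nth qq k), rep (fps_nth (SY i j) l)) 1 \<in> carrier PA"
          using qq_in_CW[of k] SY_in[OF x(2,3), of l] by simp
      qed
      then have "(\<Sum>k=0..r. fps_nth qq k * fps_nth (SY i j) (r - k)) \<in> ?M" by (rule nsubalgD(7)[OF n])
      then show "x \<in> ?M" by (simp add: x(1) SX_SY fps_mult_nth)
    qed
  qed
  then have "x \<in> ?M" if "x \<in> alg CX" using that by (rule subsetD)
  then show "x \<in> alg CX \<Longrightarrow> \<exists>f\<in>carrier PA. mu f = x" by auto
qed

lemma KA_ideal: "ideal KA PA" and KA_rels: "bilin_rels WA YA \<subseteq> KA"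
proof -
  interpret calgebra PA by (rule PA)
  show "ideal KA PA" by (rule genideal_ideal[OF bilin_rels_carrier[OF WA YA]])
  show "bilin_rels WA YA \<subseteq> KA" by (rule genideal_self[OF bilin_rels_carrier[OF WA YA]])
qed

lemma PA_uminus: "f \<in> carrier PA \<Longrightarrow> \<ominus>\<^bsub>PA\<^esub> f = - f"
proof -
  interpret calgebra PA by (rule PA)
  assume f: "f \<in> carrier PA"
  then show ?thesis by (intro minus_equality) simp_all
qed

lemma KA_closed:
  shows "0 \<in> KA" "f \<in> KA \<Longrightarrow> g \<in> KA \<Longrightarrow> f + g \<in> KA" "f \<in> KA \<Longrightarrow> - f \<in> KA" "f \<in> KA \<Longrightarrow> g \<in> KA \<Longrightarrow> f - g \<in> KA"
    "(\<And>i. i \<in> A \<Longrightarrow> h i \<in> KA) \<Longrightarrow> sum h A \<in> KA"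
proof -
  interpret calgebra PA by (rule PA)
  interpret K: ideal KA PA by (rule KA_ideal)
  show 0: "0 \<in> KA" using K.zero_closed by simp
  show add: "f \<in> KA \<Longrightarrow> g \<in> KA \<Longrightarrow> f + g \<in> KA" for f g using K.a_closed[of f g] by simp
  show um: "f \<in> KA \<Longrightarrow> - f \<in> KA" for f using K.a_inv_closed[of f] PA_uminus[OF K.a_Hcarr, of f] by simp
  show "f \<in> KA \<Longrightarrow> g \<in> KA \<Longrightarrow> f - g \<in> KA" using add[of f "- g"] um[of g] by simp
  show "(\<And>i. i \<in> A \<Longrightarrow> h i \<in> KA) \<Longrightarrow> sum h A \<in> KA" by (rule sum_closed[OF 0 add])
qed

lemma mu_KA: "f \<in> KA \<Longrightarrow> f \<in> carrier PA \<and> mu f = 0"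
proof -
  interpret calgebra PA by (rule PA)
  let ?K = "{f \<in> carrier PA. mu f = 0}"
  have um: "mu (- f) = - mu f" for f using mu_add[of f "- f"] by (simp add: mu_zero eq_neg_iff_add_eq_0 add.commute)
  have df: "mu (f - g) = mu f - mu g" for f g using mu_add[of f "- g"] um[of g] by simp
  have "ideal ?K PA"
  proof (rule idealI[OF ring_axioms])
    show "subgroup ?K (add_monoid PA)"
    proof (rule add.subgroupI)
      show "?K \<subseteq> carrier PA" by blast
      have "0 \<in> ?K" using zero_closed by (simp add: mu_zero)
      then show "?K \<noteq> {}" by blast
    next
      fix a assume a: "a \<in> ?K"
      then show "\<ominus>\<^bsub>PA\<^esub> a \<in> ?K" using PA_uminus[of a] a_inv_closed[of a] um[of a] by simp
      fix b assume "b \<in> ?K"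
      then show "a \<oplus>\<^bsub>PA\<^esub> b \<in> ?K" using a a_closed[of a b] mu_add[of a b] by simp
    qed
  next
    fix a b assume "a \<in> ?K" "b \<in> carrier PA"
    then show "b \<otimes>\<^bsub>PA\<^esub> a \<in> ?K" "a \<otimes>\<^bsub>PA\<^esub> b \<in> ?K"
      using m_closed[of a b] m_closed[of b a] mu_mult[of a b] mu_mult[of b a] by auto
  qed
  moreover have "bilin_rels WA YA \<subseteq> ?K"
  proof
    fix f assume f: "f \<in> bilin_rels WA YA"
    have "mu f = 0"
      using f unfolding bilin_rels_def
    proof (elim UnE CollectE exE conjE)
      fix p q r assume "f = Poly_Mapping.single (p \<oplus>\<^bsub>WA\<^esub> q, r) 1 - Poly_Mapping.single (p, r) 1 - Poly_Mapping.single (q, r) 1"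
        "p \<in> carrier WA" "q \<in> carrier WA" "r \<in> carrier YA"
      then show ?thesis by (auto simp: df X.add mu_single sc_one distrib_right)
    next
      fix p q r assume "f = Poly_Mapping.single (p, q \<oplus>\<^bsub>YA\<^esub> r) 1 - Poly_Mapping.single (p, q) 1 - Poly_Mapping.single (p, r) 1"
        "p \<in> carrier WA" "q \<in> carrier YA" "r \<in> carrier YA"
      then show ?thesis by (auto simp: df X.add mu_single sc_one distrib_left)
    next
      fix c p q assume "f = Poly_Mapping.single (c \<odot>\<^bsub>WA\<^esub> p, q) 1 - Poly_Mapping.single (p, q) c"
        "p \<in> carrier WA" "q \<in> carrier YA"
      then show ?thesis by (auto simp: df mu_single sc_one Rep_smult[symmetric] mult.assoc)
    next
      fix c p q assume "f = Poly_Mapping.single (p, c \<odot>\<^bsub>YA\<^esub> q) 1 - Poly_Mapping.single (p, q) c"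
        "p \<in> carrier WA" "q \<in> carrier YA"
      then show ?thesis by (auto simp: df mu_single sc_one Rep_smult[symmetric] central_left_commute[OF central_sc[of c]])
    qed
    then show "f \<in> ?K" using f bilin_rels_carrier[OF WA YA] by blast
  qed
  ultimately have "KA \<subseteq> ?K" by (rule genideal_minimal)
  then show "f \<in> KA \<Longrightarrow> f \<in> carrier PA \<and> mu f = 0" by blast
qed

definition ten :: "yang \<Rightarrow> yang \<Rightarrow> free set \<times> free set \<Rightarrow>\<^sub>0 complex" where
  "ten a b = Poly_Mapping.single (rep a, rep b) 1"

lemma ten_rels:
  assumes "a \<in> alg CW" "b \<in> alg CY"
  shows "a' \<in> alg CW \<Longrightarrow> ten (a + a') b - ten a b - ten a' b \<in> KA"
    and "b' \<in> alg CY \<Longrightarrow> ten a (b + b') - ten a b - ten a b' \<in> KA"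
    and "ten (sc c * a) b - Poly_Mapping.single (rep a, rep b) c \<in> KA"
    and "ten a (sc c * b) - Poly_Mapping.single (rep a, rep b) c \<in> KA"
proof -
  have m: "rep a \<in> carrier WA" "rep b \<in> carrier YA" using assms by simp_all
  show "ten (a + a') b - ten a b - ten a' b \<in> KA" if "a' \<in> alg CW"
    using subsetD[OF KA_rels bilin_relsI(1)[OF m(1) _ m(2), of "rep a'"]] that by (simp add: ten_def X.add)
  show "ten a (b + b') - ten a b - ten a b' \<in> KA" if "b' \<in> alg CY"
    using subsetD[OF KA_rels bilin_relsI(2)[OF m(1) m(2), of "rep b'"]] that by (simp add: ten_def X.add)
  show "ten (sc c * a) b - Poly_Mapping.single (rep a, rep b) c \<in> KA"
    using subsetD[OF KA_rels bilin_relsI(3)[OF m, of c]] by (simp add: ten_def Rep_smult)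
  show "ten a (sc c * b) - Poly_Mapping.single (rep a, rep b) c \<in> KA"
    using subsetD[OF KA_rels bilin_relsI(4)[OF m, of c]] by (simp add: ten_def Rep_smult)
qed

lemma ten_zero: 
  assumes "a \<in> alg CW" "b \<in> alg CY" shows "ten 0 b \<in> KA" "ten a 0 \<in> KA"
proof -
  note z = nsubalgD(1)[OF nsubalg_alg]
  show "ten 0 b \<in> KA" using KA_closed(3)[OF ten_rels(1)[OF z assms(2) z]] by simp
  show "ten a 0 \<in> KA" using KA_closed(3)[OF ten_rels(2)[OF assms(1) z z]] by simp
qed

lemma ten_sum:
  assumes "a \<in> alg CW" "finite S" "\<And>i. i \<in> S \<Longrightarrow> y i \<in> alg CY"
  shows "ten a (\<Sum>i\<in>S. y i) - (\<Sum>i\<in>S. ten a (y i)) \<in> KA"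
  using assms(2,3)
proof (induction S rule: finite_induct)
  case empty
  then show ?case using ten_zero(2)[OF assms(1) alg.one] by simp
next
  case (insert j S)
  have s: "(\<Sum>i\<in>S. y i) \<in> alg CY" using insert by (intro nsubalgD(7)[OF nsubalg_alg]) auto
  have "ten a (y j + (\<Sum>i\<in>S. y i)) - ten a (y j) - ten a (\<Sum>i\<in>S. y i) \<in> KA"
    using insert by (intro ten_rels(2) assms(1) s) auto
  moreover have "ten a (\<Sum>i\<in>S. y i) - (\<Sum>i\<in>S. ten a (y i)) \<in> KA" using insert by auto
  ultimately have "(ten a (y j + (\<Sum>i\<in>S. y i)) - ten a (y j) - ten a (\<Sum>i\<in>S. y i)) + (ten a (\<Sum>i\<in>S. y i) - (\<Sum>i\<in>S. ten a (y i))) \<in> KA"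
    by (rule KA_closed(2))
  then show ?case using insert.hyps by (simp add: algebra_simps)
qed

text \<open>The case of a nonzero \<open>a\<^sub>j\<close>: a character that does not vanish on \<open>a\<^sub>j\<close> turns the relation into
  a scalar one, which expresses \<open>y\<^sub>j\<close> by the other \<open>y\<^sub>i\<close>. Substituting this for \<open>y\<^sub>j\<close> removes the \<open>j\<close>-th
  term, both in the algebra and in the tensor product, at the cost of changing the remaining \<open>a\<^sub>i\<close>.\<close>

lemma tensor_independence:
  "finite S \<Longrightarrow> (\<And>i. i \<in> S \<Longrightarrow> a i \<in> alg CW \<and> y i \<in> alg CY) \<Longrightarrow> (\<Sum>i\<in>S. a i * y i) = 0 \<Longrightarrow> (\<Sum>i\<in>S. ten (a i) (y i)) \<in> KA"
proof (induction "card S" arbitrary: S a)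
  case 0
  then show ?case using KA_closed(1) by simp
next
  case (Suc n)
  show ?case
  proof (cases "\<forall>i\<in>S. a i = 0")
    case True
    then show ?thesis
      using Suc.prems(2) ten_zero(1)[OF alg.one] by (intro KA_closed(5)) auto
  next
    case False
    then obtain j where j: "j \<in> S" "a j \<noteq> 0" by blast
    obtain f where f: "unit_series f" "retr f (a j) \<noteq> 0" using W_separated[of "a j"] Suc.prems(2)[OF j(1)] j(2) by blast
    interpret f: unit_series f by (rule f(1))
    have "\<forall>i\<in>S. \<exists>c. retr f (a i) = sc c" using W_scalar[OF _ f(1)] Suc.prems(2) by blast
    then obtain c where c: "\<And>i. i \<in> S \<Longrightarrow> retr f (a i) = sc (c i)" by metis
    have cj: "c j \<noteq> 0" using c[OF j(1)] f(2) by (auto simp: sc.zero)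
    let ?T = "S - {j}"
    have T: "finite ?T" "card ?T = n" "n = card ?T" using Suc.hyps(2) Suc.prems(1) j(1) by auto
    \<comment> \<open>Under the character, the relation reads \<open>y j = \<Sum>i\<noteq>j. d i * y i\<close>; substitution into the original
      relation leaves the coefficients \<open>b i = a i + d i * a j\<close>.\<close>
    define d where "d = (\<lambda>i. - c i / c j)"
    have "0 = retr f (\<Sum>i\<in>S. a i * y i)" using Suc.prems(3) by (simp add: f.retr.zero)
    also have "\<dots> = (\<Sum>i\<in>S. sc (c i) * y i)"
      using Suc.prems(2) retr_on_Y[OF f(1)] by (simp add: f.retr.sum f.retr.mult c)
    also have "\<dots> = sc (c j) * y j + (\<Sum>i\<in>?T. sc (c i) * y i)"
      using Suc.prems(1) j(1) by (simp add: sum.remove)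
    finally have "sc (c j) * y j = - (\<Sum>i\<in>?T. sc (c i) * y i)"
      unfolding eq_neg_iff_add_eq_0 by (rule sym)
    then have "sc (1 / c j) * (sc (c j) * y j) = sc (1 / c j) * - (\<Sum>i\<in>?T. sc (c i) * y i)"
      by (rule arg_cong)
    also have "sc (1 / c j) * (sc (c j) * y j) = y j"
      using cj by (simp add: mult.assoc[symmetric] sc_mult[symmetric] sc_one)
    also have "sc (1 / c j) * - (\<Sum>i\<in>?T. sc (c i) * y i) = (\<Sum>i\<in>?T. sc (d i) * y i)"
    proof -
      have "- (sc (1 / c j) * (sc (c i) * y i)) = sc (d i) * y i" for i
      proof -
        have "d i = - (1 / c j * c i)" by (simp add: d_def)
        then show ?thesis by (simp only: sc.uminus sc_mult mult.assoc mult_minus_left)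
      qed
      then show ?thesis by (simp add: sum_distrib_left sum_negf[symmetric])
    qed
    finally have yj: "y j = (\<Sum>i\<in>?T. sc (d i) * y i)" .
    have aj: "a j \<in> alg CW" using Suc.prems(2)[OF j(1)] by blast
    define b where "b = (\<lambda>i. a i + sc (d i) * a j)"
    have b: "b i \<in> alg CW" if "i \<in> ?T" for i
      unfolding b_def using Suc.prems(2)[of i] that aj by (intro alg.add alg.scale) auto
    have yT: "y i \<in> alg CY" if "i \<in> ?T" for i using Suc.prems(2)[of i] that by auto
    have aT: "a i \<in> alg CW" if "i \<in> ?T" for i using Suc.prems(2)[of i] that by auto
    have "(\<Sum>i\<in>?T. b i * y i) = (\<Sum>i\<in>?T. a i * y i) + (\<Sum>i\<in>?T. a j * (sc (d i) * y i))"
      unfolding b_def sum.distrib[symmetric]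
    proof (intro sum.cong refl)
      fix i
      have "a j * (sc (d i) * y i) = sc (d i) * (a j * y i)" by (rule central_left_commute[OF central_sc])
      then show "(a i + sc (d i) * a j) * y i = a i * y i + a j * (sc (d i) * y i)" by (simp only: distrib_right mult.assoc)
    qed
    also have "(\<Sum>i\<in>?T. a j * (sc (d i) * y i)) = a j * y j" unfolding yj by (simp add: sum_distrib_left)
    also have "(\<Sum>i\<in>?T. a i * y i) + a j * y j = 0"
      using Suc.prems(1,3) j(1) by (simp add: sum.remove add.commute)
    finally have "(\<Sum>i\<in>?T. ten (b i) (y i)) \<in> KA"
      by (intro Suc.hyps(1)[OF T(3) T(1)]) (use b yT in auto)
    moreover have "(\<Sum>i\<in>S. ten (a i) (y i)) - (\<Sum>i\<in>?T. ten (b i) (y i)) \<in> KA"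
    proof -
      have 1: "ten (a j) (y j) - (\<Sum>i\<in>?T. ten (a j) (sc (d i) * y i)) \<in> KA"
        by (subst (1) yj) (rule ten_sum[OF aj T(1)], intro alg.scale yT)
      have 2: "ten (a j) (sc (d i) * y i) - ten (sc (d i) * a j) (y i) \<in> KA" if "i \<in> ?T" for i
        using KA_closed(4)[OF ten_rels(4)[OF aj yT[OF that], of "d i"] ten_rels(3)[OF aj yT[OF that], of "d i"]] by simp
      have 3: "ten (b i) (y i) - ten (a i) (y i) - ten (sc (d i) * a j) (y i) \<in> KA" if "i \<in> ?T" for i
        unfolding b_def by (rule ten_rels(1)[OF aT[OF that] yT[OF that] alg.scale[OF aj]])
      have "(ten (a j) (sc (d i) * y i) - ten (sc (d i) * a j) (y i)) - (ten (b i) (y i) - ten (a i) (y i) - ten (sc (d i) * a j) (y i)) \<in> KA"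
        if "i \<in> ?T" for i by (rule KA_closed(4)[OF 2[OF that] 3[OF that]])
      moreover have "(p - s) - (u - v - s) = p - u + v" for p s u v :: "free set \<times> free set \<Rightarrow>\<^sub>0 complex" by simp
      ultimately have "ten (a j) (sc (d i) * y i) - ten (b i) (y i) + ten (a i) (y i) \<in> KA" if "i \<in> ?T" for i
        using that by (simp only:)
      then have "(\<Sum>i\<in>?T. ten (a j) (sc (d i) * y i) - ten (b i) (y i) + ten (a i) (y i)) \<in> KA"
        by (rule KA_closed(5))
      from KA_closed(2)[OF 1 this]
      have "ten (a j) (y j) + (\<Sum>i\<in>?T. ten (a i) (y i)) - (\<Sum>i\<in>?T. ten (b i) (y i)) \<in> KA"
        by (simp add: sum.distrib sum_subtractf algebra_simps)
      then show ?thesis using Suc.prems(1) j(1) by (simp add: sum.remove)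
    qed
    ultimately show ?thesis using KA_closed(2) by fastforce
  qed
qed

lemma mu_zero_iff: 
  assumes "f \<in> carrier PA" shows "mu f = 0 \<longleftrightarrow> f \<in> KA"
proof
  assume m: "mu f = 0"
  let ?S = "Poly_Mapping.keys f"
  define y where "y = (\<lambda>p :: free set \<times> free set. Abs_yang (snd p))"
  define x where "x = (\<lambda>p :: free set \<times> free set. Abs_yang (fst p))"
  define a where "a = (\<lambda>p. sc (Poly_Mapping.lookup f p) * x p)"
  have p: "p = (rep (x p), rep (y p))" "x p \<in> alg CW" "y p \<in> alg CY" if pS: "p \<in> ?S" for p
  proof -
    have "p \<in> rep ` alg CW \<times> rep ` alg CY" using assms pS by auto
    then show "p = (rep (x p), rep (y p))" "x p \<in> alg CW" "y p \<in> alg CY"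
      by (auto simp: x_def y_def Rep_yang_inverse)
  qed
  have "(\<Sum>p\<in>?S. a p * y p) = 0"
    using m by (simp add: mu_def lin_def a_def x_def y_def mult.assoc)
  then have 1: "(\<Sum>p\<in>?S. ten (a p) (y p)) \<in> KA"
    by (intro tensor_independence) (use p in \<open>auto simp: a_def intro: alg.scale\<close>)
  have "(\<Sum>p\<in>?S. ten (a p) (y p) - Poly_Mapping.single p (Poly_Mapping.lookup f p)) \<in> KA"
  proof (rule KA_closed(5))
    fix q assume q: "q \<in> ?S"
    show "ten (a q) (y q) - Poly_Mapping.single q (Poly_Mapping.lookup f q) \<in> KA"
      using ten_rels(3)[OF p(2,3)[OF q], of "Poly_Mapping.lookup f q"] p(1)[OF q] unfolding a_def by metis
  qed
  then have "(\<Sum>p\<in>?S. ten (a p) (y p)) - f \<in> KA"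
    unfolding sum_subtractf poly_mapping_sum_single[symmetric] .
  from KA_closed(4)[OF 1 this] show "f \<in> KA" by simp
next
  assume "f \<in> KA" then show "mu f = 0" using mu_KA by blast
qed

lemma tensor_iso: "\<exists>\<phi>. \<phi> \<in> alg_iso (X_tw g0 ty) (tensor_alg (W_tw g0 ty) (Y_tilde_tw g0 ty))"
  unfolding X_tw_rec W_tw_rec Y_tilde_rec tensor_alg_def
proof (rule calgebra_first_iso[where h = "\<lambda>f. rep (mu f)"])
  show "calgebra PA" by (rule PA)
  show "calgebra (sub_rec (alg CX))" by (rule calgebra_sub_rec[OF nsubalg_alg alg.one])
  show "ideal KA PA" by (rule KA_ideal)
  show "(\<lambda>f. rep (mu f)) ` carrier PA = carrier (sub_rec (alg CX))"
  proof (intro equalityI subsetI)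
    fix x assume "x \<in> (\<lambda>f. rep (mu f)) ` carrier PA"
    then show "x \<in> carrier (sub_rec (alg CX))" using mu_X by auto
  next
    fix x assume "x \<in> carrier (sub_rec (alg CX))"
    then obtain a where "x = rep a" "a \<in> alg CX" by auto
    then show "x \<in> (\<lambda>f. rep (mu f)) ` carrier PA" using mu_surj[of a] by blast
  qed
  fix x assume x: "x \<in> carrier PA"
  show "rep (mu x) = \<zero>\<^bsub>sub_rec (alg CX)\<^esub> \<longleftrightarrow> x \<in> KA"
    using mu_zero_iff[OF x] by (simp add: X.zero X.eq_iff)
  show "rep (mu (c \<odot>\<^bsub>PA\<^esub> x)) = c \<odot>\<^bsub>sub_rec (alg CX)\<^esub> rep (mu x)" for c
    unfolding mu_smult[OF x] by (simp add: Rep_smult)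
  fix y assume y: "y \<in> carrier PA"
  show "rep (mu (x \<oplus>\<^bsub>PA\<^esub> y)) = rep (mu x) \<oplus>\<^bsub>sub_rec (alg CX)\<^esub> rep (mu y)"
    by (simp add: mu_add X.add)
  show "rep (mu (x \<otimes>\<^bsub>PA\<^esub> y)) = rep (mu x) \<otimes>\<^bsub>sub_rec (alg CX)\<^esub> rep (mu y)"
    unfolding mu_mult[OF x y] by (simp add: X.mult)
next
  show "rep (mu \<one>\<^bsub>PA\<^esub>) = \<one>\<^bsub>sub_rec (alg CX)\<^esub>"
    unfolding mu_one by (simp add: X.one)
qed

lemma csubalg_Y: "csubalg (carrier (Y_tilde_tw g0 ty)) (X_tw g0 ty)"
  unfolding X_tw_rec Y_tilde_rec
  using csubalg_sub_rec[OF nsubalg_alg alg.one nsubalg_alg alg.one alg_mono_alg[OF CY_CX]] by simp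

lemma claim_g0: "claim g0 ty"
  unfolding claim_def using csubalg_Y Y_iso tensor_iso by blast

end

theorem theorem3p1:
  fixes g :: lie_type and ty :: pair_type
  assumes "symmetric_pair g ty"
  shows "csubalg (carrier (Y_tilde_tw g ty)) (X_tw g ty) \<and>
         quot_map (X_tw g ty) (unitarity_ideal g ty) \<in> alg_iso (Y_tilde_tw g ty) (Y_tw g ty) \<and>
         (\<exists>\<phi>. \<phi> \<in> alg_iso (X_tw g ty) (tensor_alg (W_tw g ty) (Y_tilde_tw g ty)))"
proof -
  have "claim g ty"
  proof (rule claim_generic[OF _ assms])
    fix ty assume "symmetric_pair g0 ty"
    then interpret pair ty by unfold_locales
    show "claim g0 ty" by (rule claim_g0)
  qed
  then show ?thesis unfolding claim_def .
qed

end
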